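(* Let $\kappa$ be an infinite cardinal. The pair $(\mathcal A_\kappa,\tau_\kappa)$ is isomorphic, as a von Neumann measure algebra, to $(L^\infty(\Omega_\kappa,\Sigma_\kappa,\nu_\kappa),\sigma_\kappa)$, where $\sigma_\kappa(a)=\int_{\Omega_\kappa}a\,d\nu_\kappa$ for $a\in L^\infty(\Omega_\kappa,\Sigma_\kappa,\nu_\kappa)$.
   Context: Pairs $(M_1,\varphi_1)$ and $(M_2,\varphi_2)$ of $W^*$-algebras with faithful normal semifinite weights are isomorphic (as von Neumann measure algebras) if there is a $*$-isomorphism $\Phi:M_1\to M_2$ with $\varphi_1=\varphi_2\circ\Phi$ on $(M_1)_+$. $(\mathcal A_\kappa,\tau_\kappa)$ is the infinite tensor product of $\kappa$ copies of $(\mathbb C^2,\tau)$, $\tau(a,b)=\frac12(a+b)$: let $A_\kappa$ be the $C^*$-inductive limit of the finite tensor products $\bigotimes_{i\in F}\mathbb C^2$ over finite $F\subset\kappa$ with connecting maps $a\mapsto a\otimes 1$; let $\varphi_\kappa$ be the product state, determined by $\varphi_\kappa(\bigotimes_{i\in F}a_i)=\prod_{i\in F}\tau(a_i)$; let $\pi$ be the GNS representation of $\varphi_\kappa$ with cyclic vector $\xi$; then $\mathcal A_\kappa=\pi(A_\kappa)''$ and $\tau_\kappa(x)=\langle x\xi,\xi\rangle$. $\Omega_\kappa=\{0,1\}^\kappa$ with the product topology, and $\nu_\kappa$ is the product measure: the Radon probability measure on $\Omega_\kappa$ (regular, defined on the completion $\Sigma_\kappa$ of the Borel $\sigma$-algebra)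 such that $\nu_\kappa(C)=2^{-k}$ for every cylinder $C=\prod_i E_i$ with all $E_i\subset\{0,1\}$ nonempty and exactly $k<\infty$ of the $E_i$ different from $\{0,1\}$. *)

theory Defs
  imports "HOL-Analysis.Analysis" "HOL-Algebra.Module" "HOL-Algebra.QuotRing"
begin

section \<open>C*-algebras, W*-algebras and weights\<close>

definition complex_ring :: "complex ring" where
  "complex_ring = \<lparr>carrier = UNIV, mult = (*), one = 1, zero = 0, add = (+)\<rparr>"

record 'a star_alg = "(complex, 'a) module" +
  star :: "'a \<Rightarrow> 'a"
  nrm :: "'a \<Rightarrow> real"

definition cauchy_seqs :: "('a, 'm) ring_scheme \<Rightarrow> ('a \<Rightarrow> real) \<Rightarrow> (nat \<Rightarrow> 'a) set" where
  "cauchy_seqs B p = {s. (\<forall>n. s n \<in> carrier B) \<and>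
     (\<forall>e>0. \<exists>N. \<forall>m\<ge>N. \<forall>n\<ge>N. p (s m \<ominus>\<^bsub>B\<^esub> s n) < e)}"

locale cstar_algebra = ring M for M :: "'a star_alg" (structure) +
  assumes complex_module: "module complex_ring M"
    and smult_mult_left: "\<And>c x y. x \<in> carrier M \<Longrightarrow> y \<in> carrier M \<Longrightarrow> (c \<odot> x) \<otimes> y = c \<odot> (x \<otimes> y)"
    and smult_mult_right: "\<And>c x y. x \<in> carrier M \<Longrightarrow> y \<in> carrier M \<Longrightarrow> x \<otimes> (c \<odot> y) = c \<odot> (x \<otimes> y)"
    and star_closed: "\<And>x. x \<in> carrier M \<Longrightarrow> star M x \<in> carrier M"
    and star_star: "\<And>x. x \<in> carrier M \<Longrightarrow> star M (star M x) = x"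
    and star_add: "\<And>x y. x \<in> carrier M \<Longrightarrow> y \<in> carrier M \<Longrightarrow> star M (x \<oplus> y) = star M x \<oplus> star M y"
    and star_smult: "\<And>c x. x \<in> carrier M \<Longrightarrow> star M (c \<odot> x) = cnj c \<odot> star M x"
    and star_mult: "\<And>x y. x \<in> carrier M \<Longrightarrow> y \<in> carrier M \<Longrightarrow> star M (x \<otimes> y) = star M y \<otimes> star M x"
    and nrm_nonneg: "\<And>x. x \<in> carrier M \<Longrightarrow> 0 \<le> nrm M x"
    and nrm_eq_0: "\<And>x. x \<in> carrier M \<Longrightarrow> nrm M x = 0 \<longleftrightarrow> x = \<zero>"
    and nrm_triangle: "\<And>x y. x \<in> carrier M \<Longrightarrow> y \<in> carrier M \<Longrightarrow> nrm M (x \<oplus> y) \<le> nrm M x + nrm M y"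
    and nrm_smult: "\<And>c x. x \<in> carrier M \<Longrightarrow> nrm M (c \<odot> x) = cmod c * nrm M x"
    and nrm_mult: "\<And>x y. x \<in> carrier M \<Longrightarrow> y \<in> carrier M \<Longrightarrow> nrm M (x \<otimes> y) \<le> nrm M x * nrm M y"
    and cstar_identity: "\<And>x. x \<in> carrier M \<Longrightarrow> nrm M (star M x \<otimes> x) = (nrm M x)\<^sup>2"
    and complete: "\<And>s. s \<in> cauchy_seqs M (nrm M) \<Longrightarrow>
           \<exists>x\<in>carrier M. (\<lambda>n. nrm M (s n \<ominus> x)) \<longlonglongrightarrow> 0"

definition pos :: "'a star_alg \<Rightarrow> 'a set" where
  "pos M = {star M x \<otimes>\<^bsub>M\<^esub> x |x. x \<in> carrier M}"

definition le_alg :: "'a star_alg \<Rightarrow> 'a \<Rightarrow> 'a \<Rightarrow> bool" where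
  "le_alg M x y \<longleftrightarrow> y \<ominus>\<^bsub>M\<^esub> x \<in> pos M"

definition dual_norm :: "'a star_alg \<Rightarrow> ('a \<Rightarrow> complex) \<Rightarrow> real" where
  "dual_norm M \<omega> = Inf {C. 0 \<le> C \<and> (\<forall>x\<in>carrier M. cmod (\<omega> x) \<le> C * nrm M x)}"

definition bounded_functionals :: "'a star_alg \<Rightarrow> ('a \<Rightarrow> complex) set" where
  "bounded_functionals M = {\<omega> \<in> extensional (carrier M).
     (\<forall>x\<in>carrier M. \<forall>y\<in>carrier M. \<omega> (x \<oplus>\<^bsub>M\<^esub> y) = \<omega> x + \<omega> y) \<and>
     (\<forall>c. \<forall>x\<in>carrier M. \<omega> (c \<odot>\<^bsub>M\<^esub> x) = c * \<omega> x) \<and>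
     (\<exists>C. \<forall>x\<in>carrier M. cmod (\<omega> x) \<le> C * nrm M x)}"

definition is_state :: "'a star_alg \<Rightarrow> ('a \<Rightarrow> complex) \<Rightarrow> bool" where
  "is_state M \<omega> \<longleftrightarrow> \<omega> \<in> bounded_functionals M \<and>
     (\<forall>x\<in>pos M. \<omega> x \<in> \<real> \<and> 0 \<le> Re (\<omega> x)) \<and> dual_norm M \<omega> = 1"

(* Any normed space with dual M embeds isometrically into the dual of M, so a predual is rendered
   as a linear space E of bounded functionals for which evaluation M -> E* is an isometric
   bijection. Closedness of E is not demanded: a normed space and its completion have the same
   dual, so the norm closure of E is then a Banach space predual. *)
definition is_predual :: "'a star_alg \<Rightarrow> ('a \<Rightarrow> complex) set \<Rightarrow> bool" where
  "is_predual M E \<longleftrightarrow> E \<subseteq> bounded_functionals M \<and> (\<lambda>x\<in>carrier M. 0) \<in> E \<and>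
     (\<forall>\<omega>\<in>E. \<forall>\<psi>\<in>E. (\<lambda>x\<in>carrier M. \<omega> x + \<psi> x) \<in> E) \<and>
     (\<forall>c. \<forall>\<omega>\<in>E. (\<lambda>x\<in>carrier M. c * \<omega> x) \<in> E) \<and>
     (\<forall>x\<in>carrier M. nrm M x = Inf {C. 0 \<le> C \<and> (\<forall>\<omega>\<in>E. cmod (\<omega> x) \<le> C * dual_norm M \<omega>)}) \<and>
     (\<forall>\<Lambda> :: ('a \<Rightarrow> complex) \<Rightarrow> complex.
        (\<forall>\<omega>\<in>E. \<forall>\<psi>\<in>E. \<Lambda> (\<lambda>x\<in>carrier M. \<omega> x + \<psi> x) = \<Lambda> \<omega> + \<Lambda> \<psi>) \<and>
        (\<forall>c. \<forall>\<omega>\<in>E. \<Lambda> (\<lambda>x\<in>carrier M. c * \<omega> x) = c * \<Lambda> \<omega>) \<and>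
        (\<exists>C. \<forall>\<omega>\<in>E. cmod (\<Lambda> \<omega>) \<le> C * dual_norm M \<omega>) \<longrightarrow>
        (\<exists>x\<in>carrier M. \<forall>\<omega>\<in>E. \<Lambda> \<omega> = \<omega> x))"

definition wstar_algebra :: "'a star_alg \<Rightarrow> bool" where
  "wstar_algebra M \<longleftrightarrow> cstar_algebra M \<and> (\<exists>E. is_predual M E)"

text \<open>Only the values of a weight on \<^term>\<open>pos M\<close> matter.\<close>

definition weight :: "'a star_alg \<Rightarrow> ('a \<Rightarrow> ennreal) \<Rightarrow> bool" where
  "weight M \<phi> \<longleftrightarrow>
     (\<forall>x\<in>pos M. \<forall>y\<in>pos M. \<phi> (x \<oplus>\<^bsub>M\<^esub> y) = \<phi> x + \<phi> y) \<and>
     (\<forall>t\<ge>0. \<forall>x\<in>pos M. \<phi> (complex_of_real t \<odot>\<^bsub>M\<^esub> x) = ennreal t * \<phi> x)"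

definition faithful_weight :: "'a star_alg \<Rightarrow> ('a \<Rightarrow> ennreal) \<Rightarrow> bool" where
  "faithful_weight M \<phi> \<longleftrightarrow> (\<forall>x\<in>pos M. \<phi> x = 0 \<longrightarrow> x = \<zero>\<^bsub>M\<^esub>)"

definition normal_weight :: "'a star_alg \<Rightarrow> ('a \<Rightarrow> ennreal) \<Rightarrow> bool" where
  "normal_weight M \<phi> \<longleftrightarrow> (\<forall>D x. D \<subseteq> pos M \<and> D \<noteq> {} \<and>
       (\<forall>a\<in>D. \<forall>b\<in>D. \<exists>c\<in>D. le_alg M a c \<and> le_alg M b c) \<and>
       x \<in> pos M \<and> (\<forall>a\<in>D. le_alg M a x) \<and>
       (\<forall>y\<in>pos M. (\<forall>a\<in>D. le_alg M a y) \<longrightarrow> le_alg M x y) \<longrightarrow>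
       \<phi> x = (SUP a\<in>D. \<phi> a))"

(* The left ideal of all x with \<phi>(x* x) finite is dense in the weak topology sigma(M,E). As the
   predual of a W*-algebra is unique, the choice of E is immaterial. *)
definition semifinite_weight :: "'a star_alg \<Rightarrow> ('a \<Rightarrow> ennreal) \<Rightarrow> bool" where
  "semifinite_weight M \<phi> \<longleftrightarrow> (\<forall>E. is_predual M E \<longrightarrow>
     (\<forall>x\<in>carrier M. \<forall>F e. finite F \<and> F \<subseteq> E \<and> e > 0 \<longrightarrow>
        (\<exists>y\<in>carrier M. \<phi> (star M y \<otimes>\<^bsub>M\<^esub> y) < \<infinity> \<and> (\<forall>\<omega>\<in>F. cmod (\<omega> x - \<omega> y) < e))))"

definition vn_measure_algebra :: "'a star_alg \<Rightarrow> ('a \<Rightarrow> ennreal) \<Rightarrow> bool" where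
  "vn_measure_algebra M \<phi> \<longleftrightarrow> wstar_algebra M \<and> weight M \<phi> \<and>
     faithful_weight M \<phi> \<and> normal_weight M \<phi> \<and> semifinite_weight M \<phi>"

definition star_isos :: "'a star_alg \<Rightarrow> 'b star_alg \<Rightarrow> ('a \<Rightarrow> 'b) set" where
  "star_isos M N = {\<Phi> \<in> ring_iso M N.
     (\<forall>c. \<forall>x\<in>carrier M. \<Phi> (c \<odot>\<^bsub>M\<^esub> x) = c \<odot>\<^bsub>N\<^esub> \<Phi> x) \<and>
     (\<forall>x\<in>carrier M. \<Phi> (star M x) = star N (\<Phi> x))}"

definition vn_measure_isomorphic ::
    "'a star_alg \<times> ('a \<Rightarrow> ennreal) \<Rightarrow> 'b star_alg \<times> ('b \<Rightarrow> ennreal) \<Rightarrow> bool" where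
  "vn_measure_isomorphic = (\<lambda>(M\<^sub>1, \<phi>\<^sub>1) (M\<^sub>2, \<phi>\<^sub>2).
     vn_measure_algebra M\<^sub>1 \<phi>\<^sub>1 \<and> vn_measure_algebra M\<^sub>2 \<phi>\<^sub>2 \<and>
     (\<exists>\<Phi>\<in>star_isos M\<^sub>1 M\<^sub>2. \<forall>x\<in>pos M\<^sub>1. \<phi>\<^sub>1 x = \<phi>\<^sub>2 (\<Phi> x)))"

text \<open>A positive linear functional takes values in \<open>[0,\<infinity>)\<close> on positive elements, so nothing is lost
  by taking real parts here.\<close>

definition functional_weight :: "('a \<Rightarrow> complex) \<Rightarrow> 'a \<Rightarrow> ennreal" where
  "functional_weight \<tau> x = ennreal (Re (\<tau> x))"


section \<open>Inductive limits and completions\<close>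

text \<open>The Hausdorff completion of \<open>B\<close> for a seminorm \<open>p\<close> consists of the \<open>p\<close>-Cauchy sequences modulo
  \<open>p\<close>-null sequences, so it includes the passage to the quotient by the kernel of \<open>p\<close>.\<close>

definition cauchy_class :: "('a, 'm) ring_scheme \<Rightarrow> ('a \<Rightarrow> real) \<Rightarrow> (nat \<Rightarrow> 'a) \<Rightarrow> (nat \<Rightarrow> 'a) set" where
  "cauchy_class B p s = {t \<in> cauchy_seqs B p. (\<lambda>n. p (s n \<ominus>\<^bsub>B\<^esub> t n)) \<longlonglongrightarrow> 0}"

definition hausdorff_completion :: "'a star_alg \<Rightarrow> (nat \<Rightarrow> 'a) set star_alg" where
  "hausdorff_completion B = (let cl = cauchy_class B (nrm B) in
     \<lparr>carrier = cl ` cauchy_seqs B (nrm B),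
      mult = (\<lambda>X Y. \<Union>s\<in>X. \<Union>t\<in>Y. cl (\<lambda>n. s n \<otimes>\<^bsub>B\<^esub> t n)),
      one = cl (\<lambda>n. \<one>\<^bsub>B\<^esub>),
      zero = cl (\<lambda>n. \<zero>\<^bsub>B\<^esub>),
      add = (\<lambda>X Y. \<Union>s\<in>X. \<Union>t\<in>Y. cl (\<lambda>n. s n \<oplus>\<^bsub>B\<^esub> t n)),
      smult = (\<lambda>c X. \<Union>s\<in>X. cl (\<lambda>n. c \<odot>\<^bsub>B\<^esub> s n)),
      star = (\<lambda>X. \<Union>s\<in>X. cl (\<lambda>n. star B (s n))),
      nrm = (\<lambda>X. THE r. \<forall>s\<in>X. (\<lambda>n. nrm B (s n)) \<longlonglongrightarrow> r)\<rparr>)"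

definition limit_class ::
    "'d::order set \<Rightarrow> ('d \<Rightarrow> 'a star_alg) \<Rightarrow> ('d \<Rightarrow> 'd \<Rightarrow> 'a \<Rightarrow> 'a) \<Rightarrow> 'd \<times> 'a \<Rightarrow> ('d \<times> 'a) set" where
  "limit_class D A j = (\<lambda>(F, a). {(G, b). G \<in> D \<and> b \<in> carrier (A G) \<and>
     (\<exists>H\<in>D. F \<le> H \<and> G \<le> H \<and> j F H a = j G H b)})"

(* The system consists of algebras A F and maps j F G : A F -> A G for F <= G in the directed
   set D. Since the connecting maps are contractive, the infimum of the norms of all
   representatives is the limit of the norms of j F H a along H. *)
definition algebraic_limit ::
    "'d::order set \<Rightarrow> ('d \<Rightarrow> 'a star_alg) \<Rightarrow> ('d \<Rightarrow> 'd \<Rightarrow> 'a \<Rightarrow> 'a) \<Rightarrow> ('d \<times> 'a) set star_alg" where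
  "algebraic_limit D A j = (let cl = limit_class D A j in
     \<lparr>carrier = cl ` (SIGMA F:D. carrier (A F)),
      mult = (\<lambda>X Y. \<Union>(F, a)\<in>X. \<Union>(G, b)\<in>Y. \<Union>H\<in>{H\<in>D. F \<le> H \<and> G \<le> H}.
                cl (H, j F H a \<otimes>\<^bsub>A H\<^esub> j G H b)),
      one = (\<Union>F\<in>D. cl (F, \<one>\<^bsub>A F\<^esub>)),
      zero = (\<Union>F\<in>D. cl (F, \<zero>\<^bsub>A F\<^esub>)),
      add = (\<lambda>X Y. \<Union>(F, a)\<in>X. \<Union>(G, b)\<in>Y. \<Union>H\<in>{H\<in>D. F \<le> H \<and> G \<le> H}.
                cl (H, j F H a \<oplus>\<^bsub>A H\<^esub> j G H b)),
      smult = (\<lambda>c X. \<Union>(F, a)\<in>X. cl (F, c \<odot>\<^bsub>A F\<^esub> a)),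
      star = (\<lambda>X. \<Union>(F, a)\<in>X. cl (F, star (A F) a)),
      nrm = (\<lambda>X. INF (F, a)\<in>X. nrm (A F) a)\<rparr>)"

definition cstar_limit ::
    "'d::order set \<Rightarrow> ('d \<Rightarrow> 'a star_alg) \<Rightarrow> ('d \<Rightarrow> 'd \<Rightarrow> 'a \<Rightarrow> 'a) \<Rightarrow> (nat \<Rightarrow> ('d \<times> 'a) set) set star_alg" where
  "cstar_limit D A j = hausdorff_completion (algebraic_limit D A j)"

definition cstar_limit_inj ::
    "'d::order set \<Rightarrow> ('d \<Rightarrow> 'a star_alg) \<Rightarrow> ('d \<Rightarrow> 'd \<Rightarrow> 'a \<Rightarrow> 'a) \<Rightarrow> 'd \<Rightarrow> 'a \<Rightarrow> (nat \<Rightarrow> ('d \<times> 'a) set) set" where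
  "cstar_limit_inj D A j F a =
     cauchy_class (algebraic_limit D A j) (nrm (algebraic_limit D A j)) (\<lambda>n. limit_class D A j (F, a))"


section \<open>The GNS representation and von Neumann algebras\<close>

record 'h hilbert =
  hcarrier :: "'h set"
  hadd :: "'h \<Rightarrow> 'h \<Rightarrow> 'h"
  hzero :: 'h
  hscale :: "complex \<Rightarrow> 'h \<Rightarrow> 'h"
  hinner :: "'h \<Rightarrow> 'h \<Rightarrow> complex"

text \<open>Inner products are linear in the first argument.\<close>

definition hnorm :: "'h hilbert \<Rightarrow> 'h \<Rightarrow> real" where
  "hnorm H x = sqrt (Re (hinner H x x))"

definition bounded_ops :: "'h hilbert \<Rightarrow> ('h \<Rightarrow> 'h) set" where
  "bounded_ops H = {T \<in> hcarrier H \<rightarrow>\<^sub>E hcarrier H.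
     (\<forall>x\<in>hcarrier H. \<forall>y\<in>hcarrier H. T (hadd H x y) = hadd H (T x) (T y)) \<and>
     (\<forall>c. \<forall>x\<in>hcarrier H. T (hscale H c x) = hscale H c (T x)) \<and>
     (\<exists>C. \<forall>x\<in>hcarrier H. hnorm H (T x) \<le> C * hnorm H x)}"

definition commutant :: "'h hilbert \<Rightarrow> ('h \<Rightarrow> 'h) set \<Rightarrow> ('h \<Rightarrow> 'h) set" where
  "commutant H S = {T \<in> bounded_ops H. \<forall>R\<in>S. compose (hcarrier H) T R = compose (hcarrier H) R T}"

definition adjoint_op :: "'h hilbert \<Rightarrow> ('h \<Rightarrow> 'h) \<Rightarrow> 'h \<Rightarrow> 'h" where
  "adjoint_op H T = (THE S. S \<in> bounded_ops H \<and>
     (\<forall>x\<in>hcarrier H. \<forall>y\<in>hcarrier H. hinner H (T x) y = hinner H x (S y)))"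

definition operator_algebra :: "'h hilbert \<Rightarrow> ('h \<Rightarrow> 'h) set \<Rightarrow> ('h \<Rightarrow> 'h) star_alg" where
  "operator_algebra H S =
     \<lparr>carrier = S,
      mult = compose (hcarrier H),
      one = (\<lambda>x\<in>hcarrier H. x),
      zero = (\<lambda>x\<in>hcarrier H. hzero H),
      add = (\<lambda>T R. \<lambda>x\<in>hcarrier H. hadd H (T x) (R x)),
      smult = (\<lambda>c T. \<lambda>x\<in>hcarrier H. hscale H c (T x)),
      star = adjoint_op H,
      nrm = (\<lambda>T. Inf {C. 0 \<le> C \<and> (\<forall>x\<in>hcarrier H. hnorm H (T x) \<le> C * hnorm H x)})\<rparr>"

definition gns_seminorm :: "'a star_alg \<Rightarrow> ('a \<Rightarrow> complex) \<Rightarrow> 'a \<Rightarrow> real" where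
  "gns_seminorm A \<omega> a = sqrt (Re (\<omega> (star A a \<otimes>\<^bsub>A\<^esub> a)))"

definition gns_space :: "'a star_alg \<Rightarrow> ('a \<Rightarrow> complex) \<Rightarrow> (nat \<Rightarrow> 'a) set hilbert" where
  "gns_space A \<omega> = (let p = gns_seminorm A \<omega>; cl = cauchy_class A p in
     \<lparr>hcarrier = cl ` cauchy_seqs A p,
      hadd = (\<lambda>X Y. \<Union>s\<in>X. \<Union>t\<in>Y. cl (\<lambda>n. s n \<oplus>\<^bsub>A\<^esub> t n)),
      hzero = cl (\<lambda>n. \<zero>\<^bsub>A\<^esub>),
      hscale = (\<lambda>c X. \<Union>s\<in>X. cl (\<lambda>n. c \<odot>\<^bsub>A\<^esub> s n)),
      hinner = (\<lambda>X Y. THE z. \<forall>s\<in>X. \<forall>t\<in>Y. (\<lambda>n. \<omega> (star A (t n) \<otimes>\<^bsub>A\<^esub> s n)) \<longlonglongrightarrow> z)\<rparr>)"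

definition gns_rep :: "'a star_alg \<Rightarrow> ('a \<Rightarrow> complex) \<Rightarrow> 'a \<Rightarrow> (nat \<Rightarrow> 'a) set \<Rightarrow> (nat \<Rightarrow> 'a) set" where
  "gns_rep A \<omega> a = (\<lambda>X\<in>hcarrier (gns_space A \<omega>).
     \<Union>s\<in>X. cauchy_class A (gns_seminorm A \<omega>) (\<lambda>n. a \<otimes>\<^bsub>A\<^esub> s n))"

definition gns_vector :: "'a star_alg \<Rightarrow> ('a \<Rightarrow> complex) \<Rightarrow> (nat \<Rightarrow> 'a) set" where
  "gns_vector A \<omega> = cauchy_class A (gns_seminorm A \<omega>) (\<lambda>n. \<one>\<^bsub>A\<^esub>)"

definition gns_algebra ::
    "'a star_alg \<Rightarrow> ('a \<Rightarrow> complex) \<Rightarrow> ((nat \<Rightarrow> 'a) set \<Rightarrow> (nat \<Rightarrow> 'a) set) star_alg" where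
  "gns_algebra A \<omega> = (let H = gns_space A \<omega> in
     operator_algebra H (commutant H (commutant H (gns_rep A \<omega> ` carrier A))))"

definition gns_functional ::
    "'a star_alg \<Rightarrow> ('a \<Rightarrow> complex) \<Rightarrow> ((nat \<Rightarrow> 'a) set \<Rightarrow> (nat \<Rightarrow> 'a) set) \<Rightarrow> complex" where
  "gns_functional A \<omega> T = hinner (gns_space A \<omega>) (T (gns_vector A \<omega>)) (gns_vector A \<omega>)"


section \<open>The infinite tensor product of copies of \<open>\<complex>\<^sup>2\<close>\<close>

text \<open>\<open>\<complex>\<^sup>2\<close> is the type \<^typ>\<open>bool \<Rightarrow> complex\<close>. An element of the tensor product over a finite set
  \<open>F\<close> is the array of its coefficients with respect to the basis of elementary tensors of standard basis
  vectors, which is indexed by \<^term>\<open>cube F\<close>. As these basis elements are pairwise orthogonal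
  projections of norm one, the C*-norm is the maximum norm.\<close>

definition cube :: "'k set \<Rightarrow> ('k \<Rightarrow> bool) set" where
  "cube K = K \<rightarrow>\<^sub>E UNIV"

definition half_trace :: "(bool \<Rightarrow> complex) \<Rightarrow> complex" where
  "half_trace a = (a False + a True) / 2"

definition fin_tensor :: "'k set \<Rightarrow> (('k \<Rightarrow> bool) \<Rightarrow> complex) star_alg" where
  "fin_tensor F =
     \<lparr>carrier = cube F \<rightarrow>\<^sub>E UNIV,
      mult = (\<lambda>x y. \<lambda>s\<in>cube F. x s * y s),
      one = (\<lambda>s\<in>cube F. 1),
      zero = (\<lambda>s\<in>cube F. 0),
      add = (\<lambda>x y. \<lambda>s\<in>cube F. x s + y s),
      smult = (\<lambda>c x. \<lambda>s\<in>cube F. c * x s),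
      star = (\<lambda>x. \<lambda>s\<in>cube F. cnj (x s)),
      nrm = (\<lambda>x. Max ((\<lambda>s. cmod (x s)) ` cube F))\<rparr>"

definition elem_tensor :: "'k set \<Rightarrow> ('k \<Rightarrow> bool \<Rightarrow> complex) \<Rightarrow> ('k \<Rightarrow> bool) \<Rightarrow> complex" where
  "elem_tensor F a = (\<lambda>s\<in>cube F. \<Prod>i\<in>F. a i (s i))"

text \<open>The map \<open>a \<mapsto> a \<otimes> 1\<close>; see \<open>tensor_one_elem\<close> below.\<close>

definition tensor_one ::
    "'k set \<Rightarrow> 'k set \<Rightarrow> (('k \<Rightarrow> bool) \<Rightarrow> complex) \<Rightarrow> ('k \<Rightarrow> bool) \<Rightarrow> complex" where
  "tensor_one F G x = (\<lambda>s\<in>cube G. x (restrict s F))"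

lemma fin_tensor_elem_basis:
  assumes "finite F" "x \<in> carrier (fin_tensor F)" "s \<in> cube F"
  shows "x s = (\<Sum>u\<in>cube F. x u * elem_tensor F (\<lambda>i t. of_bool (t = u i)) s)"
proof -
  have fin: "finite (cube F)"
    unfolding cube_def using assms(1) by (intro finite_PiE) auto
  have "elem_tensor F (\<lambda>i t. of_bool (t = u i)) s = of_bool (s = u)" if u: "u \<in> cube F" for u
  proof (cases "s = u")
    case False
    then have "\<exists>i\<in>F. s i \<noteq> u i"
      using PiE_ext[of s F "\<lambda>_. UNIV" u] assms(3) u unfolding cube_def by blast
    then have "\<exists>i\<in>F. (of_bool (s i = u i) :: complex) = 0"
      by simp
    then have "(\<Prod>i\<in>F. of_bool (s i = u i) :: complex) = 0"
      by (rule prod_zero[OF assms(1)])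
    with False assms(3) show ?thesis
      by (simp only: elem_tensor_def restrict_apply' of_bool_def if_False)
  next
    case True
    with assms(3) show ?thesis
      by (simp add: elem_tensor_def)
  qed
  then have "(\<Sum>u\<in>cube F. x u * elem_tensor F (\<lambda>i t. of_bool (t = u i)) s)
      = (\<Sum>u\<in>cube F. if u = s then x u else 0)"
    by (intro sum.cong) auto
  also have "\<dots> = x s"
    using fin assms(3) by simp
  finally show ?thesis by simp
qed

lemma fin_tensor_elem_mult:
  "elem_tensor F a \<otimes>\<^bsub>fin_tensor F\<^esub> elem_tensor F b = elem_tensor F (\<lambda>i t. a i t * b i t)"
  by (auto simp: fin_tensor_def elem_tensor_def prod.distrib restrict_def)

lemma fin_tensor_elem_star:
  "star (fin_tensor F) (elem_tensor F a) = elem_tensor F (\<lambda>i t. cnj (a i t))"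
  by (auto simp: fin_tensor_def elem_tensor_def restrict_def)

lemma tensor_one_elem:
  assumes "finite G" "F \<subseteq> G"
  shows "tensor_one F G (elem_tensor F a) = elem_tensor G (\<lambda>i. if i \<in> F then a i else (\<lambda>t. 1))"
proof
  fix s
  have "(\<Prod>i\<in>G. (if i \<in> F then a i else (\<lambda>t. 1)) (s i)) = (\<Prod>i\<in>F. a i (s i))"
    using assms by (intro prod.mono_neutral_cong_right) auto
  then show "tensor_one F G (elem_tensor F a) s
      = elem_tensor G (\<lambda>i. if i \<in> F then a i else (\<lambda>t. 1)) s"
    by (auto simp: tensor_one_def elem_tensor_def cube_def)
qed

type_synonym 'k tensor = "(nat \<Rightarrow> ('k set \<times> (('k \<Rightarrow> bool) \<Rightarrow> complex)) set) set"

definition fin_subsets :: "'k set \<Rightarrow> 'k set set" where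
  "fin_subsets K = {F. finite F \<and> F \<subseteq> K}"

definition inf_tensor :: "'k set \<Rightarrow> 'k tensor star_alg" where
  "inf_tensor K = cstar_limit (fin_subsets K) fin_tensor tensor_one"

definition product_state :: "'k set \<Rightarrow> 'k tensor \<Rightarrow> complex" where
  "product_state K = (THE \<omega>. is_state (inf_tensor K) \<omega> \<and>
     (\<forall>F\<in>fin_subsets K. \<forall>a. \<omega> (cstar_limit_inj (fin_subsets K) fin_tensor tensor_one F (elem_tensor F a))
        = (\<Prod>i\<in>F. half_trace (a i))))"

definition tensor_vn_algebra ::
    "'k set \<Rightarrow> ((nat \<Rightarrow> 'k tensor) set \<Rightarrow> (nat \<Rightarrow> 'k tensor) set) star_alg" where
  "tensor_vn_algebra K = gns_algebra (inf_tensor K) (product_state K)"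

definition tensor_vn_trace ::
    "'k set \<Rightarrow> ((nat \<Rightarrow> 'k tensor) set \<Rightarrow> (nat \<Rightarrow> 'k tensor) set) \<Rightarrow> complex" where
  "tensor_vn_trace K = gns_functional (inf_tensor K) (product_state K)"


section \<open>The product measure and its \<open>L\<^sup>\<infinity>\<close> algebra\<close>

definition cube_topology :: "'k set \<Rightarrow> ('k \<Rightarrow> bool) topology" where
  "cube_topology K = product_topology (\<lambda>_. discrete_topology UNIV) K"

definition regular_on :: "'w topology \<Rightarrow> 'w measure \<Rightarrow> bool" where
  "regular_on T \<mu> \<longleftrightarrow> (\<forall>B\<in>sets \<mu>.
     emeasure \<mu> B = (INF U\<in>{U. openin T U \<and> B \<subseteq> U}. emeasure \<mu> U) \<and>
     emeasure \<mu> B = (SUP C\<in>{C. compactin T C \<and> C \<subseteq> B}. emeasure \<mu> C))"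

(* For uncountable K the Borel sets of cube_topology K form a strictly larger sigma-algebra than
   that of the library product measure PiM. *)
definition is_radon_product :: "'k set \<Rightarrow> ('k \<Rightarrow> bool) measure \<Rightarrow> bool" where
  "is_radon_product K \<mu> \<longleftrightarrow>
     sets \<mu> = sigma_sets (topspace (cube_topology K)) {U. openin (cube_topology K) U} \<and>
     emeasure \<mu> (space \<mu>) = 1 \<and> regular_on (cube_topology K) \<mu> \<and>
     (\<forall>E. (\<forall>i\<in>K. E i \<noteq> {}) \<and> finite {i\<in>K. E i \<noteq> UNIV} \<longrightarrow>
        emeasure \<mu> (Pi\<^sub>E K E) = ennreal ((1/2) ^ card {i\<in>K. E i \<noteq> UNIV}))"

definition product_measure :: "'k set \<Rightarrow> ('k \<Rightarrow> bool) measure" where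
  "product_measure K = completion (THE \<mu>. is_radon_product K \<mu>)"

definition ess_bounded :: "'w measure \<Rightarrow> ('w \<Rightarrow> complex) set" where
  "ess_bounded N = {f \<in> borel_measurable N. \<exists>C. AE w in N. cmod (f w) \<le> C}"

definition ae_class :: "'w measure \<Rightarrow> ('w \<Rightarrow> complex) \<Rightarrow> ('w \<Rightarrow> complex) set" where
  "ae_class N f = {g \<in> ess_bounded N. AE w in N. f w = g w}"

definition Linf :: "'w measure \<Rightarrow> ('w \<Rightarrow> complex) set star_alg" where
  "Linf N = (let cl = ae_class N in
     \<lparr>carrier = cl ` ess_bounded N,
      mult = (\<lambda>X Y. \<Union>f\<in>X. \<Union>g\<in>Y. cl (\<lambda>w. f w * g w)),
      one = cl (\<lambda>w. 1),
      zero = cl (\<lambda>w. 0),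
      add = (\<lambda>X Y. \<Union>f\<in>X. \<Union>g\<in>Y. cl (\<lambda>w. f w + g w)),
      smult = (\<lambda>c X. \<Union>f\<in>X. cl (\<lambda>w. c * f w)),
      star = (\<lambda>X. \<Union>f\<in>X. cl (\<lambda>w. cnj (f w))),
      nrm = (\<lambda>X. Inf {C. 0 \<le> C \<and> (\<forall>f\<in>X. AE w in N. cmod (f w) \<le> C)})\<rparr>)"

definition Linf_integral :: "'w measure \<Rightarrow> ('w \<Rightarrow> complex) set \<Rightarrow> complex" where
  "Linf_integral N X = (THE z. \<forall>f\<in>X. z = (\<integral>w. f w \<partial>N))"

end

theory Submission
  imports Defs "HOL-Probability.Infinite_Product_Measure"
begin

text \<open>The inductive limit of the finite tensor products is the algebra of cylinder functions on the Cantor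
  cube, and the product state is integration against the product measure. As this measure is regular,
  cylinder functions are dense in the square-integrable functions, so the GNS space is the \<open>L\<^sup>2\<close> space
  of the product measure, on which the C*-algebra acts by multiplication. An operator commuting with
  multiplication by a dense set of functions is multiplication by its value at the constant function 1,
  and that value must be essentially bounded. Hence the commutant and the bicommutant both consist of the
  multiplication operators with symbol in \<open>L\<^sup>\<infinity>\<close>, and the vector state of the constant function 1 is
  integration of the symbol.\<close>

section \<open>Algebras of functions modulo a filter\<close>

text \<open>The definitions build quotients as sets of representatives, with operations given by
  unions and limits given by definite descriptions. Each such object is matched with functions on
  the cube, and everything else is proved about functions. Both algebras of the theorem become
  copies of the essentially bounded functions on one probability space, so the W*-axioms and the
  properties of the weight are proved once, for any such copy, and the isomorphism pairs elements
  with the same function. The obstacle is the measure: over an uncountable index set not every open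
  set belongs to the product \<sigma>-algebra. Only cylinder sets are measured directly; inner
  approximation of open sets and outer approximation of arbitrary sets yield an outer measure to
  which Caratheodory's theorem applies, and compactness of the cube gives inner regularity and
  uniqueness. Uniqueness matters as much as existence, since the measure and the product state are
  both defined by definite description.\<close>

lemma cring_complex_ring: "cring complex_ring"
proof (rule cringI)
  show "abelian_group complex_ring"
  proof (rule abelian_groupI)
    fix x assume "x \<in> carrier complex_ring"
    show "\<exists>y\<in>carrier complex_ring. y \<oplus>\<^bsub>complex_ring\<^esub> x = \<zero>\<^bsub>complex_ring\<^esub>"
      by (rule bexI[of _ "- x"]) (auto simp: complex_ring_def)
  qed (auto simp: complex_ring_def)
  show "comm_monoid complex_ring"
    by (rule comm_monoidI) (auto simp: complex_ring_def)
qed (auto simp: complex_ring_def algebra_simps)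

text \<open>A principal filter gives pointwise equality on a set, the almost-everywhere filter gives equality up to
  null sets; the two instances cover the C*-algebra and the von Neumann algebras.\<close>

locale func_model =
  fixes M :: "'a star_alg" (structure) and \<F> :: "'w filter" and \<theta> :: "'a \<Rightarrow> 'w \<Rightarrow> complex"
  assumes one_closed: "\<one> \<in> carrier M" and zero_closed: "\<zero> \<in> carrier M"
    and add_closed: "\<And>x y. x \<in> carrier M \<Longrightarrow> y \<in> carrier M \<Longrightarrow> x \<oplus> y \<in> carrier M"
    and mult_closed: "\<And>x y. x \<in> carrier M \<Longrightarrow> y \<in> carrier M \<Longrightarrow> x \<otimes> y \<in> carrier M"
    and smult_closed: "\<And>c x. x \<in> carrier M \<Longrightarrow> c \<odot> x \<in> carrier M"
    and star_closed: "\<And>x. x \<in> carrier M \<Longrightarrow> star M x \<in> carrier M"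
    and theta_one: "\<forall>\<^sub>F w in \<F>. \<theta> \<one> w = 1"
    and theta_zero: "\<forall>\<^sub>F w in \<F>. \<theta> \<zero> w = 0"
    and theta_add: "\<And>x y. x \<in> carrier M \<Longrightarrow> y \<in> carrier M \<Longrightarrow> \<forall>\<^sub>F w in \<F>. \<theta> (x \<oplus> y) w = \<theta> x w + \<theta> y w"
    and theta_mult: "\<And>x y. x \<in> carrier M \<Longrightarrow> y \<in> carrier M \<Longrightarrow> \<forall>\<^sub>F w in \<F>. \<theta> (x \<otimes> y) w = \<theta> x w * \<theta> y w"
    and theta_smult: "\<And>c x. x \<in> carrier M \<Longrightarrow> \<forall>\<^sub>F w in \<F>. \<theta> (c \<odot> x) w = c * \<theta> x w"
    and theta_star: "\<And>x. x \<in> carrier M \<Longrightarrow> \<forall>\<^sub>F w in \<F>. \<theta> (star M x) w = cnj (\<theta> x w)"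
    and theta_inj: "\<And>x y. x \<in> carrier M \<Longrightarrow> y \<in> carrier M \<Longrightarrow> \<forall>\<^sub>F w in \<F>. \<theta> x w = \<theta> y w \<Longrightarrow> x = y"
    and nrm_pos: "\<And>x. x \<in> carrier M \<Longrightarrow> 0 \<le> nrm M x"
    and nrm_le_iff: "\<And>x C. x \<in> carrier M \<Longrightarrow> 0 \<le> C \<Longrightarrow> nrm M x \<le> C \<longleftrightarrow> (\<forall>\<^sub>F w in \<F>. cmod (\<theta> x w) \<le> C)"
begin

lemmas closed = one_closed zero_closed add_closed mult_closed smult_closed star_closed

lemma ev_le_nrm: "x \<in> carrier M \<Longrightarrow> \<forall>\<^sub>F w in \<F>. cmod (\<theta> x w) \<le> nrm M x"
  using nrm_le_iff[of x "nrm M x"] nrm_pos[of x] by simp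

lemma eqI:
  assumes "x \<in> carrier M" "y \<in> carrier M" "\<forall>\<^sub>F w in \<F>. \<theta> x w = f w" "\<forall>\<^sub>F w in \<F>. \<theta> y w = f w"
  shows "x = y"
proof (rule theta_inj[OF assms(1,2)])
  show "\<forall>\<^sub>F w in \<F>. \<theta> x w = \<theta> y w"
    using assms(3,4) by eventually_elim simp
qed

lemma eval_add:
  assumes "x \<in> carrier M" "y \<in> carrier M" "\<forall>\<^sub>F w in \<F>. \<theta> x w = f w" "\<forall>\<^sub>F w in \<F>. \<theta> y w = g w"
  shows "\<forall>\<^sub>F w in \<F>. \<theta> (x \<oplus> y) w = f w + g w"
  using theta_add[OF assms(1,2)] assms(3,4) by eventually_elim simp

lemma eval_mult:
  assumes "x \<in> carrier M" "y \<in> carrier M" "\<forall>\<^sub>F w in \<F>. \<theta> x w = f w" "\<forall>\<^sub>F w in \<F>. \<theta> y w = g w"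
  shows "\<forall>\<^sub>F w in \<F>. \<theta> (x \<otimes> y) w = f w * g w"
  using theta_mult[OF assms(1,2)] assms(3,4) by eventually_elim simp

lemma eval_smult:
  assumes "x \<in> carrier M" "\<forall>\<^sub>F w in \<F>. \<theta> x w = f w"
  shows "\<forall>\<^sub>F w in \<F>. \<theta> (c \<odot> x) w = c * f w"
  using theta_smult[OF assms(1)] assms(2) by eventually_elim simp

lemma eval_star:
  assumes "x \<in> carrier M" "\<forall>\<^sub>F w in \<F>. \<theta> x w = f w"
  shows "\<forall>\<^sub>F w in \<F>. \<theta> (star M x) w = cnj (f w)"
  using theta_star[OF assms(1)] assms(2) by eventually_elim simp

text \<open>Turns a law of the algebra into an identity of complex numbers: \<open>closed\<close>
  settles membership, \<open>evals\<close> builds the functions \<open>f\<close> and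
  \<open>g\<close> from the two terms, and the pointwise identity is left to simplification.\<close>

lemma eqI2:
  assumes "x \<in> carrier M" "y \<in> carrier M" "\<forall>\<^sub>F w in \<F>. \<theta> x w = f w" "\<forall>\<^sub>F w in \<F>. \<theta> y w = g w" "\<And>w. f w = g w"
  shows "x = y"
  using assms by (intro eqI[OF assms(1,2,3)]) simp

lemma eval_self: "\<forall>\<^sub>F w in \<F>. \<theta> x w = \<theta> x w"
  by simp

text \<open>\<open>eval_self\<close> matches every term, hence its place at the end: it must only be
  reached at terms that are no operation.\<close>

lemmas evals = eval_add eval_mult eval_smult eval_star theta_one theta_zero eval_self

lemma abelian_group_M: "abelian_group M"
proof (rule abelian_groupI)
  fix x y z assume x: "x \<in> carrier M" and y: "y \<in> carrier M" and z: "z \<in> carrier M"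
  show "x \<oplus> y \<oplus> z = x \<oplus> (y \<oplus> z)"
    by (rule eqI2, (rule closed x y z)+, (rule evals closed x y z)+, simp add: algebra_simps complex_ring_def)
next
  fix x y assume x: "x \<in> carrier M" and y: "y \<in> carrier M"
  show "x \<oplus> y = y \<oplus> x"
    by (rule eqI2, (rule closed x y)+, (rule evals closed x y)+, simp add: algebra_simps complex_ring_def)
next
  fix x assume x: "x \<in> carrier M"
  show "\<zero> \<oplus> x = x"
    by (rule eqI2, (rule closed x)+, (rule evals closed x)+, simp add: algebra_simps complex_ring_def)
  show "\<exists>y\<in>carrier M. y \<oplus> x = \<zero>"
  proof (rule bexI[of _ "(- 1) \<odot> x"])
    show "(- 1) \<odot> x \<oplus> x = \<zero>"
      by (rule eqI2, (rule closed x)+, (rule evals closed x)+, simp add: algebra_simps complex_ring_def)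
  qed (simp add: closed x)
qed (simp_all add: closed)

lemma ring_M: "ring M"
proof (rule ringI[OF abelian_group_M])
  show "monoid M"
  proof (rule monoidI)
    fix x y z assume x: "x \<in> carrier M" and y: "y \<in> carrier M" and z: "z \<in> carrier M"
    show "x \<otimes> y \<otimes> z = x \<otimes> (y \<otimes> z)"
      by (rule eqI2, (rule closed x y z)+, (rule evals closed x y z)+, simp add: algebra_simps complex_ring_def)
  next
    fix x assume x: "x \<in> carrier M"
    show "\<one> \<otimes> x = x"
      by (rule eqI2, (rule closed x)+, (rule evals closed x)+, simp add: algebra_simps complex_ring_def)
    show "x \<otimes> \<one> = x"
      by (rule eqI2, (rule closed x)+, (rule evals closed x)+, simp add: algebra_simps complex_ring_def)
  qed (simp_all add: closed)
next
  fix x y z assume x: "x \<in> carrier M" and y: "y \<in> carrier M" and z: "z \<in> carrier M"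
  show "(x \<oplus> y) \<otimes> z = x \<otimes> z \<oplus> y \<otimes> z"
    by (rule eqI2, (rule closed x y z)+, (rule evals closed x y z)+, simp add: algebra_simps complex_ring_def)
  show "z \<otimes> (x \<oplus> y) = z \<otimes> x \<oplus> z \<otimes> y"
    by (rule eqI2, (rule closed x y z)+, (rule evals closed x y z)+, simp add: algebra_simps complex_ring_def)
qed

text \<open>The inverse of the additive group is given by a description that the evaluation rules
  cannot compute; a scalar multiple by -1 falls under them, and with it subtraction.\<close>

lemma a_inv_eq:
  assumes x: "x \<in> carrier M"
  shows "\<ominus> x = (- 1) \<odot> x"
proof -
  interpret ring M by (rule ring_M)
  have "(- 1) \<odot> x \<oplus> x = \<zero>"
    by (rule eqI2, (rule closed x)+, (rule evals closed x)+, simp add: algebra_simps complex_ring_def)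
  then show ?thesis
    using x smult_closed[OF x, of "-1"] by (metis minus_equality)
qed

lemma minus_closed': "x \<in> carrier M \<Longrightarrow> y \<in> carrier M \<Longrightarrow> x \<ominus> y \<in> carrier M"
  unfolding a_minus_def by (simp add: a_inv_eq closed)

lemma theta_minus:
  assumes x: "x \<in> carrier M" and y: "y \<in> carrier M"
  shows "\<forall>\<^sub>F w in \<F>. \<theta> (x \<ominus> y) w = \<theta> x w - \<theta> y w"
  using theta_add[OF x smult_closed[OF y], of "-1"] theta_smult[OF y, of "-1"]
  unfolding a_minus_def a_inv_eq[OF y] by eventually_elim simp

lemma module_M: "module complex_ring M"
proof (rule moduleI[OF cring_complex_ring abelian_group_M])
  fix a b x y assume x: "x \<in> carrier M" and y: "y \<in> carrier M"
  show "a \<odot> x \<in> carrier M" by (simp add: closed x)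
  show "\<one>\<^bsub>complex_ring\<^esub> \<odot> x = x"
    by (rule eqI2, (rule closed x y)+, (rule evals closed x y)+, simp add: algebra_simps complex_ring_def)
  show "a \<odot> (x \<oplus> y) = a \<odot> x \<oplus> a \<odot> y"
    by (rule eqI2, (rule closed x y)+, (rule evals closed x y)+, simp add: algebra_simps complex_ring_def)
  show "(a \<otimes>\<^bsub>complex_ring\<^esub> b) \<odot> x = a \<odot> (b \<odot> x)"
    by (rule eqI2, (rule closed x y)+, (rule evals closed x y)+, simp add: algebra_simps complex_ring_def)
  show "(a \<oplus>\<^bsub>complex_ring\<^esub> b) \<odot> x = a \<odot> x \<oplus> b \<odot> x"
    by (rule eqI2, (rule closed x y)+, (rule evals closed x y)+, simp add: algebra_simps complex_ring_def)
qed

text \<open>Completeness is the one axiom that pointwise computation does not give, since it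
  requires that limits of evaluations are again evaluations.\<close>

lemma cstar_algebraI:
  assumes complete: "\<And>s. s \<in> cauchy_seqs M (nrm M) \<Longrightarrow> \<exists>x\<in>carrier M. (\<lambda>n. nrm M (s n \<ominus> x)) \<longlonglongrightarrow> 0"
  shows "cstar_algebra M"
proof (rule cstar_algebra.intro[OF ring_M], rule cstar_algebra_axioms.intro)
  show "module complex_ring M" by (rule module_M)
next
  fix c x y assume x: "x \<in> carrier M" and y: "y \<in> carrier M"
  show "(c \<odot> x) \<otimes> y = c \<odot> (x \<otimes> y)"
    by (rule eqI2, (rule closed x y)+, (rule evals closed x y)+, simp add: algebra_simps complex_ring_def)
  show "x \<otimes> (c \<odot> y) = c \<odot> (x \<otimes> y)"
    by (rule eqI2, (rule closed x y)+, (rule evals closed x y)+, simp add: algebra_simps complex_ring_def)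
next
  fix x y assume x: "x \<in> carrier M" and y: "y \<in> carrier M"
  show "star M (x \<oplus> y) = star M x \<oplus> star M y"
    by (rule eqI2, (rule closed x y)+, (rule evals closed x y)+, simp add: algebra_simps complex_ring_def)
  show "star M (x \<otimes> y) = star M y \<otimes> star M x"
    by (rule eqI2, (rule closed x y)+, (rule evals closed x y)+, simp add: algebra_simps complex_ring_def)
  have "\<forall>\<^sub>F w in \<F>. cmod (\<theta> (x \<oplus> y) w) \<le> nrm M x + nrm M y"
    using theta_add[OF x y] ev_le_nrm[OF x] ev_le_nrm[OF y]
    by eventually_elim (auto intro!: order_trans[OF norm_triangle_ineq] add_mono)
  then show "nrm M (x \<oplus> y) \<le> nrm M x + nrm M y"
    by (subst nrm_le_iff) (auto simp: closed x y nrm_pos)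
  have "\<forall>\<^sub>F w in \<F>. cmod (\<theta> (x \<otimes> y) w) \<le> nrm M x * nrm M y"
    using theta_mult[OF x y] ev_le_nrm[OF x] ev_le_nrm[OF y]
    by eventually_elim (auto simp: norm_mult intro!: mult_mono nrm_pos x)
  then show "nrm M (x \<otimes> y) \<le> nrm M x * nrm M y"
    by (subst nrm_le_iff) (auto simp: closed x y nrm_pos)
next
  fix x assume x: "x \<in> carrier M"
  show "star M (star M x) = x"
    by (rule eqI2, (rule closed x)+, (rule evals closed x)+, simp add: algebra_simps complex_ring_def)
  show "nrm M x = 0 \<longleftrightarrow> x = \<zero>"
  proof
    assume "nrm M x = 0"
    then have "\<forall>\<^sub>F w in \<F>. \<theta> x w = 0" using ev_le_nrm[OF x] by simp
    then show "x = \<zero>"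
      by (rule eqI[OF x zero_closed _ theta_zero])
  next
    assume "x = \<zero>"
    moreover have "\<forall>\<^sub>F w in \<F>. cmod (\<theta> \<zero> w) \<le> 0" using theta_zero by eventually_elim simp
    then have "nrm M \<zero> \<le> 0" by (simp add: nrm_le_iff closed)
    ultimately show "nrm M x = 0" using nrm_pos[OF x] by simp
  qed
  have m: "\<forall>\<^sub>F w in \<F>. cmod (\<theta> (star M x \<otimes> x) w) = (cmod (\<theta> x w))\<^sup>2"
    using theta_mult[OF star_closed[OF x] x] theta_star[OF x]
    by eventually_elim (simp add: norm_mult power2_eq_square)
  show "nrm M (star M x \<otimes> x) = (nrm M x)\<^sup>2"
  proof (rule antisym)
    show "nrm M (star M x \<otimes> x) \<le> (nrm M x)\<^sup>2"
      by (subst nrm_le_iff, simp add: closed x, simp)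
        (use m ev_le_nrm[OF x] in eventually_elim, simp add: power_mono)
    have c: "star M x \<otimes> x \<in> carrier M" by (simp add: closed x)
    have "nrm M x \<le> sqrt (nrm M (star M x \<otimes> x))"
      by (subst nrm_le_iff, simp add: closed x, simp add: nrm_pos c)
        (use m ev_le_nrm[OF c] in eventually_elim, simp add: real_le_rsqrt)
    then have "(nrm M x)\<^sup>2 \<le> (sqrt (nrm M (star M x \<otimes> x)))\<^sup>2"
      using nrm_pos[OF x] by (intro power_mono) auto
    then show "(nrm M x)\<^sup>2 \<le> nrm M (star M x \<otimes> x)" using nrm_pos[OF c] by simp
  qed
next
  fix c x assume x: "x \<in> carrier M"
  show "star M (c \<odot> x) = cnj c \<odot> star M x"
    by (rule eqI2, (rule closed x)+, (rule evals closed x)+, simp add: algebra_simps complex_ring_def)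
  \<comment> \<open>Stated for all scalars and elements, since the reverse inequality arises from
    the scalar \<open>inverse c\<close> and the element \<open>c \<odot> x\<close>.\<close>
  have le: "nrm M (c \<odot> x) \<le> cmod c * nrm M x" if x: "x \<in> carrier M" for c x
    by (subst nrm_le_iff, simp add: closed x, simp add: nrm_pos x)
        (use theta_smult[OF x, of c] ev_le_nrm[OF x] in eventually_elim, simp add: norm_mult mult_left_mono)
  show "nrm M (c \<odot> x) = cmod c * nrm M x"
  proof (cases "c = 0")
    case True
    then show ?thesis using le[OF x, of c] nrm_pos[OF smult_closed[OF x], of c] by simp
  next
    case False
    have "inverse c \<odot> (c \<odot> x) = x"
      by (rule eqI2, (rule closed x)+, (rule evals closed x)+, simp add: algebra_simps complex_ring_def False)
    then have "nrm M x \<le> cmod (inverse c) * nrm M (c \<odot> x)"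
      using le[OF smult_closed[OF x, of c], of "inverse c"] by simp
    then have "cmod c * nrm M x \<le> nrm M (c \<odot> x)"
      using False unfolding norm_inverse by (simp add: field_simps)
    then show ?thesis using le[OF x, of c] by simp
  qed
qed (fact star_closed nrm_pos complete)+

text \<open>\<open>nrm_le_iff\<close> describes closed balls only, which is why \<le> appears on the
  right; the strict inequality of the definition is recovered by halving \<open>e\<close>.\<close>

lemma cauchy_seqs_nrm_iff:
  "s \<in> cauchy_seqs M (nrm M) \<longleftrightarrow> (\<forall>n. s n \<in> carrier M) \<and>
     (\<forall>e>0. \<exists>N. \<forall>m\<ge>N. \<forall>n\<ge>N. \<forall>\<^sub>F w in \<F>. cmod (\<theta> (s m) w - \<theta> (s n) w) \<le> e)"
proof -
  have *: "nrm M (x \<ominus> y) \<le> e \<longleftrightarrow> (\<forall>\<^sub>F w in \<F>. cmod (\<theta> x w - \<theta> y w) \<le> e)"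
    if "x \<in> carrier M" "y \<in> carrier M" "0 < e" for x y e
  proof -
    have "(\<forall>\<^sub>F w in \<F>. cmod (\<theta> (x \<ominus> y) w) \<le> e) \<longleftrightarrow> (\<forall>\<^sub>F w in \<F>. cmod (\<theta> x w - \<theta> y w) \<le> e)"
      by (rule eventually_subst) (use theta_minus[OF that(1,2)] in eventually_elim, simp)
    then show ?thesis using that(3) nrm_le_iff[OF minus_closed'[OF that(1,2)], of e] by simp
  qed
  show ?thesis
  proof safe
    fix e :: real assume "s \<in> cauchy_seqs M (nrm M)" "e > 0"
    then show "\<exists>N. \<forall>m\<ge>N. \<forall>n\<ge>N. \<forall>\<^sub>F w in \<F>. cmod (\<theta> (s m) w - \<theta> (s n) w) \<le> e"
    proof -
      have s: "s n \<in> carrier M" for n using \<open>s \<in> _\<close> by (auto simp: cauchy_seqs_def)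
      obtain N where "\<forall>m\<ge>N. \<forall>n\<ge>N. nrm M (s m \<ominus> s n) < e"
        using \<open>s \<in> _\<close> \<open>e > 0\<close> by (auto simp: cauchy_seqs_def)
      then have "\<forall>m\<ge>N. \<forall>n\<ge>N. nrm M (s m \<ominus> s n) \<le> e" by (simp add: less_imp_le)
      then show ?thesis using *[OF s s \<open>e > 0\<close>] by auto
    qed
  next
    assume s: "\<forall>n. s n \<in> carrier M" and
      c: "\<forall>e>0. \<exists>N. \<forall>m\<ge>N. \<forall>n\<ge>N. \<forall>\<^sub>F w in \<F>. cmod (\<theta> (s m) w - \<theta> (s n) w) \<le> e"
    have "\<exists>N. \<forall>m\<ge>N. \<forall>n\<ge>N. nrm M (s m \<ominus> s n) < e" if "e > 0" for e
    proof -
      obtain N where "\<forall>m\<ge>N. \<forall>n\<ge>N. \<forall>\<^sub>F w in \<F>. cmod (\<theta> (s m) w - \<theta> (s n) w) \<le> e/2"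
        using c half_gt_zero[OF \<open>e>0\<close>] by blast
      then have "\<forall>m\<ge>N. \<forall>n\<ge>N. nrm M (s m \<ominus> s n) \<le> e/2"
        using *[OF s[rule_format] s[rule_format] half_gt_zero[OF \<open>e>0\<close>]] by simp
      then show ?thesis using \<open>e > 0\<close> by (intro exI[of _ N]) fastforce
    qed
    then show "s \<in> cauchy_seqs M (nrm M)" using s by (simp add: cauchy_seqs_def)
  qed (auto simp: cauchy_seqs_def)
qed

end

section \<open>Algebras of essentially bounded functions\<close>

text \<open>Measure-theoretic induction over complex simple functions. The last clause carries the
  bound 2 |f| of the approximating sequence, so that uses of the rule can apply dominated
  convergence. \<open>cong\<close> absorbs the values outside the space, where a combination of
  indicators need not agree with the simple function.\<close>

lemma complex_measurable_induct:
  fixes f :: "'w \<Rightarrow> complex"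
  assumes f: "f \<in> borel_measurable N"
    and ind: "\<And>A. A \<in> sets N \<Longrightarrow> P (indicator A)"
    and smult: "\<And>c u. P u \<Longrightarrow> P (\<lambda>w. c * u w)"
    and add: "\<And>u v. P u \<Longrightarrow> P v \<Longrightarrow> P (\<lambda>w. u w + v w)"
    and cong: "\<And>u v. P u \<Longrightarrow> (\<And>w. w \<in> space N \<Longrightarrow> u w = v w) \<Longrightarrow> v \<in> borel_measurable N \<Longrightarrow> P v"
    and lim: "\<And>s. (\<And>n::nat. s n \<in> borel_measurable N) \<Longrightarrow> (\<And>n. P (s n)) \<Longrightarrow>
      (\<And>w. w \<in> space N \<Longrightarrow> (\<lambda>n. s n w) \<longlonglongrightarrow> f w) \<Longrightarrow>
      (\<And>n w. w \<in> space N \<Longrightarrow> cmod (s n w) \<le> 2 * cmod (f w)) \<Longrightarrow> P f"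
  shows "P f"
proof -
  obtain s where s: "\<And>i. simple_function N (s i)"
    "\<And>x. x \<in> space N \<Longrightarrow> (\<lambda>i. s i x) \<longlonglongrightarrow> f x"
    "\<And>i x. x \<in> space N \<Longrightarrow> dist (s i x) 0 \<le> 2 * dist (f x) 0"
    using borel_measurable_implies_sequence_metric[OF f, of 0] by blast
  have zero: "P (\<lambda>w. 0)"
    using smult[OF ind[of "{}"], of 0] by simp
  have sums: "P (\<lambda>w. \<Sum>y\<in>Y. y * indicator (u -` {y} \<inter> space N) w)"
    if "finite Y" "simple_function N u" for Y :: "complex set" and u :: "'w \<Rightarrow> complex"
    using that(1)
  proof (induction Y rule: finite_induct)
    case (insert y Y)
    have "u -` {y} \<inter> space N \<in> sets N"
      using that(2) by (rule simple_functionD)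
    from add[OF smult[OF ind[OF this], of y] insert.IH] show ?case
      by (simp only: sum.insert[OF insert.hyps])
  qed (simp add: zero)
  have simple: "P u" if "simple_function N u" for u
  proof (rule cong[OF sums[OF _ that, of "u ` space N"]])
    show "finite (u ` space N)" using that by (rule simple_functionD)
    show "u \<in> borel_measurable N" by (rule borel_measurable_simple_function[OF that])
    fix w assume "w \<in> space N"
    have "u w = (\<Sum>y\<in>u ` space N. indicator (u -` {y} \<inter> space N) w *\<^sub>R y)"
      by (rule simple_function_indicator_representation_banach[OF that \<open>w \<in> space N\<close>])
    also have "\<dots> = (\<Sum>y\<in>u ` space N. y * indicator (u -` {y} \<inter> space N) w)"
      by (intro sum.cong refl) (simp split: split_indicator)
    finally show "(\<Sum>y\<in>u ` space N. y * indicator (u -` {y} \<inter> space N) w) = u w" by (rule sym)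
  qed
  show ?thesis
  proof (rule lim[of s])
    show "s n \<in> borel_measurable N" "P (s n)" for n
      by (rule borel_measurable_simple_function[OF s(1)], rule simple[OF s(1)])
  qed (use s in auto)
qed

lemma ess_boundedI: "f \<in> borel_measurable N \<Longrightarrow> AE w in N. cmod (f w) \<le> C \<Longrightarrow> f \<in> ess_bounded N"
  by (auto simp: ess_bounded_def)

lemma ess_bounded_measurable: "f \<in> ess_bounded N \<Longrightarrow> f \<in> borel_measurable N"
  by (simp add: ess_bounded_def)

lemma ess_bounded_bound:
  assumes "f \<in> ess_bounded N" obtains C where "0 \<le> C" "AE w in N. cmod (f w) \<le> C"
proof -
  obtain C where "AE w in N. cmod (f w) \<le> C" using assms by (auto simp: ess_bounded_def)
  then have "AE w in N. cmod (f w) \<le> \<bar>C\<bar>" by eventually_elim simp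
  then show ?thesis using that[of "\<bar>C\<bar>"] by simp
qed

lemma ess_bounded_const: "(\<lambda>w. c) \<in> ess_bounded N"
  by (rule ess_boundedI[where C = "cmod c"]) auto

lemma ess_bounded_indicator: "A \<in> sets N \<Longrightarrow> indicator A \<in> ess_bounded N"
  by (rule ess_boundedI[where C = 1]) (auto simp: indicator_def)

lemma ess_bounded_add:
  assumes "f \<in> ess_bounded N" "g \<in> ess_bounded N" shows "(\<lambda>w. f w + g w) \<in> ess_bounded N"
proof -
  obtain B C where "AE w in N. cmod (f w) \<le> B" "AE w in N. cmod (g w) \<le> C"
    using assms by (auto simp: ess_bounded_def)
  then have "AE w in N. cmod (f w + g w) \<le> B + C"
    by eventually_elim (intro norm_triangle_le add_mono)
  then show ?thesis
    by (rule ess_boundedI[OF borel_measurable_add[OF assms[THEN ess_bounded_measurable]]])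
qed

lemma ess_bounded_mult:
  assumes "f \<in> ess_bounded N" "g \<in> ess_bounded N" shows "(\<lambda>w. f w * g w) \<in> ess_bounded N"
proof -
  obtain B C where "0 \<le> B" "AE w in N. cmod (f w) \<le> B" "AE w in N. cmod (g w) \<le> C"
    using assms ess_bounded_bound by metis
  then have "AE w in N. cmod (f w * g w) \<le> B * C"
    by (auto elim!: eventually_elim2 simp: norm_mult intro!: mult_mono)
  then show ?thesis
    by (rule ess_boundedI[OF borel_measurable_times[OF assms[THEN ess_bounded_measurable]]])
qed

lemma ess_bounded_smult: "f \<in> ess_bounded N \<Longrightarrow> (\<lambda>w. c * f w) \<in> ess_bounded N"
  using ess_bounded_mult[OF ess_bounded_const] .

lemma borel_measurable_cnj [measurable (raw)]:
  "f \<in> borel_measurable N \<Longrightarrow> (\<lambda>w. cnj (f w)) \<in> borel_measurable N"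
  by (rule borel_measurable_continuous_onI[THEN measurable_compose[rotated]]) (auto intro: continuous_intros)

lemma ess_bounded_cnj: "f \<in> ess_bounded N \<Longrightarrow> (\<lambda>w. cnj (f w)) \<in> ess_bounded N"
  by (auto simp: ess_bounded_def intro: borel_measurable_cnj)

lemma (in finite_measure) ess_bounded_integrable:
  assumes "f \<in> ess_bounded M" shows "integrable M f"
  using assms by (auto simp: ess_bounded_def intro: integrable_const_bound)

text \<open>It suffices to test the set where the bound fails: there \<open>u - C\<close> is
  positive, so an integral \<le> 0 over this set makes it a null set.\<close>

lemma AE_le_of_integral_indicator:
  fixes u :: "'w \<Rightarrow> real"
  assumes N: "finite_measure N" and u: "integrable N u"
    and le: "(\<integral>w. u w * indicator {w\<in>space N. C < u w} w \<partial>N) \<le> C * measure N {w\<in>space N. C < u w}"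
  shows "AE w in N. u w \<le> C"
proof -
  interpret finite_measure N by fact
  let ?A = "{w\<in>space N. C < u w}"
  have m [measurable]: "u \<in> borel_measurable N" using u by simp
  have A: "?A \<in> sets N" by measurable
  have i1: "integrable N (\<lambda>w. u w * indicator ?A w)" using u A by (rule integrable_real_mult_indicator[rotated])
  have i2: "integrable N (\<lambda>w. C * indicator ?A w)" using A by (intro integrable_mult_right) (simp add: integrable_indicator_iff emeasure_eq_measure)
  let ?g = "\<lambda>w. u w * indicator ?A w - C * indicator ?A w"
  have "(\<integral>w. ?g w \<partial>N) \<le> 0"
    using le A i1 i2 by simp
  moreover have nn: "AE w in N. 0 \<le> ?g w" by (auto simp: indicator_def)
  ultimately have "(\<integral>w. ?g w \<partial>N) = 0" using integral_nonneg_AE[OF nn] by linarith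
  then have "AE w in N. ?g w = 0"
    using integral_nonneg_eq_0_iff_AE[OF _ nn] i1 i2 by auto
  then show ?thesis
    using AE_space by eventually_elim (auto simp: indicator_def split: if_splits)
qed

text \<open>Adding a multiple of the measure makes the set function positive, so that the Radon-Nikodym theorem
  applies without a Hahn decomposition.\<close>

lemma (in finite_measure) bounded_additive_density:
  fixes R :: "'a set \<Rightarrow> real"
  assumes add: "\<And>A B. A \<in> sets M \<Longrightarrow> B \<in> sets M \<Longrightarrow> A \<inter> B = {} \<Longrightarrow> R (A \<union> B) = R A + R B"
    and bd: "\<And>A. A \<in> sets M \<Longrightarrow> \<bar>R A\<bar> \<le> C * measure M A"
  obtains h :: "'a \<Rightarrow> real" and B where "h \<in> borel_measurable M" "AE w in M. \<bar>h w\<bar> \<le> B"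
    "\<And>A. A \<in> sets M \<Longrightarrow> R A = (\<integral>w. h w * indicator A w \<partial>M)"
proof -
  have bd': "\<bar>R A\<bar> \<le> \<bar>C\<bar> * measure M A" if "A \<in> sets M" for A
    using bd[OF that] by (rule order_trans) (simp add: mult_right_mono)
  define \<mu> where "\<mu> A = ennreal (R A + \<bar>C\<bar> * measure M A)" for A
  have nn: "0 \<le> R A + \<bar>C\<bar> * measure M A" if "A \<in> sets M" for A
    using bd'[OF that] by linarith
  have le: "R A + \<bar>C\<bar> * measure M A \<le> 2 * \<bar>C\<bar> * measure M A" if "A \<in> sets M" for A
    using bd'[OF that] by linarith
  have R0: "R {} = 0" using bd[of "{}"] by simp
  \<comment> \<open>Finite additivity is given, so continuity at the empty set is enough, and there
    \<open>\<mu>\<close> is squeezed below a multiple of the measure.\<close>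
  have ca: "countably_additive (sets M) \<mu>"
  proof (rule sets.empty_continuous_imp_countably_additive)
    show "positive (sets M) \<mu>" by (simp add: positive_def \<mu>_def R0)
    show "Measure_Space.additive (sets M) \<mu>"
      unfolding Measure_Space.additive_def \<mu>_def
      by (auto simp: add nn finite_measure_Union ennreal_plus[symmetric] algebra_simps simp del: ennreal_plus)
    fix A :: "nat \<Rightarrow> 'a set" assume A: "range A \<subseteq> sets M" "decseq A" "(\<Inter>i. A i) = {}"
    have "(\<lambda>i. measure M (A i)) \<longlonglongrightarrow> 0"
      using finite_Lim_measure_decseq[OF A(1,2)] A(3) by simp
    then have l: "(\<lambda>i. 2 * \<bar>C\<bar> * measure M (A i)) \<longlonglongrightarrow> 0"
      by (rule tendsto_mult_right_zero)
    have "(\<lambda>i. R (A i) + \<bar>C\<bar> * measure M (A i)) \<longlonglongrightarrow> 0"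
      by (rule tendsto_sandwich[OF _ _ tendsto_const l]) (use A nn le in \<open>auto intro!: always_eventually\<close>)
    then show "(\<lambda>i. \<mu> (A i)) \<longlonglongrightarrow> 0"
      unfolding \<mu>_def by (metis ennreal_0 tendsto_ennrealI)
  qed (simp add: \<mu>_def)
  define N' where "N' = measure_of (space M) (sets M) \<mu>"
  have sN: "sets N' = sets M" "space N' = space M" by (simp_all add: N'_def)
  have eN: "emeasure N' A = \<mu> A" if "A \<in> sets M" for A
    unfolding N'_def by (rule emeasure_measure_of_sigma[OF sets.sigma_algebra_axioms _ ca that])
      (simp add: positive_def \<mu>_def R0)
  have "absolutely_continuous M N'"
  proof (unfold absolutely_continuous_def, rule subsetI)
    fix A assume A: "A \<in> null_sets M"
    then have "measure M A = 0" by (simp add: measure_def null_setsD1)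
    with A le[of A] nn[of A] have "R A + \<bar>C\<bar> * measure M A = 0" by (auto dest: null_setsD2)
    then show "A \<in> null_sets N'" using A by (intro null_setsI) (auto simp: eN \<mu>_def sN)
  qed
  from Radon_Nikodym[OF this sN(1)] obtain h where h[measurable]: "h \<in> borel_measurable M" and d: "density M h = N'"
    by auto
  have hA: "(\<integral>\<^sup>+w. h w * indicator A w \<partial>M) = \<mu> A" if "A \<in> sets M" for A
    using eN[OF that] emeasure_density[OF h that] d by simp
  \<comment> \<open>On the set where \<open>h\<close> exceeds 2 |C| the integral of \<open>h\<close>
    would be larger than \<open>le\<close> permits for \<open>\<mu>\<close>.\<close>
  have hb: "AE w in M. h w \<le> ennreal (2 * \<bar>C\<bar>)"
  proof (rule ccontr)
    assume n: "\<not> (AE w in M. h w \<le> ennreal (2 * \<bar>C\<bar>))"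
    define A where "A = {w\<in>space M. ennreal (2 * \<bar>C\<bar>) < h w}"
    have A[measurable]: "A \<in> sets M" unfolding A_def by measurable
    have e: "(\<integral>\<^sup>+w. ennreal (2 * \<bar>C\<bar>) * indicator A w \<partial>M) = ennreal (2 * \<bar>C\<bar> * measure M A)"
      using A by (simp add: nn_integral_cmult_indicator emeasure_eq_measure ennreal_mult)
    have "(\<integral>\<^sup>+w. ennreal (2 * \<bar>C\<bar>) * indicator A w \<partial>M) < (\<integral>\<^sup>+w. h w * indicator A w \<partial>M)"
    proof (rule nn_integral_less)
      show "AE w in M. ennreal (2 * \<bar>C\<bar>) * indicator A w \<le> h w * indicator A w"
        by (auto simp: A_def indicator_def)
      show "\<not> (AE w in M. h w * indicator A w \<le> ennreal (2 * \<bar>C\<bar>) * indicator A w)"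
      proof
        assume "AE w in M. h w * indicator A w \<le> ennreal (2 * \<bar>C\<bar>) * indicator A w"
        then have "AE w in M. h w \<le> ennreal (2 * \<bar>C\<bar>)"
          using AE_space
        proof eventually_elim
          case (elim w)
          then show ?case by (cases "w \<in> A") (auto simp: A_def not_less)
        qed
        with n show False by simp
      qed
    qed (auto simp: e)
    also have "\<dots> = \<mu> A" by (rule hA[OF A])
    also have "\<dots> \<le> ennreal (2 * \<bar>C\<bar> * measure M A)" unfolding \<mu>_def by (intro ennreal_leI le A)
    finally show False using e by simp
  qed
  define k where "k w = enn2real (h w)" for w
  have k[measurable]: "k \<in> borel_measurable M" unfolding k_def by measurable
  have kb: "AE w in M. 0 \<le> k w \<and> k w \<le> 2 * \<bar>C\<bar> \<and> ennreal (k w) = h w"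
    using hb unfolding k_def
  proof eventually_elim
    case (elim w)
    then show ?case by (cases "h w" rule: ennreal_cases) (auto simp: top_unique)
  qed
  have ki: "integrable M k"
    by (rule integrable_const_bound[where B = "2 * \<bar>C\<bar>"]) (use kb in \<open>auto\<close>)
  show ?thesis
  \<comment> \<open>Subtracting |C| removes the multiple of the measure that was added; as
    \<open>k\<close> lies between 0 and 2 |C|, the difference is bounded by |C|.\<close>
  proof (rule that[of "\<lambda>w. k w - \<bar>C\<bar>" "\<bar>C\<bar>"])
    show "AE w in M. \<bar>k w - \<bar>C\<bar>\<bar> \<le> \<bar>C\<bar>" using kb by eventually_elim auto
    fix A assume A: "A \<in> sets M"
    have kA: "integrable M (\<lambda>w. k w * indicator A w)"
      using ki A by (rule integrable_real_mult_indicator[rotated])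
    have "ennreal (\<integral>w. k w * indicator A w \<partial>M) = (\<integral>\<^sup>+w. ennreal (k w * indicator A w) \<partial>M)"
      by (rule nn_integral_eq_integral[symmetric, OF kA]) (auto simp: k_def)
    also have "\<dots> = (\<integral>\<^sup>+w. h w * indicator A w \<partial>M)"
      by (rule nn_integral_cong_AE) (use kb in eventually_elim, auto simp: indicator_def)
    also have "\<dots> = ennreal (R A + \<bar>C\<bar> * measure M A)" using hA[OF A] by (simp add: \<mu>_def)
    finally have "(\<integral>w. k w * indicator A w \<partial>M) = R A + \<bar>C\<bar> * measure M A"
      using nn[OF A] by (subst (asm) ennreal_inj) (auto intro!: integral_nonneg_AE simp: k_def)
    moreover have "(\<integral>w. (k w - \<bar>C\<bar>) * indicator A w \<partial>M) = (\<integral>w. k w * indicator A w - \<bar>C\<bar> * indicator A w \<partial>M)"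
      by (simp add: algebra_simps)
    moreover have "\<dots> = (\<integral>w. k w * indicator A w \<partial>M) - \<bar>C\<bar> * measure M A"
      using A kA by (subst Bochner_Integration.integral_diff) (auto simp: integrable_indicator_iff emeasure_eq_measure)
    ultimately show "R A = (\<integral>w. (k w - \<bar>C\<bar>) * indicator A w \<partial>M)" by simp
  qed measurable
qed

text \<open>The infimum that defines the dual norm is itself an admissible constant. Elements of
  norm 0 are treated apart because the argument divides by the norm.\<close>

lemma cmod_le_dual_norm:
  assumes "\<omega> \<in> bounded_functionals M" "x \<in> carrier M" "\<And>x. x \<in> carrier M \<Longrightarrow> 0 \<le> nrm M x"
  shows "cmod (\<omega> x) \<le> dual_norm M \<omega> * nrm M x"
proof -
  let ?T = "{C. 0 \<le> C \<and> (\<forall>x\<in>carrier M. cmod (\<omega> x) \<le> C * nrm M x)}"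
  obtain C where C: "\<forall>x\<in>carrier M. cmod (\<omega> x) \<le> C * nrm M x"
    using assms(1) by (auto simp: bounded_functionals_def)
  have ne: "\<bar>C\<bar> \<in> ?T"
    using C assms(3) by (auto intro!: order_trans[OF bspec[OF C] mult_right_mono])
  show ?thesis
  proof (cases "nrm M x = 0")
    case True
    then show ?thesis using C assms(2) by force
  next
    case False
    then have p: "0 < nrm M x" using assms(2,3) by fastforce
    have "cmod (\<omega> x) / nrm M x \<le> Inf ?T"
    proof (rule cInf_greatest)
      show "?T \<noteq> {}" using ne by blast
    qed (use p assms(2) in \<open>auto simp: field_simps\<close>)
    then show ?thesis using p by (simp add: dual_norm_def field_simps)
  qed
qed

lemma dual_norm_le:
  assumes "0 \<le> C" "\<And>x. x \<in> carrier M \<Longrightarrow> cmod (\<omega> x) \<le> C * nrm M x"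
  shows "dual_norm M \<omega> \<le> C"
  unfolding dual_norm_def by (rule cInf_lower) (use assms in \<open>auto intro: bdd_belowI[of _ 0]\<close>)

text \<open>An algebra that is L-infinity of \<open>N\<close> up to notation: besides a faithful
  evaluation modulo null sets, every essentially bounded function is required to occur. The
  multiplication operators and the classes of functions are the two instances.\<close>

locale linf_model = prob_space N + func_model M "ae_filter N" \<theta>
  for N :: "'w measure" and M :: "'a star_alg" (structure) and \<theta> +
  assumes theta_ess: "x \<in> carrier M \<Longrightarrow> \<theta> x \<in> ess_bounded N"
    and theta_surj: "f \<in> ess_bounded N \<Longrightarrow> \<exists>x\<in>carrier M. AE w in N. \<theta> x w = f w"
begin

lemma theta_meas: "x \<in> carrier M \<Longrightarrow> \<theta> x \<in> borel_measurable N"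
  using theta_ess by (rule ess_bounded_measurable)

text \<open>The estimates for the countably many index pairs hold outside one common null set; off
  this set the sequence converges uniformly, and \<open>theta_surj\<close> turns the limit function
  into an element.\<close>

lemma cstar: "cstar_algebra M"
proof (rule cstar_algebraI)
  fix s assume s: "s \<in> cauchy_seqs M (nrm M)"
  have sc: "s n \<in> carrier M" for n using s by (simp add: cauchy_seqs_def)
  have "\<forall>k. \<exists>K. \<forall>m\<ge>K. \<forall>n\<ge>K. AE w in N. cmod (\<theta> (s m) w - \<theta> (s n) w) \<le> 1 / Suc k"
    using s unfolding cauchy_seqs_nrm_iff by simp
  then obtain K where K: "\<And>k m n. K k \<le> m \<Longrightarrow> K k \<le> n \<Longrightarrow> AE w in N. cmod (\<theta> (s m) w - \<theta> (s n) w) \<le> 1 / Suc k"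
    by metis
  have "AE w in N. \<forall>k m n. K k \<le> m \<longrightarrow> K k \<le> n \<longrightarrow> cmod (\<theta> (s m) w - \<theta> (s n) w) \<le> 1 / Suc k"
    unfolding AE_all_countable using K by auto
  then have ae: "AE w in N. (\<lambda>n. \<theta> (s n) w) \<longlonglongrightarrow> lim (\<lambda>n. \<theta> (s n) w) \<and>
     (\<forall>k. \<forall>n\<ge>K k. cmod (\<theta> (s n) w - lim (\<lambda>n. \<theta> (s n) w)) \<le> 1 / Suc k)"
  proof eventually_elim
    case (elim w)
    have "Cauchy (\<lambda>n. \<theta> (s n) w)"
    proof (rule CauchyI)
      fix e :: real assume "e > 0"
      then obtain k where k: "1 / real (Suc k) < e"
        using reals_Archimedean by (auto simp: inverse_eq_divide)
      show "\<exists>M. \<forall>m\<ge>M. \<forall>n\<ge>M. cmod (\<theta> (s m) w - \<theta> (s n) w) < e"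
        using elim k by (intro exI[of _ "K k"]) (meson le_less_trans)
    qed
    then have l: "(\<lambda>n. \<theta> (s n) w) \<longlonglongrightarrow> lim (\<lambda>n. \<theta> (s n) w)"
      by (simp add: Cauchy_convergent_iff convergent_LIMSEQ_iff)
    have "cmod (\<theta> (s n) w - lim (\<lambda>n. \<theta> (s n) w)) \<le> 1 / Suc k" if "K k \<le> n" for k n
    proof (rule LIMSEQ_le_const2[where X = "\<lambda>m. cmod (\<theta> (s n) w - \<theta> (s m) w)"])
      show "(\<lambda>m. cmod (\<theta> (s n) w - \<theta> (s m) w)) \<longlonglongrightarrow> cmod (\<theta> (s n) w - lim (\<lambda>n. \<theta> (s n) w))"
        by (intro tendsto_intros l)
      show "\<exists>N. \<forall>m\<ge>N. cmod (\<theta> (s n) w - \<theta> (s m) w) \<le> 1 / Suc k"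
        using elim that by (intro exI[of _ "K k"]) auto
    qed
    with l show ?case by blast
  qed
  define f where "f = (\<lambda>w. lim (\<lambda>n. \<theta> (s n) w))"
  have "f \<in> borel_measurable N"
    unfolding f_def by (rule borel_measurable_lim_metric) (rule theta_meas[OF sc])
  \<comment> \<open>From \<open>K 0\<close> on the error is at most 1 / Suc 0 = 1, whence the bound
    \<open>C + 1\<close>.\<close>
  moreover obtain C where "AE w in N. cmod (\<theta> (s (K 0)) w) \<le> C"
    using theta_ess[OF sc] by (auto simp: ess_bounded_def)
  with ae have "AE w in N. cmod (f w) \<le> C + 1"
  proof eventually_elim
    case (elim w)
    then have "cmod (\<theta> (s (K 0)) w - f w) \<le> 1 / real (Suc 0)" unfolding f_def by blast
    then show ?case using elim(2) norm_triangle_ineq4[of "\<theta> (s (K 0)) w" "\<theta> (s (K 0)) w - f w"] by simp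
  qed
  ultimately obtain x where x: "x \<in> carrier M" "AE w in N. \<theta> x w = f w"
    using theta_surj[of f] by (auto simp: ess_bounded_def)
  have le: "nrm M (s n \<ominus> x) \<le> 1 / Suc k" if "K k \<le> n" for k n
  proof (subst nrm_le_iff[OF minus_closed'[OF sc x(1)]])
    show "AE w in N. cmod (\<theta> (s n \<ominus> x) w) \<le> 1 / Suc k"
      using theta_minus[OF sc x(1), of n] x(2) ae
      by eventually_elim (use that in \<open>auto simp: f_def\<close>)
  qed simp
  have "(\<lambda>n. nrm M (s n \<ominus> x)) \<longlonglongrightarrow> 0"
  proof (rule LIMSEQ_I)
    fix e :: real assume "e > 0"
    then obtain k where k: "1 / real (Suc k) < e"
      using reals_Archimedean by (auto simp: inverse_eq_divide)
    show "\<exists>no. \<forall>n\<ge>no. norm (nrm M (s n \<ominus> x) - 0) < e"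
      using le[of k] k nrm_pos[OF minus_closed'[OF sc x(1)]]
      by (intro exI[of _ "K k"]) (auto intro: le_less_trans)
  qed
  with x(1) show "\<exists>x\<in>carrier M. (\<lambda>n. nrm M (s n \<ominus> x)) \<longlonglongrightarrow> 0" by blast
qed

text \<open>For the converse, the square root of the nonnegative evaluation is again essentially
  bounded, so it is the evaluation of an element \<open>y\<close> with
  \<open>x = star M y \<otimes> y\<close>.\<close>

lemma pos_iff: "x \<in> pos M \<longleftrightarrow> x \<in> carrier M \<and> (AE w in N. Im (\<theta> x w) = 0 \<and> 0 \<le> Re (\<theta> x w))"
proof safe
  assume "x \<in> pos M"
  then obtain y where y: "y \<in> carrier M" "x = star M y \<otimes> y" by (auto simp: pos_def)
  then show "x \<in> carrier M" by (simp add: closed)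
  have "AE w in N. \<theta> x w = cnj (\<theta> y w) * \<theta> y w"
    unfolding y(2) by (rule evals closed y(1))+
  then show "AE w in N. Im (\<theta> x w) = 0 \<and> 0 \<le> Re (\<theta> x w)"
    by eventually_elim simp
next
  assume x: "x \<in> carrier M" and ae: "AE w in N. Im (\<theta> x w) = 0 \<and> 0 \<le> Re (\<theta> x w)"
  obtain C where C: "0 \<le> C" "AE w in N. cmod (\<theta> x w) \<le> C" using ess_bounded_bound[OF theta_ess[OF x]] .
  have "(\<lambda>w. complex_of_real (sqrt (Re (\<theta> x w)))) \<in> ess_bounded N"
  proof (rule ess_boundedI)
    show "(\<lambda>w. complex_of_real (sqrt (Re (\<theta> x w)))) \<in> borel_measurable N"
      using theta_meas[OF x] by measurable
    show "AE w in N. cmod (complex_of_real (sqrt (Re (\<theta> x w)))) \<le> sqrt C"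
      using C(2) ae by eventually_elim (auto intro: order_trans[OF complex_Re_le_cmod])
  qed
  then obtain y where y: "y \<in> carrier M" "AE w in N. \<theta> y w = complex_of_real (sqrt (Re (\<theta> x w)))"
    using theta_surj by blast
  have "AE w in N. \<theta> (star M y \<otimes> y) w = cnj (complex_of_real (sqrt (Re (\<theta> x w)))) * complex_of_real (sqrt (Re (\<theta> x w)))"
    by (rule eval_mult eval_star closed y)+
  moreover have "AE w in N. \<theta> x w = cnj (complex_of_real (sqrt (Re (\<theta> x w)))) * complex_of_real (sqrt (Re (\<theta> x w)))"
    using ae by eventually_elim (simp add: complex_eq_iff)
  ultimately have "x = star M y \<otimes> y"
    by (intro eqI[OF x]) (auto simp: closed y)
  then show "x \<in> pos M" using y(1) by (auto simp: pos_def)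
qed

lemma pos_carrier: "x \<in> pos M \<Longrightarrow> x \<in> carrier M"
  by (simp add: pos_iff)

lemma le_alg_iff:
  assumes "x \<in> pos M" "y \<in> pos M"
  shows "le_alg M x y \<longleftrightarrow> (AE w in N. Re (\<theta> x w) \<le> Re (\<theta> y w))"
proof -
  have "AE w in N. (Im (\<theta> (y \<ominus> x) w) = 0 \<and> 0 \<le> Re (\<theta> (y \<ominus> x) w)) = (Re (\<theta> x w) \<le> Re (\<theta> y w))"
    using assms theta_minus[of y x] unfolding pos_iff by (auto elim: eventually_elim2)
  then have "(AE w in N. Im (\<theta> (y \<ominus> x) w) = 0 \<and> 0 \<le> Re (\<theta> (y \<ominus> x) w)) \<longleftrightarrow> (AE w in N. Re (\<theta> x w) \<le> Re (\<theta> y w))"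
    by (rule eventually_subst)
  then show ?thesis
    using assms minus_closed'[of y x] by (simp add: le_alg_def pos_iff)
qed

lemma theta_integrable: "x \<in> carrier M \<Longrightarrow> integrable N (\<theta> x)"
  by (rule ess_bounded_integrable[OF theta_ess])

definition elt :: "('w \<Rightarrow> complex) \<Rightarrow> 'a" where
  "elt f = (SOME x. x \<in> carrier M \<and> (AE w in N. \<theta> x w = f w))"

lemma elt: assumes "f \<in> ess_bounded N" shows "elt f \<in> carrier M" "AE w in N. \<theta> (elt f) w = f w"
proof -
  have "\<exists>x. x \<in> carrier M \<and> (AE w in N. \<theta> x w = f w)" using theta_surj[OF assms] by blast
  from someI_ex[OF this] show "elt f \<in> carrier M" "AE w in N. \<theta> (elt f) w = f w"
    unfolding elt_def by simp_all
qed

lemma Re_theta_integrable: "x \<in> carrier M \<Longrightarrow> integrable N (\<lambda>w. Re (\<theta> x w))"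
  using theta_integrable by (rule integrable_Re)

lemma functional_weight_eq:
  assumes "x \<in> carrier M" "\<tau> x = (\<integral>w. \<theta> x w \<partial>N)"
  shows "functional_weight \<tau> x = ennreal (\<integral>w. Re (\<theta> x w) \<partial>N)"
  by (simp add: functional_weight_def assms(2) theta_integrable[OF assms(1)])

section \<open>Integration as a faithful normal semifinite weight\<close>

lemma weight_tau:
  assumes tau: "\<And>x. x \<in> carrier M \<Longrightarrow> \<tau> x = (\<integral>w. \<theta> x w \<partial>N)"
  shows "weight M (functional_weight \<tau>)"
  unfolding weight_def
proof (intro conjI ballI allI impI)
  fix x y assume x: "x \<in> pos M" and y: "y \<in> pos M"
  note c = x[THEN pos_carrier] y[THEN pos_carrier]
  have "(\<integral>w. Re (\<theta> (x \<oplus> y) w) \<partial>N) = (\<integral>w. Re (\<theta> x w) + Re (\<theta> y w) \<partial>N)"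
    by (rule integral_cong_AE) (use theta_add[OF c] theta_meas closed c in \<open>auto elim: eventually_mono\<close>)
  also have "\<dots> = (\<integral>w. Re (\<theta> x w) \<partial>N) + (\<integral>w. Re (\<theta> y w) \<partial>N)"
    using c[THEN Re_theta_integrable] by (rule Bochner_Integration.integral_add)
  finally have *: "(\<integral>w. Re (\<theta> (x \<oplus> y) w) \<partial>N) = (\<integral>w. Re (\<theta> x w) \<partial>N) + (\<integral>w. Re (\<theta> y w) \<partial>N)" .
  have nn: "0 \<le> (\<integral>w. Re (\<theta> x w) \<partial>N)" if "x \<in> pos M" for x
    using that by (intro integral_nonneg_AE) (auto simp: pos_iff)
  show "functional_weight \<tau> (x \<oplus> y) = functional_weight \<tau> x + functional_weight \<tau> y"
    using c nn[OF x] nn[OF y] by (simp add: functional_weight_eq closed tau * )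
next
  fix t :: real and x assume t: "0 \<le> t" and x: "x \<in> pos M"
  note c = x[THEN pos_carrier]
  have "(\<integral>w. Re (\<theta> (complex_of_real t \<odot> x) w) \<partial>N) = (\<integral>w. t * Re (\<theta> x w) \<partial>N)"
    by (rule integral_cong_AE) (use theta_smult[OF c, of t] theta_meas closed c in \<open>auto elim: eventually_mono\<close>)
  then show "functional_weight \<tau> (complex_of_real t \<odot> x) = ennreal t * functional_weight \<tau> x"
    using t c by (simp add: functional_weight_eq closed tau ennreal_mult')
qed

lemma faithful_tau:
  assumes tau: "\<And>x. x \<in> carrier M \<Longrightarrow> \<tau> x = (\<integral>w. \<theta> x w \<partial>N)"
  shows "faithful_weight M (functional_weight \<tau>)"
  unfolding faithful_weight_def
proof (intro ballI impI)
  fix x assume x: "x \<in> pos M" and z: "functional_weight \<tau> x = 0"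
  have nn: "AE w in N. 0 \<le> Re (\<theta> x w)" using x by (auto simp: pos_iff)
  have "(\<integral>w. Re (\<theta> x w) \<partial>N) \<le> 0"
    using z pos_carrier[OF x] by (simp add: functional_weight_eq tau ennreal_eq_0_iff)
  then have "(\<integral>w. Re (\<theta> x w) \<partial>N) = 0" using integral_nonneg_AE[OF nn] by simp
  then have "AE w in N. Re (\<theta> x w) = 0"
    using integral_nonneg_eq_0_iff_AE[OF Re_theta_integrable nn] pos_carrier[OF x] by blast
  moreover have "AE w in N. Im (\<theta> x w) = 0" using x by (auto simp: pos_iff)
  ultimately have "AE w in N. \<theta> x w = 0" by eventually_elim (simp add: complex_eq_iff)
  then show "x = \<zero>" by (rule eqI[OF pos_carrier[OF x] zero_closed _ theta_zero])
qed

text \<open>Monotone convergence concerns sequences, while \<open>D\<close> may be uncountable, so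
  an increasing sequence \<open>b\<close> in \<open>D\<close> is chosen whose integrals tend to
  their supremum \<open>S\<close>. Its limit \<open>f\<close> has integral \<open>S\<close>; hence
  no member of \<open>D\<close> can exceed \<open>f\<close> on a set of positive measure, and
  \<open>x\<close>, as least upper bound, lies below the element with evaluation
  \<open>f\<close>.\<close>

lemma normal_tau:
  assumes tau: "\<And>x. x \<in> carrier M \<Longrightarrow> \<tau> x = (\<integral>w. \<theta> x w \<partial>N)"
  shows "normal_weight M (functional_weight \<tau>)"
  unfolding normal_weight_def
proof (intro allI impI, elim conjE)
  fix D x
  assume D: "D \<subseteq> pos M" "D \<noteq> {}" and dir: "\<forall>a\<in>D. \<forall>b\<in>D. \<exists>c\<in>D. le_alg M a c \<and> le_alg M b c"
    and x: "x \<in> pos M" and ub: "\<forall>a\<in>D. le_alg M a x"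
    and lub: "\<forall>y\<in>pos M. (\<forall>a\<in>D. le_alg M a y) \<longrightarrow> le_alg M x y"
  define r where "r a = (\<lambda>w. Re (\<theta> a w))" for a
  define I where "I a = (\<integral>w. r a w \<partial>N)" for a
  have rm [measurable]: "r a \<in> borel_measurable N" if "a \<in> pos M" for a
    unfolding r_def using theta_meas[OF pos_carrier[OF that]] by measurable
  have ri: "integrable N (r a)" if "a \<in> pos M" for a
    unfolding r_def by (rule Re_theta_integrable[OF pos_carrier[OF that]])
  have rpos: "AE w in N. 0 \<le> r a w" if "a \<in> pos M" for a
    using that by (auto simp: pos_iff r_def)
  have le: "le_alg M a b \<longleftrightarrow> (AE w in N. r a w \<le> r b w)" if "a \<in> pos M" "b \<in> pos M" for a b
    unfolding r_def by (rule le_alg_iff[OF that])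
  have mono: "I a \<le> I b" if "a \<in> pos M" "b \<in> pos M" "AE w in N. r a w \<le> r b w" for a b
    unfolding I_def by (rule integral_mono_AE) (use ri that in auto)
  have fw: "functional_weight \<tau> a = ennreal (I a)" if "a \<in> pos M" for a
    using functional_weight_eq[of a \<tau>] pos_carrier[OF that] tau by (simp add: I_def r_def)
  have rx: "AE w in N. r a w \<le> r x w" if "a \<in> D" for a
    using ub that D(1) le[OF _ x] by auto
  have bdd: "bdd_above (I ` D)"
    by (rule bdd_aboveI[of _ "I x"]) (use mono[OF _ x rx] D(1) in auto)
  define S where "S = Sup (I ` D)"
  have IS: "I a \<le> S" if "a \<in> D" for a
    unfolding S_def using that bdd by (intro cSup_upper) auto
  \<comment> \<open>Directedness combines two demands on the next member: to lie above the current
    one, and above some \<open>a\<close> whose integral is within 1 / Suc n of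
    \<open>S\<close>.\<close>
  have "\<exists>b. (b 0 \<in> D) \<and> (\<forall>n. b (Suc n) \<in> D \<and> (AE w in N. r (b n) w \<le> r (b (Suc n)) w) \<and> S - 1 / Suc n < I (b (Suc n)))"
  proof -
    obtain d where d: "d \<in> D" using D(2) by blast
    have "\<exists>c. c \<in> D \<and> (AE w in N. r b w \<le> r c w) \<and> S - 1 / Suc n < I c" if b: "b \<in> D" for b n
    proof -
      obtain a where a: "a \<in> D" "S - 1 / Suc n < I a"
        using less_cSupD[of "I ` D" "S - 1 / real (Suc n)"] D(2) unfolding S_def[symmetric] by auto
      obtain c where c: "c \<in> D" "le_alg M a c" "le_alg M b c" using dir a b by blast
      have p: "a \<in> pos M" "b \<in> pos M" "c \<in> pos M" using a b c D(1) by auto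
      then have "I a \<le> I c" using mono c(2) unfolding le[OF p(1,3)] by simp
      then show ?thesis using c a(2) unfolding le[OF p(2,3)] by (intro exI[of _ c]) simp
    qed
    note ex = this
    define f where "f n b = (SOME c. c \<in> D \<and> (AE w in N. r b w \<le> r c w) \<and> S - 1 / Suc n < I c)" for n b
    have f: "f n b \<in> D \<and> (AE w in N. r b w \<le> r (f n b) w) \<and> S - 1 / real (Suc n) < I (f n b)" if "b \<in> D" for n b
      unfolding f_def by (rule someI_ex[OF ex[OF that]])
    define b where "b = rec_nat d f"
    have bS: "b 0 = d" "b (Suc n) = f n (b n)" for n by (simp_all add: b_def)
    have bD: "b n \<in> D" for n by (induction n) (use f d in \<open>simp_all add: bS\<close>)
    show ?thesis
      by (rule exI[of _ b]) (use f[OF bD] d in \<open>simp add: bS\<close>)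
  qed
  then obtain b where b0: "b 0 \<in> D" and bs: "\<And>n. b (Suc n) \<in> D"
    and bm: "\<And>n. AE w in N. r (b n) w \<le> r (b (Suc n)) w" and bS: "\<And>n. S - 1 / Suc n < I (b (Suc n))"
    by blast
  have bD: "b n \<in> D" for n by (cases n) (auto simp: b0 bs)
  then have bp: "b n \<in> pos M" for n using D(1) by blast
  have Ib: "(\<lambda>n. I (b n)) \<longlonglongrightarrow> S"
  proof (rule LIMSEQ_imp_Suc, rule tendsto_sandwich)
    show "(\<lambda>n. S - 1 / real (Suc n)) \<longlonglongrightarrow> S"
      using tendsto_diff[OF tendsto_const LIMSEQ_Suc[OF lim_1_over_n], of S] by simp
    show "\<forall>\<^sub>F n in sequentially. S - 1 / real (Suc n) \<le> I (b (Suc n))" using bS by (simp add: less_imp_le)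
    show "\<forall>\<^sub>F n in sequentially. I (b (Suc n)) \<le> S" using IS[OF bD] by simp
  qed simp
  define f where "f = (\<lambda>w. lim (\<lambda>n. r (b n) w))"
  have fm [measurable]: "f \<in> borel_measurable N"
    unfolding f_def by (rule borel_measurable_lim_metric) (rule rm[OF bp])
  have lim: "AE w in N. (\<lambda>n. r (b n) w) \<longlonglongrightarrow> f w"
  proof -
    have "AE w in N. \<forall>n. r (b n) w \<le> r (b (Suc n)) w" "AE w in N. \<forall>n. r (b n) w \<le> r x w"
      using bm rx[OF bD] by (auto simp: AE_all_countable)
    then show ?thesis
    proof eventually_elim
      case (elim w)
      have "convergent (\<lambda>n. r (b n) w)"
        by (rule incseq_convergent[of "\<lambda>n. r (b n) w" "r x w"])
          (use elim in \<open>auto intro: incseq_SucI convergentI\<close>)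
      then show ?case by (simp add: f_def convergent_LIMSEQ_iff)
    qed
  qed
  have fle: "AE w in N. 0 \<le> f w \<and> f w \<le> r x w"
  proof -
    have "AE w in N. \<forall>n. 0 \<le> r (b n) w" "AE w in N. \<forall>n. r (b n) w \<le> r x w"
      using rpos[OF bp] rx[OF bD] by (auto simp: AE_all_countable)
    then show ?thesis using lim
      by eventually_elim (auto intro: LIMSEQ_le_const LIMSEQ_le_const2)
  qed
  have fi: "integrable N f"
    by (rule Bochner_Integration.integrable_bound[OF ri[OF x] fm]) (use fle in eventually_elim, auto)
  have dom: "(\<lambda>n. \<integral>w. max (r a w) (r (b n) w) \<partial>N) \<longlonglongrightarrow> (\<integral>w. max (r a w) (f w) \<partial>N)" if a: "a \<in> D" for a
  proof (rule integral_dominated_convergence[where w = "r x"])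
    have ap: "a \<in> pos M" using a D(1) by blast
    show "AE w in N. (\<lambda>n. max (r a w) (r (b n) w)) \<longlonglongrightarrow> max (r a w) (f w)"
      using lim by eventually_elim (intro tendsto_max tendsto_const)
    show "AE w in N. norm (max (r a w) (r (b n) w)) \<le> r x w" for n
      using rx[OF a] rx[OF bD[of n]] rpos[OF ap] by eventually_elim auto
    show "(\<lambda>w. max (r a w) (f w)) \<in> borel_measurable N" using rm[OF ap] by measurable
    show "(\<lambda>w. max (r a w) (r (b n) w)) \<in> borel_measurable N" for n using rm[OF ap] rm[OF bp[of n]] by measurable
  qed (rule ri[OF x])
  have "(\<lambda>n. \<integral>w. r (b n) w \<partial>N) \<longlonglongrightarrow> (\<integral>w. f w \<partial>N)"
  proof (rule integral_dominated_convergence[where w = "r x"])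
    show "AE w in N. norm (r (b n) w) \<le> r x w" for n
      using rx[OF bD[of n]] rpos[OF bp[of n]] by eventually_elim auto
  qed (use lim ri[OF x] rm[OF bp] in auto)
  then have If: "(\<integral>w. f w \<partial>N) = S" using Ib LIMSEQ_unique unfolding I_def by blast
  have af: "AE w in N. r a w \<le> f w" if a: "a \<in> D" for a
  proof -
    have ap: "a \<in> pos M" using a D(1) by blast
    have mi: "integrable N (\<lambda>w. max (r a w) (f w))"
      using ri[OF ap] fi by (rule integrable_max)
    \<comment> \<open>A common upper bound \<open>c\<close> of \<open>a\<close> and
      \<open>b n\<close> lies in \<open>D\<close>, so it dominates the maximum while its integral is
      at most \<open>S\<close>.\<close>
    have "(\<integral>w. max (r a w) (r (b n) w) \<partial>N) \<le> S" for n
    proof -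
      obtain c where c: "c \<in> D" "le_alg M a c" "le_alg M (b n) c" using dir a bD by blast
      have cp: "c \<in> pos M" using c D(1) by blast
      have "AE w in N. r a w \<le> r c w" "AE w in N. r (b n) w \<le> r c w"
        using c le ap bp cp by auto
      then have "AE w in N. max (r a w) (r (b n) w) \<le> r c w" by eventually_elim simp
      then have "(\<integral>w. max (r a w) (r (b n) w) \<partial>N) \<le> I c"
        unfolding I_def by (intro integral_mono_AE integrable_max ri ap bp cp)
      then show ?thesis using IS[OF c(1)] by simp
    qed
    then have "(\<integral>w. max (r a w) (f w) \<partial>N) \<le> S"
      by (intro LIMSEQ_le_const2[OF dom[OF a]]) auto
    then have "(\<integral>w. max (r a w) (f w) - f w \<partial>N) \<le> 0"
      using mi fi If by simp
    moreover have nn: "AE w in N. 0 \<le> max (r a w) (f w) - f w" by auto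
    ultimately have "(\<integral>w. max (r a w) (f w) - f w \<partial>N) = 0"
      using integral_nonneg_AE[OF nn] by linarith
    then have "AE w in N. max (r a w) (f w) - f w = 0"
      using integral_nonneg_eq_0_iff_AE[OF Bochner_Integration.integrable_diff[OF mi fi] nn] by blast
    then show ?thesis by eventually_elim (auto simp: max_def split: if_splits)
  qed
  \<comment> \<open>Since \<open>f\<close> lies between 0 and the evaluation of \<open>x\<close>, it
    is essentially bounded. It thus gives an upper bound of \<open>D\<close> inside the algebra, to
    which the leastness of \<open>x\<close> applies.\<close>
  have fe: "(\<lambda>w. complex_of_real (f w)) \<in> ess_bounded N"
  proof -
    obtain C where "AE w in N. cmod (\<theta> x w) \<le> C" using theta_ess[OF pos_carrier[OF x]] by (auto simp: ess_bounded_def)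
    with fle have "AE w in N. cmod (complex_of_real (f w)) \<le> C"
      by eventually_elim (auto simp: r_def intro: order_trans[OF complex_Re_le_cmod] order_trans)
    then show ?thesis by (rule ess_boundedI[rotated]) measurable
  qed
  define y where "y = elt (\<lambda>w. complex_of_real (f w))"
  have y: "y \<in> carrier M" "AE w in N. \<theta> y w = complex_of_real (f w)"
    unfolding y_def by (rule elt[OF fe])+
  have yp: "y \<in> pos M" unfolding pos_iff
    by (intro conjI y(1), use y(2) fle in eventually_elim, simp)
  have "le_alg M a y" if "a \<in> D" for a
    using af[OF that] y(2) D(1) that yp by (subst le) (auto simp: r_def elim: eventually_elim2)
  then have "AE w in N. r x w \<le> r y w" using lub[rule_format, OF yp] le[OF x yp] by simp
  then have "AE w in N. r x w \<le> f w" using y(2) by eventually_elim (simp add: r_def)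
  then have "I x \<le> S" unfolding I_def If[symmetric]
    by (intro integral_mono_AE ri x fi)
  show "functional_weight \<tau> x = (SUP a\<in>D. functional_weight \<tau> a)"
  proof (rule antisym)
    have "ennreal (I (b n)) \<le> (SUP a\<in>D. functional_weight \<tau> a)" for n
      unfolding fw[OF bp, symmetric] by (rule SUP_upper[OF bD])
    then have "ennreal S \<le> (SUP a\<in>D. functional_weight \<tau> a)"
      by (intro LIMSEQ_le_const2[OF tendsto_ennrealI[OF Ib]]) auto
    then show "functional_weight \<tau> x \<le> (SUP a\<in>D. functional_weight \<tau> a)"
      using \<open>I x \<le> S\<close> fw[OF x] ennreal_leI order_trans by fastforce
    show "(SUP a\<in>D. functional_weight \<tau> a) \<le> functional_weight \<tau> x"
    proof (rule SUP_least)
      fix a assume a: "a \<in> D"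
      then have ap: "a \<in> pos M" using D(1) by blast
      show "functional_weight \<tau> a \<le> functional_weight \<tau> x"
        unfolding fw[OF ap] fw[OF x] by (intro ennreal_leI mono ap x rx a)
    qed
  qed
qed

text \<open>The weight is finite everywhere, so \<open>x\<close> serves as its own
  approximation.\<close>

lemma semifinite_tau: "semifinite_weight M (functional_weight \<tau>)"
  unfolding semifinite_weight_def
proof (intro allI impI ballI, elim conjE)
  fix E x F and e :: real assume "x \<in> carrier M" "e > 0"
  then show "\<exists>y\<in>carrier M. functional_weight \<tau> (star M y \<otimes> y) < \<infinity> \<and> (\<forall>\<omega>\<in>F. cmod (\<omega> x - \<omega> y) < e)"
    by (intro bexI[of _ x]) (auto simp: functional_weight_def)
qed

section \<open>The predual: functionals with bounded density\<close>

definition fnl :: "('w \<Rightarrow> complex) \<Rightarrow> 'a \<Rightarrow> complex" where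
  "fnl g = (\<lambda>x\<in>carrier M. \<integral>w. \<theta> x w * g w \<partial>N)"

lemma fnl_integrable: "x \<in> carrier M \<Longrightarrow> g \<in> ess_bounded N \<Longrightarrow> integrable N (\<lambda>w. \<theta> x w * g w)"
  by (intro ess_bounded_integrable ess_bounded_mult theta_ess)

lemma fnl_bound:
  assumes x: "x \<in> carrier M" and g: "g \<in> ess_bounded N"
  shows "cmod (fnl g x) \<le> (\<integral>w. cmod (g w) \<partial>N) * nrm M x"
proof -
  have "cmod (fnl g x) \<le> (\<integral>w. cmod (\<theta> x w * g w) \<partial>N)"
    using x by (simp add: fnl_def)
  also have "\<dots> \<le> (\<integral>w. nrm M x * cmod (g w) \<partial>N)"
  proof (rule integral_mono_AE)
    show "AE w in N. cmod (\<theta> x w * g w) \<le> nrm M x * cmod (g w)"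
      using ev_le_nrm[OF x] by eventually_elim (simp add: norm_mult mult_right_mono)
  qed (use fnl_integrable[OF x g] ess_bounded_integrable[OF g] in auto)
  finally show ?thesis by (simp add: mult.commute)
qed

lemma fnl_add:
  assumes "g \<in> ess_bounded N" "h \<in> ess_bounded N"
  shows "fnl (\<lambda>w. g w + h w) = (\<lambda>x\<in>carrier M. fnl g x + fnl h x)"
  using assms by (auto simp: fnl_def fun_eq_iff distrib_left fnl_integrable restrict_def)

lemma fnl_smult:
  assumes "g \<in> ess_bounded N"
  shows "fnl (\<lambda>w. c * g w) = (\<lambda>x\<in>carrier M. c * fnl g x)"
  using assms by (auto simp: fnl_def fun_eq_iff mult.left_commute[of _ c] fnl_integrable restrict_def)

lemma fnl_cong:
  assumes "AE w in N. g w = h w" "g \<in> borel_measurable N" "h \<in> borel_measurable N"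
  shows "fnl g = fnl h"
proof -
  have "(\<integral>w. \<theta> x w * g w \<partial>N) = (\<integral>w. \<theta> x w * h w \<partial>N)" if "x \<in> carrier M" for x
    by (rule integral_cong_AE) (use assms theta_meas[OF that] in \<open>auto elim: eventually_mono\<close>)
  then show ?thesis by (auto simp: fnl_def fun_eq_iff restrict_def)
qed

lemma fnl_in_bounded_functionals:
  assumes g: "g \<in> ess_bounded N" shows "fnl g \<in> bounded_functionals M"
  unfolding bounded_functionals_def mem_Collect_eq
proof (intro conjI ballI allI)
  show "fnl g \<in> extensional (carrier M)" by (simp add: fnl_def)
  show "\<exists>C. \<forall>x\<in>carrier M. cmod (fnl g x) \<le> C * nrm M x" using fnl_bound[OF _ g] by blast
  fix x assume x: "x \<in> carrier M"
  note gm = ess_bounded_measurable[OF g]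
  {
    fix y assume y: "y \<in> carrier M"
    have "(\<integral>w. \<theta> (x \<oplus> y) w * g w \<partial>N) = (\<integral>w. \<theta> x w * g w + \<theta> y w * g w \<partial>N)"
      by (rule integral_cong_AE) (use theta_add[OF x y] theta_meas[OF x] theta_meas[OF y] theta_meas[OF add_closed[OF x y]] gm in
          \<open>auto elim!: eventually_mono simp: distrib_right\<close>)
    then show "fnl g (x \<oplus> y) = fnl g x + fnl g y"
      using x y g by (simp add: fnl_def closed fnl_integrable)
  }
  fix c
  have "(\<integral>w. \<theta> (c \<odot> x) w * g w \<partial>N) = (\<integral>w. c * (\<theta> x w * g w) \<partial>N)"
    by (rule integral_cong_AE) (use theta_smult[OF x, of c] theta_meas[OF x] theta_meas[OF smult_closed[OF x]] gm in
          \<open>auto elim!: eventually_mono\<close>)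
  then show "fnl g (c \<odot> x) = c * fnl g x"
    using x g by (simp add: fnl_def closed)
qed

lemma dual_norm_fnl_le: "g \<in> ess_bounded N \<Longrightarrow> dual_norm M (fnl g) \<le> (\<integral>w. cmod (g w) \<partial>N)"
  by (rule dual_norm_le) (auto intro: fnl_bound)

text \<open>The test density \<open>g\<close> is the conjugate phase of the evaluation on the set
  where its modulus exceeds \<open>C\<close>. Pairing with it integrates the modulus over that set,
  while the L1 norm of \<open>g\<close> is the measure of the set.\<close>

lemma nrm_le_of_fnl_bound:
  assumes x: "x \<in> carrier M" and C: "0 \<le> C"
    and le: "\<And>g. g \<in> ess_bounded N \<Longrightarrow> cmod (fnl g x) \<le> C * (\<integral>w. cmod (g w) \<partial>N)"
  shows "nrm M x \<le> C"
proof -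
  let ?A = "{w\<in>space N. C < cmod (\<theta> x w)}"
  note m [measurable] = theta_meas[OF x]
  have A: "?A \<in> sets N" by measurable
  define g where "g w = indicator ?A w * cnj (sgn (\<theta> x w))" for w
  have ng: "cmod (g w) = indicator ?A w" for w
    using C by (auto simp: g_def indicator_def norm_mult norm_sgn)
  have g: "g \<in> ess_bounded N"
  proof (rule ess_boundedI)
    show "g \<in> borel_measurable N" unfolding g_def sgn_eq using A by measurable
    show "AE w in N. cmod (g w) \<le> 1" by (simp add: ng indicator_def)
  qed
  have tg: "\<theta> x w * g w = complex_of_real (cmod (\<theta> x w) * indicator ?A w)" for w
  proof (cases "w \<in> ?A")
    case True
    then have "\<theta> x w \<noteq> 0" using C by auto
    then show ?thesis using True
      by (simp add: g_def sgn_eq complex_norm_square[symmetric] field_simps power2_eq_square del: of_real_power)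
  qed (simp add: g_def)
  have "(\<integral>w. cmod (\<theta> x w) * indicator ?A w \<partial>N) = Re (fnl g x)"
    by (simp only: fnl_def restrict_apply'[OF x] tg integral_complex_of_real Re_complex_of_real)
  also have "\<dots> \<le> cmod (fnl g x)" by (rule complex_Re_le_cmod)
  also have "\<dots> \<le> C * measure N ?A" using le[OF g] A by (simp add: ng)
  finally have "AE w in N. cmod (\<theta> x w) \<le> C"
    by (intro AE_le_of_integral_indicator finite_measure_axioms integrable_norm theta_integrable x)
  then show ?thesis by (simp add: nrm_le_iff x C)
qed

text \<open>Duality of L1 and L-infinity, tested on bounded functions: the set function
  \<open>L (indicator A)\<close> is dominated by a multiple of the measure, so its real and
  imaginary parts have bounded densities, and induction carries the formula from indicators to all
  essentially bounded functions.\<close>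

lemma functional_represented:
  assumes add: "\<And>g h. g \<in> ess_bounded N \<Longrightarrow> h \<in> ess_bounded N \<Longrightarrow> L (\<lambda>w. g w + h w) = L g + L h"
    and smult: "\<And>c g. g \<in> ess_bounded N \<Longrightarrow> L (\<lambda>w. c * g w) = c * L g"
    and bd: "\<And>g. g \<in> ess_bounded N \<Longrightarrow> cmod (L g) \<le> C * (\<integral>w. cmod (g w) \<partial>N)"
    and cong: "\<And>g h. g \<in> ess_bounded N \<Longrightarrow> h \<in> ess_bounded N \<Longrightarrow> (\<And>w. w \<in> space N \<Longrightarrow> g w = h w) \<Longrightarrow> L g = L h"
  obtains f where "f \<in> ess_bounded N" "\<And>g. g \<in> ess_bounded N \<Longrightarrow> L g = (\<integral>w. f w * g w \<partial>N)"
proof -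
  note ind = ess_bounded_indicator
  have Lind: "L (indicator (A \<union> B)) = L (indicator A) + L (indicator B)"
    if "A \<in> sets N" "B \<in> sets N" "A \<inter> B = {}" for A B
    using add[OF ind[OF that(1)] ind[OF that(2)]] indicator_add[OF that(3)] by (metis (no_types, lifting) ext)
  have Lb: "cmod (L (indicator A)) \<le> C * measure N A" if "A \<in> sets N" for A
  proof -
    have "cmod (indicator A w) = indicator A w" for w by (simp add: indicator_def)
    then show ?thesis using bd[OF ind[OF that]] that by simp
  qed
  obtain h1 B1 where h1: "h1 \<in> borel_measurable N" "AE w in N. \<bar>h1 w\<bar> \<le> B1"
    "\<And>A. A \<in> sets N \<Longrightarrow> Re (L (indicator A)) = (\<integral>w. h1 w * indicator A w \<partial>N)"
  proof (rule bounded_additive_density[of "\<lambda>A. Re (L (indicator A))" C])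
    show "\<bar>Re (L (indicator A))\<bar> \<le> C * measure N A" if "A \<in> sets N" for A
      using abs_Re_le_cmod Lb[OF that] by (rule order_trans)
  qed (simp_all add: Lind)
  obtain h2 B2 where h2: "h2 \<in> borel_measurable N" "AE w in N. \<bar>h2 w\<bar> \<le> B2"
    "\<And>A. A \<in> sets N \<Longrightarrow> Im (L (indicator A)) = (\<integral>w. h2 w * indicator A w \<partial>N)"
  proof (rule bounded_additive_density[of "\<lambda>A. Im (L (indicator A))" C])
    show "\<bar>Im (L (indicator A))\<bar> \<le> C * measure N A" if "A \<in> sets N" for A
      using abs_Im_le_cmod Lb[OF that] by (rule order_trans)
  qed (simp_all add: Lind)
  define f where "f w = Complex (h1 w) (h2 w)" for w
  have fm [measurable]: "f \<in> borel_measurable N"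
    unfolding f_def using h1(1) h2(1) by (simp add: borel_measurable_complex_iff)
  have fb: "AE w in N. cmod (f w) \<le> B1 + B2"
    using h1(2) h2(2) by eventually_elim (simp add: f_def order_trans[OF cmod_le])
  have f: "f \<in> ess_bounded N" using fm fb by (rule ess_boundedI)
  have fi: "integrable N (\<lambda>w. f w * g w)" if "g \<in> ess_bounded N" for g
    by (intro ess_bounded_integrable ess_bounded_mult f that)
  have fA: "L (indicator A) = (\<integral>w. f w * indicator A w \<partial>N)" if A: "A \<in> sets N" for A
  proof -
    note i = fi[OF ind[OF A]]
    have "Re (\<integral>w. f w * indicator A w \<partial>N) = (\<integral>w. h1 w * indicator A w \<partial>N)"
      unfolding integral_Re[OF i, symmetric] by (rule Bochner_Integration.integral_cong) (auto simp: f_def indicator_def)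
    moreover have "Im (\<integral>w. f w * indicator A w \<partial>N) = (\<integral>w. h2 w * indicator A w \<partial>N)"
      unfolding integral_Im[OF i, symmetric] by (rule Bochner_Integration.integral_cong) (auto simp: f_def indicator_def)
    ultimately show ?thesis using h1(3)[OF A] h2(3)[OF A] by (simp add: complex_eq_iff)
  qed
  have "L g = (\<integral>w. f w * g w \<partial>N)" if g: "g \<in> ess_bounded N" for g
  proof -
    have "g \<in> ess_bounded N \<and> L g = (\<integral>w. f w * g w \<partial>N)"
    proof (rule complex_measurable_induct[OF ess_bounded_measurable[OF g], where P = "\<lambda>u. u \<in> ess_bounded N \<and> L u = (\<integral>w. f w * u w \<partial>N)"])
      fix c u assume u: "u \<in> ess_bounded N \<and> L u = (\<integral>w. f w * u w \<partial>N)"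
      then show "(\<lambda>w. c * u w) \<in> ess_bounded N \<and> L (\<lambda>w. c * u w) = (\<integral>w. f w * (c * u w) \<partial>N)"
        using smult[of u c] by (simp add: ess_bounded_smult mult.left_commute[of _ c])
    next
      fix u v assume u: "u \<in> ess_bounded N \<and> L u = (\<integral>w. f w * u w \<partial>N)" and v: "v \<in> ess_bounded N \<and> L v = (\<integral>w. f w * v w \<partial>N)"
      then show "(\<lambda>w. u w + v w) \<in> ess_bounded N \<and> L (\<lambda>w. u w + v w) = (\<integral>w. f w * (u w + v w) \<partial>N)"
        using add[of u v] fi[of u] fi[of v] by (simp add: ess_bounded_add distrib_left)
    next
      fix u v assume u: "u \<in> ess_bounded N \<and> L u = (\<integral>w. f w * u w \<partial>N)"
        and eq: "\<And>w. w \<in> space N \<Longrightarrow> u w = v w" and v: "v \<in> borel_measurable N"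
      obtain B where "AE w in N. cmod (u w) \<le> B" using u by (auto simp: ess_bounded_def)
      then have "AE w in N. cmod (v w) \<le> B" using AE_space by eventually_elim (simp add: eq)
      then have "v \<in> ess_bounded N" using v by (intro ess_boundedI)
      then show "v \<in> ess_bounded N \<and> L v = (\<integral>w. f w * v w \<partial>N)"
        using u cong[of u v] eq Bochner_Integration.integral_cong[of N N "\<lambda>w. f w * u w" "\<lambda>w. f w * v w"] by simp
    next
      fix s assume sP: "\<And>n::nat. s n \<in> ess_bounded N \<and> L (s n) = (\<integral>w. f w * s n w \<partial>N)"
        and lim: "\<And>w. w \<in> space N \<Longrightarrow> (\<lambda>n. s n w) \<longlonglongrightarrow> g w"
        and dom: "\<And>n w. w \<in> space N \<Longrightarrow> cmod (s n w) \<le> 2 * cmod (g w)"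
      note sb = sP[THEN conjunct1] note sm = ess_bounded_measurable[OF sb]
      have gm: "g \<in> borel_measurable N" by (rule ess_bounded_measurable[OF g])
      have gi: "integrable N (\<lambda>w. cmod (g w))" using ess_bounded_integrable[OF g] by simp
      have fgi: "integrable N (\<lambda>w. cmod (f w * g w))" using fi[OF g] by (rule integrable_norm)
      \<comment> \<open>Differences are written as a sum with a scalar multiple, the form that
        \<open>add\<close> and \<open>smult\<close> apply to.\<close>
      have d: "(\<lambda>w. g w + - 1 * s n w) \<in> ess_bounded N" for n
        by (intro ess_bounded_add ess_bounded_smult g sb)
      have t: "cmod (g w - s n w) \<le> 3 * cmod (g w)" if "w \<in> space N" for n w
        using norm_triangle_ineq4[of "g w" "s n w"] dom[OF that, of n] by linarith
      \<comment> \<open>The bound on \<open>L\<close> turns convergence in L1 into convergence of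
        \<open>L (s n)\<close>. The factor 3 of the dominating function is 1 + 2, with 2 from the
        bound on \<open>s n\<close>.\<close>
      have "(\<lambda>n. \<integral>w. cmod (g w - s n w) \<partial>N) \<longlonglongrightarrow> (\<integral>w. 0 \<partial>N)"
      proof (rule integral_dominated_convergence[where w = "\<lambda>w. 3 * cmod (g w)"])
        show "AE w in N. (\<lambda>n. cmod (g w - s n w)) \<longlonglongrightarrow> 0"
          using AE_space
        proof eventually_elim
          case (elim w)
          then have "(\<lambda>n. cmod (g w - s n w)) \<longlonglongrightarrow> cmod (g w - g w)" by (intro tendsto_intros lim)
          then show ?case by simp
        qed
      qed (use gm sm gi t in \<open>auto\<close>)
      then have "(\<lambda>n. C * (\<integral>w. cmod (g w - s n w) \<partial>N)) \<longlonglongrightarrow> 0"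
        by (intro tendsto_mult_right_zero) simp
      moreover have "cmod (L g - L (s n)) \<le> C * (\<integral>w. cmod (g w - s n w) \<partial>N)" for n
        using bd[OF d] add[OF g ess_bounded_smult[OF sb], of "- 1"] smult[OF sb, of "-1"] by simp
      ultimately have "(\<lambda>n. L g - L (s n)) \<longlonglongrightarrow> 0"
        using Lim_null_comparison[of "\<lambda>n. L g - L (s n)" "\<lambda>n. C * (\<integral>w. cmod (g w - s n w) \<partial>N)" sequentially]
        by simp
      then have "(\<lambda>n. L g - (L g - L (s n))) \<longlonglongrightarrow> L g - 0"
        by (intro tendsto_intros)
      then have l1: "(\<lambda>n. \<integral>w. f w * s n w \<partial>N) \<longlonglongrightarrow> L g" using sP by simp
      have l2: "(\<lambda>n. \<integral>w. f w * s n w \<partial>N) \<longlonglongrightarrow> (\<integral>w. f w * g w \<partial>N)"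
      proof (rule integral_dominated_convergence[where w = "\<lambda>w. 2 * cmod (f w * g w)"])
        show "AE w in N. (\<lambda>n. f w * s n w) \<longlonglongrightarrow> f w * g w"
          using AE_space by eventually_elim (intro tendsto_intros lim)
        show "AE w in N. norm (f w * s n w) \<le> 2 * cmod (f w * g w)" for n
          using AE_space
        proof eventually_elim
          case (elim w)
          then show ?case using mult_left_mono[OF dom[OF elim, of n], of "cmod (f w)"] by (simp add: norm_mult)
        qed
      qed (use gm fm sm fgi in auto)
      show "g \<in> ess_bounded N \<and> L g = (\<integral>w. f w * g w \<partial>N)"
        using g LIMSEQ_unique[OF l1 l2] by simp
    qed (use fA ind in auto)
    then show ?thesis by simp
  qed
  then show ?thesis by (rule that[OF f])
qed

text \<open>As a predual need not be closed, the integrals against essentially bounded densities suffice, and an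
  upper bound for their dual norms is all that is needed.\<close>

lemma wstar: "wstar_algebra M"
  unfolding wstar_algebra_def
proof (intro conjI exI[of _ "fnl ` ess_bounded N"] cstar)
  show "is_predual M (fnl ` ess_bounded N)"
    unfolding is_predual_def
  proof (intro conjI ballI allI impI)
    show "fnl ` ess_bounded N \<subseteq> bounded_functionals M"
      using fnl_in_bounded_functionals by blast
    have "fnl (\<lambda>w. 0) = (\<lambda>x\<in>carrier M. 0)" by (simp add: fnl_def)
    then show "(\<lambda>x\<in>carrier M. 0) \<in> fnl ` ess_bounded N"
      using ess_bounded_const[of 0 N] by (metis imageI)
    show "(\<lambda>x\<in>carrier M. \<omega> x + \<psi> x) \<in> fnl ` ess_bounded N"
      if "\<omega> \<in> fnl ` ess_bounded N" "\<psi> \<in> fnl ` ess_bounded N" for \<omega> \<psi>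
      using that fnl_add[symmetric] ess_bounded_add by (auto intro!: image_eqI)
    show "(\<lambda>x\<in>carrier M. c * \<omega> x) \<in> fnl ` ess_bounded N"
      if "\<omega> \<in> fnl ` ess_bounded N" for \<omega> c
      using that fnl_smult[symmetric] ess_bounded_smult by (auto intro!: image_eqI)
    fix x assume x: "x \<in> carrier M"
    show "nrm M x = Inf {C. 0 \<le> C \<and> (\<forall>\<omega>\<in>fnl ` ess_bounded N. cmod (\<omega> x) \<le> C * dual_norm M \<omega>)}"
    proof (rule cInf_eq_minimum[symmetric])
      show "nrm M x \<in> {C. 0 \<le> C \<and> (\<forall>\<omega>\<in>fnl ` ess_bounded N. cmod (\<omega> x) \<le> C * dual_norm M \<omega>)}"
        using cmod_le_dual_norm[OF fnl_in_bounded_functionals x] nrm_pos x by (auto simp: mult.commute)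
      fix C assume C: "C \<in> {C. 0 \<le> C \<and> (\<forall>\<omega>\<in>fnl ` ess_bounded N. cmod (\<omega> x) \<le> C * dual_norm M \<omega>)}"
      show "nrm M x \<le> C"
      proof (rule nrm_le_of_fnl_bound[OF x])
        fix g assume g: "g \<in> ess_bounded N"
        then have "cmod (fnl g x) \<le> C * dual_norm M (fnl g)" using C by blast
        also have "\<dots> \<le> C * (\<integral>w. cmod (g w) \<partial>N)"
          using C by (intro mult_left_mono dual_norm_fnl_le g) auto
        finally show "cmod (fnl g x) \<le> C * (\<integral>w. cmod (g w) \<partial>N)" .
      qed (use C in simp)
    qed
  next
    fix \<Lambda> :: "('a \<Rightarrow> complex) \<Rightarrow> complex"
    assume *: "(\<forall>\<omega>\<in>fnl ` ess_bounded N. \<forall>\<psi>\<in>fnl ` ess_bounded N. \<Lambda> (\<lambda>x\<in>carrier M. \<omega> x + \<psi> x) = \<Lambda> \<omega> + \<Lambda> \<psi>) \<and>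
      (\<forall>c. \<forall>\<omega>\<in>fnl ` ess_bounded N. \<Lambda> (\<lambda>x\<in>carrier M. c * \<omega> x) = c * \<Lambda> \<omega>) \<and>
      (\<exists>C. \<forall>\<omega>\<in>fnl ` ess_bounded N. cmod (\<Lambda> \<omega>) \<le> C * dual_norm M \<omega>)"
    from *[THEN conjunct2, THEN conjunct2] obtain C where
      "\<forall>\<omega>\<in>fnl ` ess_bounded N. cmod (\<Lambda> \<omega>) \<le> C * dual_norm M \<omega>" by (rule exE)
    then have C: "cmod (\<Lambda> (fnl g)) \<le> C * dual_norm M (fnl g)" if "g \<in> ess_bounded N" for g
      using that by simp
    obtain f where f: "f \<in> ess_bounded N" "\<And>g. g \<in> ess_bounded N \<Longrightarrow> \<Lambda> (fnl g) = (\<integral>w. f w * g w \<partial>N)"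
    \<comment> \<open>\<open>C\<close> may be negative, while passing from the dual norm to its
      upper bound, the L1 norm of the density, needs a nonnegative factor; hence the absolute
      value.\<close>
    proof (rule functional_represented[of "\<lambda>g. \<Lambda> (fnl g)" "\<bar>C\<bar>"])
      fix g assume g: "g \<in> ess_bounded N"
      show "\<Lambda> (fnl (\<lambda>w. c * g w)) = c * \<Lambda> (fnl g)" for c
        using * g by (simp add: fnl_smult)
      have d0: "0 \<le> dual_norm M (fnl g)"
        unfolding dual_norm_def
        by (rule cInf_greatest) (use fnl_bound[OF _ g] in \<open>auto intro!: exI[of _ "\<integral>w. cmod (g w) \<partial>N"]\<close>)
      have "cmod (\<Lambda> (fnl g)) \<le> C * dual_norm M (fnl g)" by (rule C[OF g])
      also have "\<dots> \<le> \<bar>C\<bar> * dual_norm M (fnl g)" using d0 by (simp add: mult_right_mono)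
      also have "\<dots> \<le> \<bar>C\<bar> * (\<integral>w. cmod (g w) \<partial>N)" by (intro mult_left_mono dual_norm_fnl_le g) simp
      finally show "cmod (\<Lambda> (fnl g)) \<le> \<bar>C\<bar> * (\<integral>w. cmod (g w) \<partial>N)" .
    next
      fix g h assume g: "g \<in> ess_bounded N" and h: "h \<in> ess_bounded N"
      show "\<Lambda> (fnl (\<lambda>w. g w + h w)) = \<Lambda> (fnl g) + \<Lambda> (fnl h)" using * g h by (simp add: fnl_add)
      show "\<Lambda> (fnl g) = \<Lambda> (fnl h)" if "\<And>w. w \<in> space N \<Longrightarrow> g w = h w"
        using fnl_cong[of g h] that g h by (simp add: ess_bounded_measurable)
    next
      fix f assume "f \<in> ess_bounded N" "\<And>g. g \<in> ess_bounded N \<Longrightarrow> \<Lambda> (fnl g) = (\<integral>w. f w * g w \<partial>N)"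
      then show thesis by (rule that)
    qed
    have "\<Lambda> (fnl g) = fnl g (elt f)" if g: "g \<in> ess_bounded N" for g
    proof -
      have "(\<integral>w. f w * g w \<partial>N) = (\<integral>w. \<theta> (elt f) w * g w \<partial>N)"
        by (rule integral_cong_AE) (use elt[OF f(1)] theta_meas f(1) g in \<open>auto elim: eventually_mono dest: ess_bounded_measurable intro!: borel_measurable_times\<close>)
      then show ?thesis using f(2)[OF g] elt[OF f(1)] by (simp add: fnl_def)
    qed
    then show "\<exists>x\<in>carrier M. \<forall>\<omega>\<in>fnl ` ess_bounded N. \<Lambda> \<omega> = \<omega> x"
      using elt[OF f(1)] by blast
  qed
qed

theorem vn_measure_algebra:
  assumes "\<And>x. x \<in> carrier M \<Longrightarrow> \<tau> x = (\<integral>w. \<theta> x w \<partial>N)"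
  shows "vn_measure_algebra M (functional_weight \<tau>)"
  unfolding vn_measure_algebra_def
  using wstar weight_tau[OF assms] faithful_tau[OF assms] normal_tau[OF assms] semifinite_tau by blast

end

text \<open>An element goes to the one with the same evaluation in the other algebra. Every
  homomorphism law then compares two elements whose evaluations agree almost everywhere, and the
  weights agree since both integrate the evaluation.\<close>

theorem linf_models_isomorphic:
  assumes "linf_model N M\<^sub>1 \<theta>\<^sub>1" and "linf_model N M\<^sub>2 \<theta>\<^sub>2"
    and tau1: "\<And>x. x \<in> carrier M\<^sub>1 \<Longrightarrow> \<tau>\<^sub>1 x = (\<integral>w. \<theta>\<^sub>1 x w \<partial>N)"
    and tau2: "\<And>x. x \<in> carrier M\<^sub>2 \<Longrightarrow> \<tau>\<^sub>2 x = (\<integral>w. \<theta>\<^sub>2 x w \<partial>N)"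
  shows "vn_measure_isomorphic (M\<^sub>1, functional_weight \<tau>\<^sub>1) (M\<^sub>2, functional_weight \<tau>\<^sub>2)"
proof -
  interpret A: linf_model N M\<^sub>1 \<theta>\<^sub>1 by fact
  interpret B: linf_model N M\<^sub>2 \<theta>\<^sub>2 by fact
  define \<Phi> where "\<Phi> x = B.elt (\<theta>\<^sub>1 x)" for x
  have c: "\<Phi> x \<in> carrier M\<^sub>2" and ae: "AE w in N. \<theta>\<^sub>2 (\<Phi> x) w = \<theta>\<^sub>1 x w" if "x \<in> carrier M\<^sub>1" for x
    unfolding \<Phi>_def by (rule B.elt[OF A.theta_ess[OF that]])+
  have eqI: "\<Phi> x = y" if "x \<in> carrier M\<^sub>1" "y \<in> carrier M\<^sub>2" "AE w in N. \<theta>\<^sub>1 x w = f w" "AE w in N. \<theta>\<^sub>2 y w = f w" for x y f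
    by (rule B.eqI[OF c[OF that(1)] that(2) _ that(4)]) (use ae[OF that(1)] that(3) in eventually_elim, simp)
  have "\<Phi> \<in> star_isos M\<^sub>1 M\<^sub>2"
    unfolding star_isos_def mem_Collect_eq
  proof (intro conjI ballI allI)
    show "\<Phi> \<in> ring_iso M\<^sub>1 M\<^sub>2"
    proof (rule ring_iso_memI)
      show "\<Phi> \<one>\<^bsub>M\<^sub>1\<^esub> = \<one>\<^bsub>M\<^sub>2\<^esub>"
        by (rule eqI[OF A.one_closed B.one_closed A.theta_one B.theta_one])
      show "bij_betw \<Phi> (carrier M\<^sub>1) (carrier M\<^sub>2)"
      proof (rule bij_betwI')
        show "\<Phi> x = \<Phi> y \<longleftrightarrow> x = y" if "x \<in> carrier M\<^sub>1" "y \<in> carrier M\<^sub>1" for x y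
        proof
          assume "\<Phi> x = \<Phi> y"
          then show "x = y" using ae[OF that(1)] ae[OF that(2)]
            by (intro A.eqI[OF that, of "\<theta>\<^sub>2 (\<Phi> x)"]) (auto elim: eventually_mono)
        qed simp
        fix y assume y: "y \<in> carrier M\<^sub>2"
        show "\<exists>x\<in>carrier M\<^sub>1. y = \<Phi> x"
          by (rule bexI[of _ "A.elt (\<theta>\<^sub>2 y)"], rule eqI[symmetric])
            (use A.elt[OF B.theta_ess[OF y]] y in auto)
      qed (rule c)
    qed (auto intro!: c eqI[OF _ _ A.theta_mult B.eval_mult] eqI[OF _ _ A.theta_add B.eval_add] ae A.closed B.closed)
    fix x assume x: "x \<in> carrier M\<^sub>1"
    show "\<Phi> (d \<odot>\<^bsub>M\<^sub>1\<^esub> x) = d \<odot>\<^bsub>M\<^sub>2\<^esub> \<Phi> x" for d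
      by (rule eqI[OF _ _ A.theta_smult B.eval_smult]) (auto intro: x c ae A.closed B.closed)
    show "\<Phi> (star M\<^sub>1 x) = star M\<^sub>2 (\<Phi> x)"
      by (rule eqI[OF _ _ A.theta_star B.eval_star]) (auto intro: x c ae A.closed B.closed)
  qed
  moreover have "functional_weight \<tau>\<^sub>1 x = functional_weight \<tau>\<^sub>2 (\<Phi> x)" if "x \<in> pos M\<^sub>1" for x
  proof -
    have x: "x \<in> carrier M\<^sub>1" by (rule A.pos_carrier[OF that])
    have "(\<integral>w. \<theta>\<^sub>1 x w \<partial>N) = (\<integral>w. \<theta>\<^sub>2 (\<Phi> x) w \<partial>N)"
      by (rule integral_cong_AE) (use ae[OF x] A.theta_meas[OF x] B.theta_meas[OF c[OF x]] in \<open>auto elim: eventually_mono\<close>)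
    then show ?thesis using x c by (simp add: functional_weight_def tau1 tau2)
  qed
  ultimately show ?thesis
    unfolding vn_measure_isomorphic_def
    using A.vn_measure_algebra[OF tau1] B.vn_measure_algebra[OF tau2] by auto
qed

section \<open>The algebra \<open>L\<^sup>\<infinity>\<close>\<close>

text \<open>Operations on classes are defined as unions over representatives; such a union collapses
  once every representative gives the same class.\<close>

lemma UN_eq_const: "X \<noteq> {} \<Longrightarrow> (\<And>x. x \<in> X \<Longrightarrow> F x = c) \<Longrightarrow> (\<Union>x\<in>X. F x) = c"
  by auto

lemma UN_prod_eq_const:
  "X \<noteq> {} \<Longrightarrow> (\<And>a b. (a, b) \<in> X \<Longrightarrow> Q a b = c) \<Longrightarrow> (\<Union>(a, b)\<in>X. Q a b) = c"
  by (intro UN_eq_const) auto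

lemma ess_norm_nonneg:
  fixes f :: "'w \<Rightarrow> complex"
  assumes "f \<in> ess_bounded N" shows "0 \<le> Inf {C. 0 \<le> C \<and> (AE w in N. cmod (f w) \<le> C)}"
  using ess_bounded_bound[OF assms] by (intro cInf_greatest) auto

text \<open>The bounds \<open>C + 1 / Suc n\<close> hold outside one common null set, so the infimum
  is attained.\<close>

lemma ess_norm_le_iff:
  fixes f :: "'w \<Rightarrow> complex"
  assumes f: "f \<in> ess_bounded N" and C: "0 \<le> C"
  shows "Inf {C. 0 \<le> C \<and> (AE w in N. cmod (f w) \<le> C)} \<le> C \<longleftrightarrow> (AE w in N. cmod (f w) \<le> C)"
proof
  let ?S = "{C. 0 \<le> C \<and> (AE w in N. cmod (f w) \<le> C)}"
  have ne: "?S \<noteq> {}" using ess_bounded_bound[OF f] by auto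
  have bb: "bdd_below ?S" by (auto intro: bdd_belowI[of _ 0])
  show "Inf ?S \<le> C" if "AE w in N. cmod (f w) \<le> C"
    using that C bb by (intro cInf_lower) auto
  assume le: "Inf ?S \<le> C"
  have "AE w in N. cmod (f w) \<le> C + 1 / Suc n" for n
  proof -
    have "Inf ?S < C + 1 / Suc n" using le by (smt (verit) of_nat_0_less_iff zero_less_Suc zero_less_divide_1_iff)
    then obtain c where "c \<in> ?S" "c < C + 1 / Suc n" using cInf_less_iff[OF ne bb] by blast
    then show ?thesis by (auto elim!: eventually_mono)
  qed
  then have "AE w in N. \<forall>n. cmod (f w) \<le> C + 1 / Suc n" by (simp add: AE_all_countable)
  then show "AE w in N. cmod (f w) \<le> C"
  proof eventually_elim
    case (elim w)
    have "(\<lambda>n. C + 1 / real (Suc n)) \<longlonglongrightarrow> C + 0"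
      by (intro tendsto_intros LIMSEQ_Suc[OF lim_1_over_n])
    then show ?case using elim by (intro LIMSEQ_le_const[of _ C]) auto
  qed
qed

definition ae_rep :: "'w measure \<Rightarrow> ('w \<Rightarrow> complex) set \<Rightarrow> 'w \<Rightarrow> complex" where
  "ae_rep N X = (SOME f. f \<in> ess_bounded N \<and> X = ae_class N f)"

lemma ae_class_eq_iff:
  assumes "f \<in> ess_bounded N" "g \<in> ess_bounded N"
  shows "ae_class N f = ae_class N g \<longleftrightarrow> (AE w in N. f w = g w)"
proof
  assume "ae_class N f = ae_class N g"
  then have "g \<in> ae_class N f" using assms by (simp add: ae_class_def)
  then show "AE w in N. f w = g w" by (simp add: ae_class_def)
next
  assume "AE w in N. f w = g w"
  then show "ae_class N f = ae_class N g"
    by (auto simp: ae_class_def elim: eventually_elim2)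
qed

lemma ae_class_self: "f \<in> ess_bounded N \<Longrightarrow> f \<in> ae_class N f"
  by (simp add: ae_class_def)

lemma ae_rep:
  assumes "X \<in> carrier (Linf N)"
  shows "ae_rep N X \<in> ess_bounded N" "X = ae_class N (ae_rep N X)"
proof -
  have "\<exists>f. f \<in> ess_bounded N \<and> X = ae_class N f" using assms by (auto simp: Linf_def Let_def)
  from someI_ex[OF this] show "ae_rep N X \<in> ess_bounded N" "X = ae_class N (ae_rep N X)"
    unfolding ae_rep_def by simp_all
qed

lemma ae_class_carrier: "f \<in> ess_bounded N \<Longrightarrow> ae_class N f \<in> carrier (Linf N)"
  by (auto simp: Linf_def Let_def)

lemma ae_rep_class:
  assumes f: "f \<in> ess_bounded N" shows "AE w in N. ae_rep N (ae_class N f) w = f w"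
  using ae_rep(2)[OF ae_class_carrier[OF f]] ae_class_eq_iff[OF f ae_rep(1)[OF ae_class_carrier[OF f]]]
  by (auto elim: eventually_mono)

lemma Linf_binop:
  assumes f: "f \<in> ess_bounded N" and g: "g \<in> ess_bounded N"
    and h: "\<And>f g. f \<in> ess_bounded N \<Longrightarrow> g \<in> ess_bounded N \<Longrightarrow> (\<lambda>w. h (f w) (g w)) \<in> ess_bounded N"
  shows "(\<Union>f\<in>ae_class N f. \<Union>g\<in>ae_class N g. ae_class N (\<lambda>w. h (f w) (g w))) = ae_class N (\<lambda>w. h (f w) (g w))"
proof (intro UN_eq_const)
  fix f' g' assume "f' \<in> ae_class N f" "g' \<in> ae_class N g"
  then show "ae_class N (\<lambda>w. h (f' w) (g' w)) = ae_class N (\<lambda>w. h (f w) (g w))"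
    using f g by (subst ae_class_eq_iff) (auto simp: ae_class_def intro!: h elim: eventually_elim2)
qed (use f g ae_class_self in blast)+

lemma Linf_unop:
  assumes f: "f \<in> ess_bounded N"
    and h: "\<And>f. f \<in> ess_bounded N \<Longrightarrow> (\<lambda>w. h (f w)) \<in> ess_bounded N"
  shows "(\<Union>f\<in>ae_class N f. ae_class N (\<lambda>w. h (f w))) = ae_class N (\<lambda>w. h (f w))"
proof (intro UN_eq_const)
  fix f' assume "f' \<in> ae_class N f"
  then show "ae_class N (\<lambda>w. h (f' w)) = ae_class N (\<lambda>w. h (f w))"
    using f by (subst ae_class_eq_iff) (auto simp: ae_class_def intro!: h elim: eventually_mono)
qed (use f ae_class_self in blast)

lemma Linf_ops:
  assumes "f \<in> ess_bounded N" "g \<in> ess_bounded N"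
  shows "ae_class N f \<otimes>\<^bsub>Linf N\<^esub> ae_class N g = ae_class N (\<lambda>w. f w * g w)"
    and "ae_class N f \<oplus>\<^bsub>Linf N\<^esub> ae_class N g = ae_class N (\<lambda>w. f w + g w)"
    and "c \<odot>\<^bsub>Linf N\<^esub> ae_class N f = ae_class N (\<lambda>w. c * f w)"
    and "star (Linf N) (ae_class N f) = ae_class N (\<lambda>w. cnj (f w))"
  using Linf_binop[OF assms, of "(*)"] Linf_binop[OF assms, of "(+)"] Linf_unop[OF assms(1), of "\<lambda>z. c * z"]
    Linf_unop[OF assms(1), of cnj]
  by (simp_all add: Linf_def Let_def ess_bounded_mult ess_bounded_add ess_bounded_smult ess_bounded_cnj)

lemma nrm_Linf:
  assumes X: "X \<in> carrier (Linf N)"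
  shows "nrm (Linf N) X = Inf {C. 0 \<le> C \<and> (AE w in N. cmod (ae_rep N X w) \<le> C)}"
proof -
  have "(\<forall>f\<in>X. AE w in N. cmod (f w) \<le> C) \<longleftrightarrow> (AE w in N. cmod (ae_rep N X w) \<le> C)" for C
  proof
    assume "\<forall>f\<in>X. AE w in N. cmod (f w) \<le> C"
    then show "AE w in N. cmod (ae_rep N X w) \<le> C" using ae_rep[OF X] ae_class_self by blast
  next
    assume *: "AE w in N. cmod (ae_rep N X w) \<le> C"
    show "\<forall>f\<in>X. AE w in N. cmod (f w) \<le> C"
    proof
      fix f assume "f \<in> X"
      then have "AE w in N. ae_rep N X w = f w" using ae_rep(2)[OF X] by (auto simp: ae_class_def)
      with * show "AE w in N. cmod (f w) \<le> C" by eventually_elim simp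
    qed
  qed
  then show ?thesis by (simp add: Linf_def Let_def)
qed

lemma linf_model_Linf:
  assumes "prob_space N" shows "linf_model N (Linf N) (ae_rep N)"
proof -
  interpret prob_space N by fact
  have cl: "X = ae_class N (ae_rep N X)" "ae_rep N X \<in> ess_bounded N" if "X \<in> carrier (Linf N)" for X
    using ae_rep[OF that] by simp_all
  have one: "\<one>\<^bsub>Linf N\<^esub> = ae_class N (\<lambda>w. 1)" and zero: "\<zero>\<^bsub>Linf N\<^esub> = ae_class N (\<lambda>w. 0)"
    by (simp_all add: Linf_def Let_def)
  show ?thesis
  proof unfold_locales
    show "\<one>\<^bsub>Linf N\<^esub> \<in> carrier (Linf N)" "\<zero>\<^bsub>Linf N\<^esub> \<in> carrier (Linf N)"
      "AE w in N. ae_rep N \<one>\<^bsub>Linf N\<^esub> w = 1" "AE w in N. ae_rep N \<zero>\<^bsub>Linf N\<^esub> w = 0"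
      unfolding one zero by (intro ae_class_carrier ae_rep_class ess_bounded_const)+
    show "\<exists>X\<in>carrier (Linf N). AE w in N. ae_rep N X w = f w" if "f \<in> ess_bounded N" for f
      using ae_rep_class[OF that] ae_class_carrier[OF that] by blast
    fix X assume X: "X \<in> carrier (Linf N)"
    note x = cl[OF X]
    show "ae_rep N X \<in> ess_bounded N" by (rule x)
    show "0 \<le> nrm (Linf N) X" unfolding nrm_Linf[OF X] by (rule ess_norm_nonneg[OF x(2)])
    show "nrm (Linf N) X \<le> C \<longleftrightarrow> (AE w in N. cmod (ae_rep N X w) \<le> C)" if "0 \<le> C" for C
      unfolding nrm_Linf[OF X] by (rule ess_norm_le_iff[OF x(2) that])
    have "c \<odot>\<^bsub>Linf N\<^esub> X = ae_class N (\<lambda>w. c * ae_rep N X w)" for c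
      using Linf_ops(3)[OF x(2) x(2)] x(1) by simp
    then show "c \<odot>\<^bsub>Linf N\<^esub> X \<in> carrier (Linf N)" "AE w in N. ae_rep N (c \<odot>\<^bsub>Linf N\<^esub> X) w = c * ae_rep N X w" for c
      by (auto intro!: ae_class_carrier ae_rep_class ess_bounded_smult x)
    have "star (Linf N) X = ae_class N (\<lambda>w. cnj (ae_rep N X w))"
      using Linf_ops(4)[OF x(2) x(2)] x(1) by simp
    then show "star (Linf N) X \<in> carrier (Linf N)" "AE w in N. ae_rep N (star (Linf N) X) w = cnj (ae_rep N X w)"
      by (auto intro!: ae_class_carrier ae_rep_class ess_bounded_cnj x)
    fix Y assume Y: "Y \<in> carrier (Linf N)"
    note y = cl[OF Y]
    show "X = Y" if "AE w in N. ae_rep N X w = ae_rep N Y w"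
      by (rule box_equals[OF iffD2[OF ae_class_eq_iff[OF x(2) y(2)] that] x(1)[symmetric] y(1)[symmetric]])
    have "X \<oplus>\<^bsub>Linf N\<^esub> Y = ae_class N (\<lambda>w. ae_rep N X w + ae_rep N Y w)"
      using Linf_ops(2)[OF x(2) y(2)] x(1) y(1) by simp
    then show "X \<oplus>\<^bsub>Linf N\<^esub> Y \<in> carrier (Linf N)" "AE w in N. ae_rep N (X \<oplus>\<^bsub>Linf N\<^esub> Y) w = ae_rep N X w + ae_rep N Y w"
      by (auto intro!: ae_class_carrier ae_rep_class ess_bounded_add x y)
    have "X \<otimes>\<^bsub>Linf N\<^esub> Y = ae_class N (\<lambda>w. ae_rep N X w * ae_rep N Y w)"
      using Linf_ops(1)[OF x(2) y(2)] x(1) y(1) by simp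
    then show "X \<otimes>\<^bsub>Linf N\<^esub> Y \<in> carrier (Linf N)" "AE w in N. ae_rep N (X \<otimes>\<^bsub>Linf N\<^esub> Y) w = ae_rep N X w * ae_rep N Y w"
      by (auto intro!: ae_class_carrier ae_rep_class ess_bounded_mult x y)
  qed
qed

lemma Linf_integral_eq:
  assumes X: "X \<in> carrier (Linf N)" shows "Linf_integral N X = (\<integral>w. ae_rep N X w \<partial>N)"
proof -
  have *: "(\<integral>w. f w \<partial>N) = (\<integral>w. ae_rep N X w \<partial>N)" if "f \<in> X" for f
  proof (rule integral_cong_AE)
    have "f \<in> ae_class N (ae_rep N X)" using that ae_rep(2)[OF X] by simp
    then show "AE w in N. f w = ae_rep N X w" "f \<in> borel_measurable N"
      by (auto simp: ae_class_def ess_bounded_def elim: eventually_mono)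
    show "ae_rep N X \<in> borel_measurable N" using ae_rep(1)[OF X] by (rule ess_bounded_measurable)
  qed
  have self: "ae_rep N X \<in> X"
    by (subst ae_rep(2)[OF X]) (rule ae_class_self[OF ae_rep(1)[OF X]])
  show ?thesis unfolding Linf_integral_def
  proof (rule the_equality)
    show "\<forall>f\<in>X. (\<integral>w. ae_rep N X w \<partial>N) = (\<integral>w. f w \<partial>N)" using * by simp
    show "z = (\<integral>w. ae_rep N X w \<partial>N)" if "\<forall>f\<in>X. z = (\<integral>w. f w \<partial>N)" for z
      using that self by (rule bspec)
  qed
qed

section \<open>Square-integrable functions\<close>

text \<open>Functions are kept instead of classes, so that \<open>l2n\<close> below is a seminorm;
  functions that agree almost everywhere are identified only when they are compared with vectors of
  a Hilbert space.\<close>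

definition sqint :: "'w measure \<Rightarrow> ('w \<Rightarrow> complex) \<Rightarrow> bool" where
  "sqint N f \<longleftrightarrow> f \<in> borel_measurable N \<and> integrable N (\<lambda>w. (cmod (f w))\<^sup>2)"

definition l2n :: "'w measure \<Rightarrow> ('w \<Rightarrow> complex) \<Rightarrow> real" where
  "l2n N f = sqrt (\<integral>w. (cmod (f w))\<^sup>2 \<partial>N)"

lemma sqint_measurable: "sqint N f \<Longrightarrow> f \<in> borel_measurable N"
  by (simp add: sqint_def)

lemma sqint_integrable: "sqint N f \<Longrightarrow> integrable N (\<lambda>w. (cmod (f w))\<^sup>2)"
  by (simp add: sqint_def)

lemma l2n_nonneg [simp]: "0 \<le> l2n N f"
  by (simp add: l2n_def)

lemma l2n_sq: "(l2n N f)\<^sup>2 = (\<integral>w. (cmod (f w))\<^sup>2 \<partial>N)"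
  by (simp add: l2n_def)

lemma sqint_bound:
  assumes "f \<in> borel_measurable N" "integrable N u" "AE w in N. (cmod (f w))\<^sup>2 \<le> u w"
  shows "sqint N f"
  unfolding sqint_def
proof (intro conjI assms(1) Bochner_Integration.integrable_bound[OF assms(2)])
  show "(\<lambda>w. (cmod (f w))\<^sup>2) \<in> borel_measurable N" using assms(1) by measurable
  show "AE w in N. norm ((cmod (f w))\<^sup>2) \<le> norm (u w)" using assms(3) by eventually_elim auto
qed

lemma sq_add_le: "(cmod (a + b))\<^sup>2 \<le> 2 * (cmod a)\<^sup>2 + 2 * (cmod b)\<^sup>2"
proof -
  have "(cmod (a + b))\<^sup>2 \<le> (cmod a + cmod b)\<^sup>2" by (intro power_mono norm_triangle_ineq norm_ge_zero)
  also have "\<dots> \<le> 2 * (cmod a)\<^sup>2 + 2 * (cmod b)\<^sup>2"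
    using zero_le_power2[of "cmod a - cmod b"] by (simp add: power2_sum power2_diff)
  finally show ?thesis .
qed

lemma sqint_add: assumes "sqint N f" "sqint N g" shows "sqint N (\<lambda>w. f w + g w)"
  by (rule sqint_bound[where u = "\<lambda>w. 2 * (cmod (f w))\<^sup>2 + 2 * (cmod (g w))\<^sup>2"])
    (use assms in \<open>auto intro!: sq_add_le simp: sqint_def\<close>)

lemma sqint_mult_ess: assumes f: "f \<in> ess_bounded N" and g: "sqint N g" shows "sqint N (\<lambda>w. f w * g w)"
proof -
  obtain C where C: "AE w in N. cmod (f w) \<le> C" using f by (auto simp: ess_bounded_def)
  show ?thesis
  proof (rule sqint_bound[where u = "\<lambda>w. C\<^sup>2 * (cmod (g w))\<^sup>2"])
    show "AE w in N. (cmod (f w * g w))\<^sup>2 \<le> C\<^sup>2 * (cmod (g w))\<^sup>2"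
      using C by eventually_elim (auto simp: norm_mult power_mult_distrib intro!: mult_right_mono power_mono)
  qed (use f g in \<open>auto simp: sqint_def ess_bounded_def\<close>)
qed

lemma sqint_smult: "sqint N f \<Longrightarrow> sqint N (\<lambda>w. c * f w)"
  by (rule sqint_mult_ess[OF ess_bounded_const])

lemma sqint_diff: assumes "sqint N f" "sqint N g" shows "sqint N (\<lambda>w. f w - g w)"
  using sqint_add[OF assms(1) sqint_smult[OF assms(2), of "- 1"]] by simp

lemma sqint_cnj: "sqint N f \<Longrightarrow> sqint N (\<lambda>w. cnj (f w))"
  by (simp add: sqint_def borel_measurable_cnj)

lemma sqint_cong_AE:
  assumes "AE w in N. f w = g w" "sqint N f" "g \<in> borel_measurable N"
  shows "sqint N g"
  by (rule sqint_bound[OF assms(3) sqint_integrable[OF assms(2)]]) (use assms(1) in eventually_elim, simp)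

lemma l2n_cong_AE:
  assumes "AE w in N. f w = g w" "f \<in> borel_measurable N" "g \<in> borel_measurable N"
  shows "l2n N f = l2n N g"
  unfolding l2n_def by (intro arg_cong[where f = sqrt] integral_cong_AE) (use assms in \<open>auto elim: eventually_mono\<close>)

lemma l2n_eq_0_iff: assumes "sqint N f" shows "l2n N f = 0 \<longleftrightarrow> (AE w in N. f w = 0)"
proof -
  have "l2n N f = 0 \<longleftrightarrow> (\<integral>w. (cmod (f w))\<^sup>2 \<partial>N) = 0" by (simp add: l2n_def)
  also have "\<dots> \<longleftrightarrow> (AE w in N. (cmod (f w))\<^sup>2 = 0)"
    by (rule integral_nonneg_eq_0_iff_AE[OF sqint_integrable[OF assms]]) simp
  finally show ?thesis by simp
qed

lemma l2n_smult: "l2n N (\<lambda>w. c * f w) = cmod c * l2n N f"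
  by (simp add: l2n_def norm_mult power_mult_distrib real_sqrt_mult)

lemma l2n_commute: "l2n N (\<lambda>w. f w - g w) = l2n N (\<lambda>w. g w - f w)"
  by (simp add: l2n_def norm_minus_commute)

lemma sqint_prod_integrable:
  assumes "sqint N f" "sqint N g" shows "integrable N (\<lambda>w. f w * g w)"
proof (rule Bochner_Integration.integrable_bound[where f = "\<lambda>w. (cmod (f w))\<^sup>2 + (cmod (g w))\<^sup>2"])
  have "2 * (cmod a * cmod b) \<le> (cmod a)\<^sup>2 + (cmod b)\<^sup>2" "0 \<le> cmod a * cmod b" for a b
    using zero_le_power2[of "cmod a - cmod b"] by (auto simp: power2_diff)
  then have "cmod a * cmod b \<le> (cmod a)\<^sup>2 + (cmod b)\<^sup>2" for a b
    by (smt (verit, best))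
  then show "AE w in N. norm (f w * g w) \<le> norm ((cmod (f w))\<^sup>2 + (cmod (g w))\<^sup>2)"
    by (simp add: norm_mult)
qed (use assms in \<open>auto simp: sqint_def\<close>)

lemma l2_Cauchy_Schwarz:
  assumes f: "sqint N f" and g: "sqint N g"
  shows "(\<integral>w. cmod (f w * g w) \<partial>N) \<le> l2n N f * l2n N g"
proof (cases "l2n N f = 0 \<or> l2n N g = 0")
  case True
  then have "AE w in N. f w = 0 \<or> g w = 0"
    using l2n_eq_0_iff[OF f] l2n_eq_0_iff[OF g] by (auto elim: eventually_mono)
  then have "AE w in N. cmod (f w * g w) = 0" by eventually_elim auto
  then have "(\<integral>w. cmod (f w * g w) \<partial>N) = 0" by (rule integral_eq_zero_AE)
  then show ?thesis by simp
next
  case False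
  define a b where "a = l2n N f" and "b = l2n N g"
  have ab: "0 < a" "0 < b" using False by (auto simp: a_def b_def less_le)
  \<comment> \<open>Young's inequality with the weights \<open>b / a\<close> and
    \<open>a / b\<close>, chosen so that both terms integrate to \<open>a * b / 2\<close>.\<close>
  have "(\<integral>w. cmod (f w * g w) \<partial>N) \<le> (\<integral>w. (b / a) / 2 * (cmod (f w))\<^sup>2 + (a / b) / 2 * (cmod (g w))\<^sup>2 \<partial>N)"
  proof (rule integral_mono)
    fix w
    have "0 \<le> (b * cmod (f w) - a * cmod (g w))\<^sup>2" by simp
    then have "2 * (a * b) * (cmod (f w) * cmod (g w)) \<le> b\<^sup>2 * (cmod (f w))\<^sup>2 + a\<^sup>2 * (cmod (g w))\<^sup>2"
      by (simp add: power2_diff power_mult_distrib algebra_simps)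
    then show "cmod (f w * g w) \<le> (b / a) / 2 * (cmod (f w))\<^sup>2 + (a / b) / 2 * (cmod (g w))\<^sup>2"
      using ab by (simp add: norm_mult field_simps power2_eq_square)
  qed (use sqint_prod_integrable[OF f g] f g in \<open>auto simp: sqint_def\<close>)
  also have "\<dots> = (b / a) / 2 * a\<^sup>2 + (a / b) / 2 * b\<^sup>2"
    using f g by (simp add: a_def b_def l2n_sq sqint_def)
  also have "\<dots> = a * b" using ab by (simp add: field_simps power2_eq_square)
  finally show ?thesis by (simp add: a_def b_def)
qed

lemma l2_inner_bound:
  assumes f: "sqint N f" and g: "sqint N g"
  shows "cmod (\<integral>w. f w * cnj (g w) \<partial>N) \<le> l2n N f * l2n N g"
proof -
  have "cmod (\<integral>w. f w * cnj (g w) \<partial>N) \<le> (\<integral>w. cmod (f w * cnj (g w)) \<partial>N)" by (rule integral_norm_bound)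
  also have "\<dots> \<le> l2n N f * l2n N (\<lambda>w. cnj (g w))" by (rule l2_Cauchy_Schwarz[OF f sqint_cnj[OF g]])
  finally show ?thesis by (simp add: l2n_def)
qed

lemma l2n_triangle:
  assumes f: "sqint N f" and g: "sqint N g"
  shows "l2n N (\<lambda>w. f w + g w) \<le> l2n N f + l2n N g"
proof (rule power2_le_imp_le)
  have i: "integrable N (\<lambda>w. cmod (f w * g w))" using sqint_prod_integrable[OF f g] by simp
  have "(l2n N (\<lambda>w. f w + g w))\<^sup>2 \<le> (\<integral>w. (cmod (f w))\<^sup>2 + 2 * cmod (f w * g w) + (cmod (g w))\<^sup>2 \<partial>N)"
    unfolding l2n_sq
  proof (rule integral_mono)
    fix w
    have "(cmod (f w + g w))\<^sup>2 \<le> (cmod (f w) + cmod (g w))\<^sup>2" by (intro power_mono norm_triangle_ineq norm_ge_zero)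
    then show "(cmod (f w + g w))\<^sup>2 \<le> (cmod (f w))\<^sup>2 + 2 * cmod (f w * g w) + (cmod (g w))\<^sup>2"
      by (simp add: power2_sum norm_mult)
  qed (use i f g sqint_add[OF f g] in \<open>auto simp: sqint_def\<close>)
  also have "\<dots> = (l2n N f)\<^sup>2 + 2 * (\<integral>w. cmod (f w * g w) \<partial>N) + (l2n N g)\<^sup>2"
    using i f g by (simp add: l2n_sq sqint_def)
  also have "\<dots> \<le> (l2n N f)\<^sup>2 + 2 * (l2n N f * l2n N g) + (l2n N g)\<^sup>2"
    using l2_Cauchy_Schwarz[OF f g] by simp
  finally show "(l2n N (\<lambda>w. f w + g w))\<^sup>2 \<le> (l2n N f + l2n N g)\<^sup>2"
    by (simp add: power2_sum)
qed simp

lemma l2n_triangle_diff: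
  assumes f: "sqint N f" and g: "sqint N g" and h: "sqint N h"
  shows "l2n N (\<lambda>w. f w - h w) \<le> l2n N (\<lambda>w. f w - g w) + l2n N (\<lambda>w. g w - h w)"
  using l2n_triangle[OF sqint_diff[OF f g] sqint_diff[OF g h]] by simp

lemma l2n_mult_le:
  assumes f: "f \<in> borel_measurable N" "AE w in N. cmod (f w) \<le> C" and C: "0 \<le> C" and g: "sqint N g"
  shows "l2n N (\<lambda>w. f w * g w) \<le> C * l2n N g"
proof (rule power2_le_imp_le)
  have "(l2n N (\<lambda>w. f w * g w))\<^sup>2 \<le> (\<integral>w. C\<^sup>2 * (cmod (g w))\<^sup>2 \<partial>N)"
    unfolding l2n_sq
  proof (rule integral_mono_AE)
    show "AE w in N. (cmod (f w * g w))\<^sup>2 \<le> C\<^sup>2 * (cmod (g w))\<^sup>2"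
      using f(2) by eventually_elim (auto simp: norm_mult power_mult_distrib intro!: mult_right_mono power_mono)
  qed (use sqint_mult_ess[OF ess_boundedI[OF f] g] g in \<open>auto simp: sqint_def\<close>)
  then show "(l2n N (\<lambda>w. f w * g w))\<^sup>2 \<le> (C * l2n N g)\<^sup>2"
    by (simp add: power_mult_distrib l2n_sq)
qed (use C in simp)

context prob_space
begin

lemma sqint_ess_bounded: "f \<in> ess_bounded M \<Longrightarrow> sqint M f"
  using sqint_mult_ess[of f M "\<lambda>w. 1"] by (simp add: sqint_def)

lemma l1_le_l2n:
  assumes "sqint M f" shows "(\<integral>w. cmod (f w) \<partial>M) \<le> l2n M f"
proof -
  have "l2n M (\<lambda>w. 1) = 1" by (simp add: l2n_def prob_space)
  then show ?thesis using l2_Cauchy_Schwarz[OF assms, of "\<lambda>w. 1"] by (simp add: sqint_def)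
qed

lemma sqint_imp_integrable: "sqint M f \<Longrightarrow> integrable M f"
  using sqint_prod_integrable[of M f "\<lambda>w. 1"] by (simp add: sqint_def)

text \<open>On a probability space an L2-Cauchy sequence is L1-Cauchy, so a subsequence converges
  almost everywhere. Fatou's lemma along this subsequence, with the other index fixed, transfers the
  L2 estimates to the limit.\<close>

lemma l2_complete:
  assumes s: "\<And>n. sqint M (s n)"
    and cauchy: "\<And>e. 0 < e \<Longrightarrow> \<exists>K. \<forall>m\<ge>K. \<forall>n\<ge>K. l2n M (\<lambda>w. s m w - s n w) < e"
  shows "\<exists>f. sqint M f \<and> (\<lambda>n. l2n M (\<lambda>w. s n w - f w)) \<longlonglongrightarrow> 0"
proof -
  have sm [measurable]: "s n \<in> borel_measurable M" for n using s by (rule sqint_measurable)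
  obtain r :: "nat \<Rightarrow> nat" where r: "strict_mono r" "AE x in M. Cauchy (\<lambda>i. s (r i) x)"
  proof (rule cauchy_L1_AE_cauchy_subseq[of M s])
    fix e :: real assume "e > 0"
    from cauchy[OF this] show "\<exists>N. \<forall>i\<ge>N. \<forall>j\<ge>N. LINT x|M. norm (s i x - s j x) < e"
      using l1_le_l2n[OF sqint_diff[OF s s]] by (meson le_less_trans)
  qed (use sqint_imp_integrable[OF s] in auto)
  define f where "f = (\<lambda>w. lim (\<lambda>i. s (r i) w))"
  have fm [measurable]: "f \<in> borel_measurable M" unfolding f_def by (rule borel_measurable_lim_metric) (rule sm)
  have lim: "AE w in M. (\<lambda>i. s (r i) w) \<longlonglongrightarrow> f w"
    using r(2) by eventually_elim (simp add: f_def Cauchy_convergent_iff convergent_LIMSEQ_iff)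
  have key: "sqint M (\<lambda>w. s n w - f w) \<and> l2n M (\<lambda>w. s n w - f w) \<le> e"
    if e: "0 < e" and K: "\<forall>m\<ge>K. \<forall>n\<ge>K. l2n M (\<lambda>w. s m w - s n w) < e" and n: "K \<le> n" for n e K
  proof -
    have "(\<integral>\<^sup>+w. ennreal ((cmod (s n w - f w))\<^sup>2) \<partial>M) = (\<integral>\<^sup>+w. liminf (\<lambda>i. ennreal ((cmod (s n w - s (r i) w))\<^sup>2)) \<partial>M)"
    proof (rule nn_integral_cong_AE)
      show "AE w in M. ennreal ((cmod (s n w - f w))\<^sup>2) = liminf (\<lambda>i. ennreal ((cmod (s n w - s (r i) w))\<^sup>2))"
        using lim
      proof eventually_elim
        case (elim w)
        have "(\<lambda>i. ennreal ((cmod (s n w - s (r i) w))\<^sup>2)) \<longlonglongrightarrow> ennreal ((cmod (s n w - f w))\<^sup>2)"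
          by (intro tendsto_ennrealI tendsto_intros elim)
        then show ?case by (rule lim_imp_Liminf[OF trivial_limit_sequentially, symmetric])
      qed
    qed
    also have "\<dots> \<le> liminf (\<lambda>i. \<integral>\<^sup>+w. ennreal ((cmod (s n w - s (r i) w))\<^sup>2) \<partial>M)"
      by (rule nn_integral_liminf) measurable
    also have "\<dots> \<le> liminf (\<lambda>i::nat. ennreal (e\<^sup>2))"
    proof (rule Liminf_mono, rule eventually_sequentiallyI[of K])
      fix i assume "K \<le> i"
      then have "K \<le> r i" using seq_suble[OF r(1), of i] by simp
      then have "l2n M (\<lambda>w. s n w - s (r i) w) \<le> e" using K n by (simp add: less_imp_le)
      then have "(\<integral>w. (cmod (s n w - s (r i) w))\<^sup>2 \<partial>M) \<le> e\<^sup>2"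
        unfolding l2n_sq[symmetric] by (intro power_mono) auto
      moreover have "(\<integral>\<^sup>+w. ennreal ((cmod (s n w - s (r i) w))\<^sup>2) \<partial>M) = ennreal (\<integral>w. (cmod (s n w - s (r i) w))\<^sup>2 \<partial>M)"
        by (rule nn_integral_eq_integral[OF sqint_integrable[OF sqint_diff[OF s s]]]) simp
      ultimately show "(\<integral>\<^sup>+w. ennreal ((cmod (s n w - s (r i) w))\<^sup>2) \<partial>M) \<le> ennreal (e\<^sup>2)"
        by (simp add: ennreal_leI)
    qed
    also have "\<dots> = ennreal (e\<^sup>2)" by (simp add: Liminf_const)
    finally have le: "(\<integral>\<^sup>+w. ennreal ((cmod (s n w - f w))\<^sup>2) \<partial>M) \<le> ennreal (e\<^sup>2)" .
    then have i: "integrable M (\<lambda>w. (cmod (s n w - f w))\<^sup>2)"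
      by (intro integrableI_bounded) (auto simp: le_less_trans[OF _ ennreal_less_top])
    then have "ennreal (\<integral>w. (cmod (s n w - f w))\<^sup>2 \<partial>M) \<le> ennreal (e\<^sup>2)"
      using le by (subst (asm) nn_integral_eq_integral) auto
    then have "(l2n M (\<lambda>w. s n w - f w))\<^sup>2 \<le> e\<^sup>2" unfolding l2n_sq by (simp add: ennreal_le_iff)
    then have "l2n M (\<lambda>w. s n w - f w) \<le> e" by (rule power2_le_imp_le) (use e in simp)
    then show ?thesis using i by (simp add: sqint_def)
  qed
  obtain K where K: "\<forall>m\<ge>K. \<forall>n\<ge>K. l2n M (\<lambda>w. s m w - s n w) < 1" using cauchy[of 1] by auto
  \<comment> \<open>\<open>key\<close> makes only the difference \<open>s K - f\<close> square
    integrable; \<open>f\<close> is recovered by subtracting it from \<open>s K\<close>.\<close>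
  have "sqint M (\<lambda>w. s K w - (s K w - f w))"
    by (rule sqint_diff[OF s]) (use key[OF _ K, of K] in auto)
  then have "sqint M f" by simp
  moreover have "(\<lambda>n. l2n M (\<lambda>w. s n w - f w)) \<longlonglongrightarrow> 0"
  proof (rule LIMSEQ_I)
    fix e :: real assume "e > 0"
    then obtain K where "\<forall>m\<ge>K. \<forall>n\<ge>K. l2n M (\<lambda>w. s m w - s n w) < e / 2" using cauchy[of "e / 2"] by auto
    then have "\<forall>n\<ge>K. l2n M (\<lambda>w. s n w - f w) \<le> e / 2" using key[of "e / 2" K] \<open>e > 0\<close> by auto
    then show "\<exists>no. \<forall>n\<ge>no. norm (l2n M (\<lambda>w. s n w - f w) - 0) < e"
      using \<open>e > 0\<close> by (intro exI[of _ K]) fastforce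
  qed
  ultimately show ?thesis by blast
qed

end

section \<open>Hausdorff completions\<close>

text \<open>Common setting of the two completions, with the supremum norm for the C*-algebra and the
  L2 norm for the GNS space. As \<open>V\<close> is complete for \<open>q\<close>, every Cauchy
  sequence has a limit function, and this function names its class.\<close>

locale seminorm_model =
  fixes B :: "('a, 'm) ring_scheme" and p :: "'a \<Rightarrow> real" and \<theta> :: "'a \<Rightarrow> 'w \<Rightarrow> complex"
    and V :: "('w \<Rightarrow> complex) set" and q :: "('w \<Rightarrow> complex) \<Rightarrow> real"
  assumes in_V: "x \<in> carrier B \<Longrightarrow> \<theta> x \<in> V"
    and p_minus: "x \<in> carrier B \<Longrightarrow> y \<in> carrier B \<Longrightarrow> p (x \<ominus>\<^bsub>B\<^esub> y) = q (\<lambda>w. \<theta> x w - \<theta> y w)"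
    and q_nonneg: "f \<in> V \<Longrightarrow> g \<in> V \<Longrightarrow> 0 \<le> q (\<lambda>w. f w - g w)"
    and q_commute: "f \<in> V \<Longrightarrow> g \<in> V \<Longrightarrow> q (\<lambda>w. f w - g w) = q (\<lambda>w. g w - f w)"
    and q_triangle: "f \<in> V \<Longrightarrow> g \<in> V \<Longrightarrow> h \<in> V \<Longrightarrow> q (\<lambda>w. f w - h w) \<le> q (\<lambda>w. f w - g w) + q (\<lambda>w. g w - h w)"
    and q_complete: "(\<And>n. s n \<in> V) \<Longrightarrow> (\<And>e. 0 < e \<Longrightarrow> \<exists>K. \<forall>m\<ge>K. \<forall>n\<ge>K. q (\<lambda>w. s m w - s n w) < e) \<Longrightarrow>
        \<exists>f. f \<in> V \<and> (\<lambda>n. q (\<lambda>w. s n w - f w)) \<longlonglongrightarrow> 0"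
begin

definition conv :: "(nat \<Rightarrow> 'a) \<Rightarrow> ('w \<Rightarrow> complex) \<Rightarrow> bool" where
  "conv s f \<longleftrightarrow> (\<forall>n. s n \<in> carrier B) \<and> f \<in> V \<and> (\<lambda>n. q (\<lambda>w. \<theta> (s n) w - f w)) \<longlonglongrightarrow> 0"

definition cls :: "('w \<Rightarrow> complex) \<Rightarrow> (nat \<Rightarrow> 'a) set" where
  "cls f = {s. conv s f}"

text \<open>The completion seen as a set of functions. It may be smaller than \<open>V\<close>:
  uniform limits of cylinder functions need not exhaust the bounded functions.\<close>

definition lims :: "('w \<Rightarrow> complex) set" where
  "lims = {f. \<exists>s. conv s f}"

lemma lims_V: "f \<in> lims \<Longrightarrow> f \<in> V"
  by (auto simp: lims_def conv_def)

lemma cauchy_iff: "s \<in> cauchy_seqs B p \<longleftrightarrow> (\<exists>f. conv s f)"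
proof
  assume s: "s \<in> cauchy_seqs B p"
  then have c: "s n \<in> carrier B" for n by (simp add: cauchy_seqs_def)
  have "\<exists>f. f \<in> V \<and> (\<lambda>n. q (\<lambda>w. \<theta> (s n) w - f w)) \<longlonglongrightarrow> 0"
    by (rule q_complete) (use s c in \<open>auto simp: cauchy_seqs_def p_minus in_V\<close>)
  then show "\<exists>f. conv s f" using c by (auto simp: conv_def)
next
  assume "\<exists>f. conv s f"
  then obtain f where c: "\<And>n. s n \<in> carrier B" and f: "f \<in> V" and l: "(\<lambda>n. q (\<lambda>w. \<theta> (s n) w - f w)) \<longlonglongrightarrow> 0"
    by (auto simp: conv_def)
  have "\<exists>K. \<forall>m\<ge>K. \<forall>n\<ge>K. p (s m \<ominus>\<^bsub>B\<^esub> s n) < e" if e: "e > 0" for e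
  proof -
    obtain K where K: "\<forall>n\<ge>K. norm (q (\<lambda>w. \<theta> (s n) w - f w) - 0) < e / 2"
      using LIMSEQ_D[OF l half_gt_zero[OF e]] by blast
    have "p (s m \<ominus>\<^bsub>B\<^esub> s n) < e" if "K \<le> m" "K \<le> n" for m n
    proof -
      have "p (s m \<ominus>\<^bsub>B\<^esub> s n) \<le> q (\<lambda>w. \<theta> (s m) w - f w) + q (\<lambda>w. f w - \<theta> (s n) w)"
        unfolding p_minus[OF c c] by (rule q_triangle[OF in_V[OF c] f in_V[OF c]])
      also have "q (\<lambda>w. f w - \<theta> (s n) w) = q (\<lambda>w. \<theta> (s n) w - f w)" by (rule q_commute[OF f in_V[OF c]])
      finally show ?thesis
        using K[rule_format, OF that(1)] K[rule_format, OF that(2)] unfolding real_norm_def diff_0_right by linarith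
    qed
    then show ?thesis by blast
  qed
  then show "s \<in> cauchy_seqs B p" using c by (simp add: cauchy_seqs_def)
qed

text \<open>Sequences whose distance tends to 0 have the same limits, by the triangle inequality
  used both ways; so a class of Cauchy sequences is the set of all sequences with a given
  limit.\<close>

lemma conv_iff:
  assumes s: "conv s f"
  shows "conv t f \<longleftrightarrow> t \<in> cauchy_seqs B p \<and> (\<lambda>n. p (s n \<ominus>\<^bsub>B\<^esub> t n)) \<longlonglongrightarrow> 0"
proof
  have sc: "s n \<in> carrier B" for n using s by (simp add: conv_def)
  have f: "f \<in> V" and sl: "(\<lambda>n. q (\<lambda>w. \<theta> (s n) w - f w)) \<longlonglongrightarrow> 0" using s by (auto simp: conv_def)
  {
    assume t: "conv t f"
    then have tc: "t n \<in> carrier B" for n by (simp add: conv_def)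
    have tl: "(\<lambda>n. q (\<lambda>w. \<theta> (t n) w - f w)) \<longlonglongrightarrow> 0" using t by (simp add: conv_def)
    have "(\<lambda>n. p (s n \<ominus>\<^bsub>B\<^esub> t n)) \<longlonglongrightarrow> 0"
    proof (rule tendsto_sandwich[OF _ _ tendsto_const])
      show "(\<lambda>n. q (\<lambda>w. \<theta> (s n) w - f w) + q (\<lambda>w. \<theta> (t n) w - f w)) \<longlonglongrightarrow> 0"
        using tendsto_add[OF sl tl] by simp
      show "\<forall>\<^sub>F n in sequentially. p (s n \<ominus>\<^bsub>B\<^esub> t n) \<le> q (\<lambda>w. \<theta> (s n) w - f w) + q (\<lambda>w. \<theta> (t n) w - f w)"
        using q_triangle[OF in_V[OF sc] f in_V[OF tc]] q_commute[OF f in_V[OF tc]]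
        by (intro always_eventually allI) (simp add: p_minus sc tc)
      show "\<forall>\<^sub>F n in sequentially. 0 \<le> p (s n \<ominus>\<^bsub>B\<^esub> t n)"
        by (intro always_eventually allI) (simp add: p_minus sc tc q_nonneg in_V)
    qed
    then show "t \<in> cauchy_seqs B p \<and> (\<lambda>n. p (s n \<ominus>\<^bsub>B\<^esub> t n)) \<longlonglongrightarrow> 0"
      using t cauchy_iff by blast
  next
    assume t: "t \<in> cauchy_seqs B p \<and> (\<lambda>n. p (s n \<ominus>\<^bsub>B\<^esub> t n)) \<longlonglongrightarrow> 0"
    then have tc: "t n \<in> carrier B" for n by (simp add: cauchy_seqs_def)
    have "(\<lambda>n. q (\<lambda>w. \<theta> (t n) w - f w)) \<longlonglongrightarrow> 0"
    proof (rule tendsto_sandwich[OF _ _ tendsto_const])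
      show "(\<lambda>n. p (s n \<ominus>\<^bsub>B\<^esub> t n) + q (\<lambda>w. \<theta> (s n) w - f w)) \<longlonglongrightarrow> 0"
        using tendsto_add[OF _ sl] t by fastforce
      show "\<forall>\<^sub>F n in sequentially. q (\<lambda>w. \<theta> (t n) w - f w) \<le> p (s n \<ominus>\<^bsub>B\<^esub> t n) + q (\<lambda>w. \<theta> (s n) w - f w)"
        using q_triangle[OF in_V[OF tc] in_V[OF sc] f] q_commute[OF in_V[OF tc] in_V[OF sc]]
        by (intro always_eventually allI) (simp add: p_minus sc tc)
      show "\<forall>\<^sub>F n in sequentially. 0 \<le> q (\<lambda>w. \<theta> (t n) w - f w)"
        by (intro always_eventually allI) (simp add: q_nonneg in_V tc f)
    qed
    then show "conv t f" using tc f by (simp add: conv_def)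
  }
qed

lemma cauchy_class_conv: "conv s f \<Longrightarrow> cauchy_class B p s = cls f"
  unfolding cauchy_class_def cls_def using conv_iff by blast

lemma conv_unique:
  assumes "conv s f" "conv s g" shows "q (\<lambda>w. f w - g w) = 0"
proof -
  have f: "f \<in> V" "g \<in> V" and c: "s n \<in> carrier B" for n using assms by (auto simp: conv_def)
  have "q (\<lambda>w. f w - g w) \<le> 0"
  proof (rule LIMSEQ_le_const)
    show "(\<lambda>n. q (\<lambda>w. \<theta> (s n) w - f w) + q (\<lambda>w. \<theta> (s n) w - g w)) \<longlonglongrightarrow> 0"
      using tendsto_add[of "\<lambda>n. q (\<lambda>w. \<theta> (s n) w - f w)" 0 sequentially "\<lambda>n. q (\<lambda>w. \<theta> (s n) w - g w)" 0] assms
      by (simp add: conv_def)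
    show "\<exists>N. \<forall>n\<ge>N. q (\<lambda>w. f w - g w) \<le> q (\<lambda>w. \<theta> (s n) w - f w) + q (\<lambda>w. \<theta> (s n) w - g w)"
      using q_triangle[OF f(1) in_V[OF c] f(2)] q_commute[OF f(1) in_V[OF c]] by auto
  qed
  then show ?thesis using q_nonneg[OF f] by simp
qed

lemma conv_cong:
  assumes s: "conv s f" and g: "g \<in> V" "q (\<lambda>w. f w - g w) = 0" shows "conv s g"
proof -
  have f: "f \<in> V" and c: "s n \<in> carrier B" for n using s by (auto simp: conv_def)
  have "(\<lambda>n. q (\<lambda>w. \<theta> (s n) w - g w)) \<longlonglongrightarrow> 0"
  proof (rule tendsto_sandwich[OF _ _ tendsto_const])
    show "(\<lambda>n. q (\<lambda>w. \<theta> (s n) w - f w)) \<longlonglongrightarrow> 0" using s by (simp add: conv_def)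
    show "\<forall>\<^sub>F n in sequentially. q (\<lambda>w. \<theta> (s n) w - g w) \<le> q (\<lambda>w. \<theta> (s n) w - f w)"
      using q_triangle[OF in_V[OF c] f g(1)] g(2) by (intro always_eventually allI) simp
    show "\<forall>\<^sub>F n in sequentially. 0 \<le> q (\<lambda>w. \<theta> (s n) w - g w)"
      by (intro always_eventually allI) (simp add: q_nonneg in_V c g)
  qed
  then show ?thesis using c g by (simp add: conv_def)
qed

lemma cls_eq_iff:
  assumes "f \<in> lims" "g \<in> lims" shows "cls f = cls g \<longleftrightarrow> q (\<lambda>w. f w - g w) = 0"
proof
  assume "cls f = cls g"
  moreover obtain s where "conv s f" using assms(1) by (auto simp: lims_def)
  ultimately have "conv s f" "conv s g" by (auto simp: cls_def)
  then show "q (\<lambda>w. f w - g w) = 0" by (rule conv_unique)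
next
  assume *: "q (\<lambda>w. f w - g w) = 0"
  then have "q (\<lambda>w. g w - f w) = 0" using q_commute[OF lims_V[OF assms(1)] lims_V[OF assms(2)]] by simp
  then show "cls f = cls g"
    using * conv_cong assms[THEN lims_V] unfolding cls_def by blast
qed

lemma cls_image: "cauchy_class B p ` cauchy_seqs B p = cls ` lims"
proof safe
  fix s assume "s \<in> cauchy_seqs B p"
  then obtain f where "conv s f" using cauchy_iff by blast
  then show "cauchy_class B p s \<in> cls ` lims"
    using cauchy_class_conv by (auto simp: lims_def)
next
  fix f assume "f \<in> lims"
  then obtain s where s: "conv s f" by (auto simp: lims_def)
  then show "cls f \<in> cauchy_class B p ` cauchy_seqs B p"
    using cauchy_class_conv[OF s] cauchy_iff by blast
qed

definition rep :: "(nat \<Rightarrow> 'a) set \<Rightarrow> 'w \<Rightarrow> complex" where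
  "rep X = (SOME f. f \<in> lims \<and> X = cls f)"

lemma rep:
  assumes "X \<in> cls ` lims" shows "rep X \<in> lims" "cls (rep X) = X"
proof -
  have "\<exists>f. f \<in> lims \<and> X = cls f" using assms by blast
  from someI_ex[OF this] show "rep X \<in> lims" "cls (rep X) = X" unfolding rep_def by simp_all
qed

lemma rep_cls: "f \<in> lims \<Longrightarrow> q (\<lambda>w. rep (cls f) w - f w) = 0"
  using rep[of "cls f"] cls_eq_iff by blast

lemma cls_nonempty: "f \<in> lims \<Longrightarrow> cls f \<noteq> {}"
  by (auto simp: lims_def cls_def)

lemma conv_in_lims: "conv s f \<Longrightarrow> f \<in> lims"
  by (auto simp: lims_def)

text \<open>The limit \<open>k\<close> is the same for all representatives \<open>s\<close> and
  \<open>t\<close>, so the union has a single value; operations on classes thus become operations on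
  limit functions.\<close>

lemma cls_binop:
  assumes f: "f \<in> lims" and g: "g \<in> lims"
    and h: "\<And>s t. conv s f \<Longrightarrow> conv t g \<Longrightarrow> conv (\<lambda>n. u (s n) (t n)) k"
  shows "(\<Union>s\<in>cls f. \<Union>t\<in>cls g. cauchy_class B p (\<lambda>n. u (s n) (t n))) = cls k"
  by (intro UN_eq_const cls_nonempty f g cauchy_class_conv h) (auto simp: cls_def)

lemma cls_unop:
  assumes f: "f \<in> lims" and h: "\<And>s. conv s f \<Longrightarrow> conv (\<lambda>n. u (s n)) k"
  shows "(\<Union>s\<in>cls f. cauchy_class B p (\<lambda>n. u (s n))) = cls k"
  by (intro UN_eq_const cls_nonempty f cauchy_class_conv h) (auto simp: cls_def)

end

section \<open>Multiplication operators and their commutant\<close>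

text \<open>A copy of L2 of \<open>N\<close> whose vectors need not be functions:
  \<open>lift\<close> picks a representative of each. The commutant is computed here, independently
  of the way in which GNS vectors are encoded.\<close>

locale l2_model = prob_space N for N :: "'w measure" +
  fixes H :: "'h hilbert" and lift :: "'h \<Rightarrow> 'w \<Rightarrow> complex"
  assumes lift_sqint: "X \<in> hcarrier H \<Longrightarrow> sqint N (lift X)"
    and hzero_closed: "hzero H \<in> hcarrier H"
    and lift_zero: "AE w in N. lift (hzero H) w = 0"
    and hadd_closed: "X \<in> hcarrier H \<Longrightarrow> Y \<in> hcarrier H \<Longrightarrow> hadd H X Y \<in> hcarrier H"
    and lift_add: "X \<in> hcarrier H \<Longrightarrow> Y \<in> hcarrier H \<Longrightarrow> AE w in N. lift (hadd H X Y) w = lift X w + lift Y w"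
    and hscale_closed: "X \<in> hcarrier H \<Longrightarrow> hscale H c X \<in> hcarrier H"
    and lift_scale: "X \<in> hcarrier H \<Longrightarrow> AE w in N. lift (hscale H c X) w = c * lift X w"
    and hinner_eq: "X \<in> hcarrier H \<Longrightarrow> Y \<in> hcarrier H \<Longrightarrow> hinner H X Y = (\<integral>w. lift X w * cnj (lift Y w) \<partial>N)"
    and lift_inj: "X \<in> hcarrier H \<Longrightarrow> Y \<in> hcarrier H \<Longrightarrow> AE w in N. lift X w = lift Y w \<Longrightarrow> X = Y"
    and lift_surj: "sqint N f \<Longrightarrow> \<exists>X\<in>hcarrier H. AE w in N. lift X w = f w"
begin

lemma lift_meas: "X \<in> hcarrier H \<Longrightarrow> lift X \<in> borel_measurable N"
  by (rule sqint_measurable[OF lift_sqint])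

definition vec :: "('w \<Rightarrow> complex) \<Rightarrow> 'h" where
  "vec f = (SOME X. X \<in> hcarrier H \<and> (AE w in N. lift X w = f w))"

lemma vec:
  assumes "sqint N f" shows "vec f \<in> hcarrier H" "AE w in N. lift (vec f) w = f w"
proof -
  have "\<exists>X. X \<in> hcarrier H \<and> (AE w in N. lift X w = f w)" using lift_surj[OF assms] by blast
  from someI_ex[OF this] show "vec f \<in> hcarrier H" "AE w in N. lift (vec f) w = f w"
    unfolding vec_def by simp_all
qed

lemma lift_eqI:
  assumes "X \<in> hcarrier H" "Y \<in> hcarrier H" "AE w in N. lift X w = f w" "AE w in N. lift Y w = f w"
  shows "X = Y"
proof (rule lift_inj[OF assms(1,2)])
  show "AE w in N. lift X w = lift Y w" using assms(3,4) by eventually_elim simp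
qed

lemma hnorm_eq:
  assumes "X \<in> hcarrier H" shows "hnorm H X = l2n N (lift X)"
proof -
  have "(\<lambda>w. lift X w * cnj (lift X w)) = (\<lambda>w. complex_of_real ((cmod (lift X w))\<^sup>2))"
    by (simp only: complex_norm_square)
  then show ?thesis using hinner_eq[OF assms assms]
    by (simp only: hnorm_def l2n_def integral_complex_of_real Re_complex_of_real)
qed

definition mop :: "('w \<Rightarrow> complex) \<Rightarrow> 'h \<Rightarrow> 'h" where
  "mop f = (\<lambda>X\<in>hcarrier H. vec (\<lambda>w. f w * lift X w))"

lemma mop:
  assumes "f \<in> ess_bounded N" "X \<in> hcarrier H"
  shows "mop f X \<in> hcarrier H" "AE w in N. lift (mop f X) w = f w * lift X w"
  using vec[OF sqint_mult_ess[OF assms(1) lift_sqint[OF assms(2)]]] assms(2) by (simp_all add: mop_def)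

lemma hnorm_mop_le:
  assumes f: "f \<in> ess_bounded N" and C: "0 \<le> C" "AE w in N. cmod (f w) \<le> C" and X: "X \<in> hcarrier H"
  shows "hnorm H (mop f X) \<le> C * hnorm H X"
proof -
  note fm = ess_bounded_measurable[OF f] note mX = mop[OF f X]
  have "l2n N (lift (mop f X)) = l2n N (\<lambda>w. f w * lift X w)"
    by (rule l2n_cong_AE[OF mX(2) lift_meas[OF mX(1)]]) (use fm lift_meas[OF X] in measurable)
  then show ?thesis using l2n_mult_le[OF fm C(2,1) lift_sqint[OF X]] by (simp add: hnorm_eq X mX(1))
qed

lemma mop_bounded:
  assumes f: "f \<in> ess_bounded N" shows "mop f \<in> bounded_ops H"
  unfolding bounded_ops_def mem_Collect_eq
proof (intro conjI ballI allI)
  show "mop f \<in> hcarrier H \<rightarrow>\<^sub>E hcarrier H"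
    by (rule PiE_I) (simp add: mop(1)[OF f], simp add: mop_def)
  obtain C where C: "0 \<le> C" "AE w in N. cmod (f w) \<le> C" using ess_bounded_bound[OF f] .
  show "\<exists>C. \<forall>X\<in>hcarrier H. hnorm H (mop f X) \<le> C * hnorm H X" using hnorm_mop_le[OF f C] by blast
  fix X assume X: "X \<in> hcarrier H"
  {
    fix Y assume Y: "Y \<in> hcarrier H"
    show "mop f (hadd H X Y) = hadd H (mop f X) (mop f Y)"
    proof (rule lift_eqI)
      show "AE w in N. lift (mop f (hadd H X Y)) w = f w * lift X w + f w * lift Y w"
        using mop(2)[OF f hadd_closed[OF X Y]] lift_add[OF X Y] by eventually_elim (simp add: distrib_left)
      show "AE w in N. lift (hadd H (mop f X) (mop f Y)) w = f w * lift X w + f w * lift Y w"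
        using lift_add[OF mop(1)[OF f X] mop(1)[OF f Y]] mop(2)[OF f X] mop(2)[OF f Y] by eventually_elim simp
    qed (intro mop f hadd_closed X Y)+
  }
  fix c
  show "mop f (hscale H c X) = hscale H c (mop f X)"
  proof (rule lift_eqI)
    show "AE w in N. lift (mop f (hscale H c X)) w = c * (f w * lift X w)"
      using mop(2)[OF f hscale_closed[OF X, of c]] lift_scale[OF X, of c] by eventually_elim simp
    show "AE w in N. lift (hscale H c (mop f X)) w = c * (f w * lift X w)"
      using lift_scale[OF mop(1)[OF f X], of c] mop(2)[OF f X] by eventually_elim simp
  qed (intro mop f hscale_closed X)+
qed

lemma bounded_opD:
  assumes "T \<in> bounded_ops H"
  shows "X \<in> hcarrier H \<Longrightarrow> T X \<in> hcarrier H"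
    and "X \<in> hcarrier H \<Longrightarrow> Y \<in> hcarrier H \<Longrightarrow> T (hadd H X Y) = hadd H (T X) (T Y)"
    and "X \<in> hcarrier H \<Longrightarrow> T (hscale H c X) = hscale H c (T X)"
    and "T \<in> extensional (hcarrier H)"
  using assms by (auto simp: bounded_ops_def PiE_def)

lemma bounded_op_bound:
  assumes "T \<in> bounded_ops H"
  shows "\<exists>C\<ge>0. \<forall>X\<in>hcarrier H. hnorm H (T X) \<le> C * hnorm H X"
proof -
  obtain C where C: "\<forall>X\<in>hcarrier H. hnorm H (T X) \<le> C * hnorm H X"
    using assms unfolding bounded_ops_def by blast
  have "hnorm H (T X) \<le> \<bar>C\<bar> * hnorm H X" if "X \<in> hcarrier H" for X
    by (rule order_trans[OF bspec[OF C that]]) (simp add: mult_right_mono hnorm_eq that)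
  then show ?thesis by (intro exI[of _ "\<bar>C\<bar>"]) simp
qed

text \<open>The difference of two vectors is formed by adding the multiple by -1; the operator bound
  then becomes a Lipschitz estimate for representatives.\<close>

lemma l2n_diff_le:
  assumes T: "T \<in> bounded_ops H" and C: "\<And>X. X \<in> hcarrier H \<Longrightarrow> hnorm H (T X) \<le> C * hnorm H X"
    and X: "X \<in> hcarrier H" and Y: "Y \<in> hcarrier H"
  shows "l2n N (\<lambda>w. lift (T X) w - lift (T Y) w) \<le> C * l2n N (\<lambda>w. lift X w - lift Y w)"
proof -
  let ?D = "hadd H X (hscale H (-1) Y)"
  have D: "?D \<in> hcarrier H" by (intro hadd_closed hscale_closed X Y)
  note TX = bounded_opD(1)[OF T X] bounded_opD(1)[OF T Y]
  have "AE w in N. lift ?D w = lift X w - lift Y w"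
    using lift_add[OF X hscale_closed[OF Y, of "-1"]] lift_scale[OF Y, of "-1"] by eventually_elim simp
  then have 1: "hnorm H ?D = l2n N (\<lambda>w. lift X w - lift Y w)"
    unfolding hnorm_eq[OF D] using lift_meas X Y D by (intro l2n_cong_AE) auto
  have "T ?D = hadd H (T X) (hscale H (-1) (T Y))"
    using bounded_opD(2)[OF T X hscale_closed[OF Y]] bounded_opD(3)[OF T Y] by simp
  then have "AE w in N. lift (T ?D) w = lift (T X) w - lift (T Y) w"
    using lift_add[OF TX(1) hscale_closed[OF TX(2), of "-1"]] lift_scale[OF TX(2), of "-1"] by (auto elim: eventually_elim2)
  then have 2: "hnorm H (T ?D) = l2n N (\<lambda>w. lift (T X) w - lift (T Y) w)"
    unfolding hnorm_eq[OF bounded_opD(1)[OF T D]] using lift_meas TX bounded_opD(1)[OF T D] by (intro l2n_cong_AE) auto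
  show ?thesis using C[OF D] unfolding 1 2 .
qed

definition dense :: "('w \<Rightarrow> complex) set \<Rightarrow> bool" where
  "dense \<C> \<longleftrightarrow> (\<forall>f. sqint N f \<longrightarrow> (\<exists>c. (\<forall>n::nat. c n \<in> \<C>) \<and> (\<lambda>n. l2n N (\<lambda>w. c n w - f w)) \<longlonglongrightarrow> 0))"

definition cyc :: 'h where "cyc = vec (\<lambda>w. 1)"

lemma cyc: "cyc \<in> hcarrier H" "AE w in N. lift cyc w = 1"
  unfolding cyc_def by (intro vec sqint_ess_bounded ess_bounded_const)+

text \<open>For the set where |f| exceeds \<open>C\<close> the hypothesis squares to the integral
  comparison of \<open>AE_le_of_integral_indicator\<close>. This upgrades a square-integrable symbol
  to an essentially bounded one.\<close>

lemma ess_bounded_of_multiplier: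
  assumes fm [measurable]: "f \<in> borel_measurable N" and C: "0 \<le> C"
    and le: "\<And>A. A \<in> sets N \<Longrightarrow> sqint N (\<lambda>w. f w * indicator A w) \<and> l2n N (\<lambda>w. f w * indicator A w) \<le> C * l2n N (indicator A)"
  shows "AE w in N. cmod (f w) \<le> C"
proof -
  have "AE w in N. (cmod (f w))\<^sup>2 \<le> C\<^sup>2"
  proof (rule AE_le_of_integral_indicator[OF finite_measure_axioms])
    have "sqint N (\<lambda>w. f w * indicator (space N) w)" using le[of "space N"] by simp
    then have "sqint N f" by (rule sqint_cong_AE[rotated]) auto
    then show "integrable N (\<lambda>w. (cmod (f w))\<^sup>2)" by (rule sqint_integrable)
    let ?A = "{w \<in> space N. C\<^sup>2 < (cmod (f w))\<^sup>2}"
    have A: "?A \<in> sets N" by measurable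
    have ci: "(cmod (indicator S w))\<^sup>2 = indicator S w" for S and w :: 'w by (simp add: indicator_def)
    have "(l2n N (\<lambda>w. f w * indicator ?A w))\<^sup>2 \<le> (C * l2n N (indicator ?A))\<^sup>2"
      using le[OF A] by (intro power_mono) auto
    then show "(\<integral>w. (cmod (f w))\<^sup>2 * indicator ?A w \<partial>N) \<le> C\<^sup>2 * measure N ?A"
      using A by (simp add: power_mult_distrib l2n_sq norm_mult ci)
  qed
  then show ?thesis by eventually_elim (rule power2_le_imp_le[OF _ C])
qed

text \<open>As the symbol is only known to be square integrable at first, the two functions are compared in the
  \<open>L\<^sup>1\<close> norm.\<close>

lemma commuting_is_multiplication:
  assumes dense: "dense \<C>" and CE: "\<C> \<subseteq> ess_bounded N"
    and T: "T \<in> bounded_ops H"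
    and comm: "\<And>c. c \<in> \<C> \<Longrightarrow> compose (hcarrier H) T (mop c) = compose (hcarrier H) (mop c) T"
  shows "lift (T cyc) \<in> ess_bounded N" "T = mop (lift (T cyc))"
proof -
  define f where "f = lift (T cyc)"
  have Tc: "T cyc \<in> hcarrier H" by (rule bounded_opD(1)[OF T cyc(1)])
  have f: "sqint N f" unfolding f_def by (rule lift_sqint[OF Tc])
  note fm [measurable] = sqint_measurable[OF f]
  obtain C where C: "0 \<le> C" "\<And>X. X \<in> hcarrier H \<Longrightarrow> hnorm H (T X) \<le> C * hnorm H X"
    using bounded_op_bound[OF T] by blast
  \<comment> \<open>The only use of commutation: \<open>T\<close> sends \<open>mop c cyc\<close> to
    \<open>mop c (T cyc)\<close>, so on these vectors it multiplies by \<open>f\<close>.\<close>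
  have onC: "AE w in N. lift (T (mop c cyc)) w = c w * f w" "AE w in N. lift (mop c cyc) w = c w" if c: "c \<in> \<C>" for c
  proof -
    have ce: "c \<in> ess_bounded N" using c CE by blast
    have "T (mop c cyc) = mop c (T cyc)" using fun_cong[OF comm[OF c], of cyc] cyc(1) by (simp add: compose_def)
    then show "AE w in N. lift (T (mop c cyc)) w = c w * f w" using mop(2)[OF ce Tc] by (simp add: f_def)
    show "AE w in N. lift (mop c cyc) w = c w" using mop(2)[OF ce cyc(1)] cyc(2) by eventually_elim simp
  qed
  have key: "AE w in N. lift (T X) w = f w * lift X w" if X: "X \<in> hcarrier H" for X
  proof -
    define g h where "g = lift X" and "h = lift (T X)"
    have g: "sqint N g" and h: "sqint N h" unfolding g_def h_def by (intro lift_sqint X bounded_opD(1)[OF T])+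
    obtain c where c: "\<And>n::nat. c n \<in> \<C>" and cl: "(\<lambda>n. l2n N (\<lambda>w. c n w - g w)) \<longlonglongrightarrow> 0"
      using dense[unfolded dense_def, rule_format, OF g] by blast
    have ce: "c n \<in> ess_bounded N" for n using c CE by blast
    have cs: "sqint N (c n)" for n by (rule sqint_ess_bounded[OF ce])
    \<comment> \<open>The error \<open>f * g - h\<close> is split at \<open>c n\<close>: the part
      \<open>f * (c n - g)\<close> is controlled by the Cauchy-Schwarz inequality, and
      \<open>c n * f - h\<close> by the boundedness of \<open>T\<close>.\<close>
    have b: "(\<integral>w. cmod (f w * g w - h w) \<partial>N) \<le> (l2n N f + C) * l2n N (\<lambda>w. c n w - g w)" for n
    proof -
      let ?X = "mop (c n) cyc"
      note mX = mop(1)[OF ce cyc(1), of n] note TX = bounded_opD(1)[OF T mX]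
      have "l2n N (\<lambda>w. c n w * f w - h w) = l2n N (\<lambda>w. lift (T ?X) w - lift (T X) w)"
        using onC(1)[OF c, of n] lift_meas[OF TX] sqint_measurable[OF h] sqint_measurable[OF cs] fm
        by (intro l2n_cong_AE) (auto simp: h_def elim: eventually_mono)
      also have "\<dots> \<le> C * l2n N (\<lambda>w. lift ?X w - lift X w)" by (rule l2n_diff_le[OF T C(2) mX X])
      also have "l2n N (\<lambda>w. lift ?X w - lift X w) = l2n N (\<lambda>w. c n w - g w)"
        using onC(2)[OF c, of n] lift_meas[OF mX] sqint_measurable[OF g] sqint_measurable[OF cs]
        by (intro l2n_cong_AE) (auto simp: g_def elim: eventually_mono)
      finally have 1: "l2n N (\<lambda>w. c n w * f w - h w) \<le> C * l2n N (\<lambda>w. c n w - g w)" .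
      have s1: "sqint N (\<lambda>w. c n w * f w - h w)" by (intro sqint_diff sqint_mult_ess ce f h)
      have s2: "sqint N (\<lambda>w. c n w - g w)" by (intro sqint_diff cs g)
      have i1: "integrable N (\<lambda>w. cmod (f w * (c n w - g w)))" using sqint_prod_integrable[OF f s2] by simp
      have i2: "integrable N (\<lambda>w. cmod (c n w * f w - h w))" using sqint_imp_integrable[OF s1] by simp
      have i3: "integrable N (\<lambda>w. cmod (f w * g w - h w))"
        using sqint_prod_integrable[OF f g] sqint_imp_integrable[OF h] by auto
      have "(\<integral>w. cmod (f w * g w - h w) \<partial>N) \<le> (\<integral>w. cmod (f w * (c n w - g w)) + cmod (c n w * f w - h w) \<partial>N)"
      proof (rule integral_mono[OF i3 Bochner_Integration.integrable_add[OF i1 i2]])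
        fix w
        have "f w * g w - h w = - (f w * (c n w - g w)) + (c n w * f w - h w)" by (simp add: algebra_simps)
        then show "cmod (f w * g w - h w) \<le> cmod (f w * (c n w - g w)) + cmod (c n w * f w - h w)"
          by (metis norm_minus_cancel norm_triangle_ineq)
      qed
      also have "\<dots> = (\<integral>w. cmod (f w * (c n w - g w)) \<partial>N) + (\<integral>w. cmod (c n w * f w - h w) \<partial>N)"
        by (rule Bochner_Integration.integral_add[OF i1 i2])
      also have "\<dots> \<le> l2n N f * l2n N (\<lambda>w. c n w - g w) + C * l2n N (\<lambda>w. c n w - g w)"
        using l2_Cauchy_Schwarz[OF f s2] l1_le_l2n[OF s1] 1 by linarith
      finally show ?thesis by (simp add: distrib_right)
    qed
    have "(\<integral>w. cmod (f w * g w - h w) \<partial>N) \<le> 0"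
    proof (rule LIMSEQ_le_const)
      show "(\<lambda>n. (l2n N f + C) * l2n N (\<lambda>w. c n w - g w)) \<longlonglongrightarrow> 0" by (rule tendsto_mult_right_zero[OF cl])
    qed (use b in auto)
    moreover have "integrable N (\<lambda>w. cmod (f w * g w - h w))"
      using sqint_prod_integrable[OF f g] sqint_imp_integrable[OF h] by auto
    moreover have "0 \<le> (\<integral>w. cmod (f w * g w - h w) \<partial>N)" by (rule Bochner_Integration.integral_nonneg) simp
    ultimately have "AE w in N. cmod (f w * g w - h w) = 0"
      by (subst integral_nonneg_eq_0_iff_AE[symmetric]) simp_all
    then show ?thesis by eventually_elim (simp add: g_def h_def)
  qed
  have "AE w in N. cmod (f w) \<le> C"
  proof (rule ess_bounded_of_multiplier[OF fm C(1)])
    fix A assume A: "A \<in> sets N"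
    have iA: "sqint N (indicator A)" by (intro sqint_ess_bounded ess_bounded_indicator A)
    note v = vec[OF iA] note Tv = bounded_opD(1)[OF T v(1)]
    have ae: "AE w in N. lift (T (vec (indicator A))) w = f w * indicator A w"
      using key[OF v(1)] v(2) by eventually_elim simp
    have m: "(\<lambda>w. f w * indicator A w) \<in> borel_measurable N" using A by measurable
    have "l2n N (\<lambda>w. f w * indicator A w) = hnorm H (T (vec (indicator A)))"
      unfolding hnorm_eq[OF Tv] by (rule l2n_cong_AE[OF ae lift_meas[OF Tv] m, symmetric])
    also have "\<dots> \<le> C * hnorm H (vec (indicator A))" by (rule C(2)[OF v(1)])
    also have "hnorm H (vec (indicator A)) = l2n N (indicator A)"
      unfolding hnorm_eq[OF v(1)] by (rule l2n_cong_AE[OF v(2) lift_meas[OF v(1)] sqint_measurable[OF iA]])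
    finally show "sqint N (\<lambda>w. f w * indicator A w) \<and> l2n N (\<lambda>w. f w * indicator A w) \<le> C * l2n N (indicator A)"
      using sqint_cong_AE[OF ae lift_sqint[OF Tv] m] by simp
  qed
  then show fe: "lift (T cyc) \<in> ess_bounded N" using fm unfolding f_def by (intro ess_boundedI)
  show "T = mop (lift (T cyc))"
  proof (rule extensionalityI[OF bounded_opD(4)[OF T] bounded_opD(4)[OF mop_bounded[OF fe]]])
    fix X assume X: "X \<in> hcarrier H"
    show "T X = mop (lift (T cyc)) X"
      by (rule lift_eqI[OF bounded_opD(1)[OF T X] mop(1)[OF fe X] key[OF X, unfolded f_def] mop(2)[OF fe X]])
  qed
qed

lemma mop_commute:
  assumes f: "f \<in> ess_bounded N" and g: "g \<in> ess_bounded N"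
  shows "compose (hcarrier H) (mop f) (mop g) = compose (hcarrier H) (mop g) (mop f)"
proof (rule extensionalityI[OF compose_extensional compose_extensional])
  fix X assume X: "X \<in> hcarrier H"
  have "mop f (mop g X) = mop g (mop f X)"
  proof (rule lift_eqI)
    show "AE w in N. lift (mop f (mop g X)) w = f w * (g w * lift X w)"
      using mop(2)[OF f mop(1)[OF g X]] mop(2)[OF g X] by eventually_elim simp
    show "AE w in N. lift (mop g (mop f X)) w = f w * (g w * lift X w)"
      using mop(2)[OF g mop(1)[OF f X]] mop(2)[OF f X] by eventually_elim simp
  qed (intro mop f g X)+
  then show "compose (hcarrier H) (mop f) (mop g) X = compose (hcarrier H) (mop g) (mop f) X"
    using X by (simp add: compose_def)
qed

text \<open>Multiplication operators commute with each other, and an operator that commutes with a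
  dense set of them is one of them.\<close>

lemma commutant_mop:
  assumes "dense \<C>" "\<C> \<subseteq> ess_bounded N"
  shows "commutant H (mop ` \<C>) = mop ` ess_bounded N"
proof (intro equalityI subsetI)
  fix T assume "T \<in> commutant H (mop ` \<C>)"
  then have "T \<in> bounded_ops H" "\<And>c. c \<in> \<C> \<Longrightarrow> compose (hcarrier H) T (mop c) = compose (hcarrier H) (mop c) T"
    by (auto simp: commutant_def)
  from commuting_is_multiplication[OF assms this] show "T \<in> mop ` ess_bounded N" by blast
next
  fix T assume "T \<in> mop ` ess_bounded N"
  then show "T \<in> commutant H (mop ` \<C>)"
    using assms(2) by (auto simp: commutant_def mop_bounded intro!: mop_commute)
qed

text \<open>The commutant is again given by a dense set of bounded symbols, so the computation of
  the commutant applies to it once more.\<close>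

lemma bicommutant_mop:
  assumes "dense \<C>" "\<C> \<subseteq> ess_bounded N"
  shows "commutant H (commutant H (mop ` \<C>)) = mop ` ess_bounded N"
proof -
  have "dense (ess_bounded N)" using assms unfolding dense_def by blast
  then show ?thesis unfolding commutant_mop[OF assms] by (rule commutant_mop) simp
qed

lemma lift_mop_cyc:
  assumes "f \<in> ess_bounded N" shows "AE w in N. lift (mop f cyc) w = f w"
  using mop(2)[OF assms cyc(1)] cyc(2) by eventually_elim simp

text \<open>Since a vector is determined by its representative up to null sets, identities in the
  operator algebra reduce to pointwise computations with symbols.\<close>

lemma mop_eqI:
  assumes f: "f \<in> ess_bounded N" and T: "T \<in> extensional (hcarrier H)"
    and c: "\<And>X. X \<in> hcarrier H \<Longrightarrow> T X \<in> hcarrier H"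
    and ae: "\<And>X. X \<in> hcarrier H \<Longrightarrow> AE w in N. lift (T X) w = f w * lift X w"
  shows "T = mop f"
proof (rule extensionalityI[OF T bounded_opD(4)[OF mop_bounded[OF f]]])
  show "T X = mop f X" if "X \<in> hcarrier H" for X
    by (rule lift_eqI[OF c[OF that] mop(1)[OF f that] ae[OF that] mop(2)[OF f that]])
qed

lemma mop_cong:
  assumes f: "f \<in> ess_bounded N" and g: "g \<in> ess_bounded N" and ae: "AE w in N. f w = g w"
  shows "mop f = mop g"
proof (rule mop_eqI[OF g bounded_opD(4)[OF mop_bounded[OF f]] mop(1)[OF f]])
  show "AE w in N. lift (mop f X) w = g w * lift X w" if "X \<in> hcarrier H" for X
    using mop(2)[OF f that] ae by eventually_elim simp
qed

text \<open>Tested on the vector of the difference, whose squared norm the hypothesis makes 0. This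
  gives the uniqueness on which the description in \<open>adjoint_op\<close> rests.\<close>

lemma hinner_ext:
  assumes Y: "Y \<in> hcarrier H" and Z: "Z \<in> hcarrier H"
    and eq: "\<And>X. X \<in> hcarrier H \<Longrightarrow> hinner H X Y = hinner H X Z"
  shows "Y = Z"
proof -
  define d where "d w = lift Y w - lift Z w" for w
  have d: "sqint N d" unfolding d_def by (intro sqint_diff lift_sqint Y Z)
  note v = vec[OF d]
  have i: "integrable N (\<lambda>w. lift (vec d) w * cnj (lift W w))" if "W \<in> hcarrier H" for W
    by (intro sqint_prod_integrable sqint_cnj lift_sqint v that)
  have "0 = (\<integral>w. lift (vec d) w * cnj (lift Y w) \<partial>N) - (\<integral>w. lift (vec d) w * cnj (lift Z w) \<partial>N)"
    using eq[OF v(1)] by (simp add: hinner_eq v(1) Y Z)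
  also have "\<dots> = (\<integral>w. lift (vec d) w * cnj (lift Y w) - lift (vec d) w * cnj (lift Z w) \<partial>N)"
    using i[OF Y] i[OF Z] by simp
  also have "\<dots> = (\<integral>w. complex_of_real ((cmod (d w))\<^sup>2) \<partial>N)"
  proof (rule integral_cong_AE)
    show "AE w in N. lift (vec d) w * cnj (lift Y w) - lift (vec d) w * cnj (lift Z w) = complex_of_real ((cmod (d w))\<^sup>2)"
      using v(2) by eventually_elim (simp only: complex_norm_square, simp add: d_def right_diff_distrib)
  qed (use lift_meas[OF v(1)] lift_meas[OF Y] lift_meas[OF Z] sqint_measurable[OF d] in measurable)
  finally have "l2n N d = 0" by (simp only: integral_complex_of_real l2n_def of_real_eq_0_iff[symmetric, where 'a = complex]) simp
  then have "AE w in N. d w = 0" using l2n_eq_0_iff[OF d] by simp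
  then show ?thesis by (intro lift_inj[OF Y Z]) (simp add: d_def)
qed

lemma adjoint_mop:
  assumes f: "f \<in> ess_bounded N" shows "adjoint_op H (mop f) = mop (\<lambda>w. cnj (f w))"
  unfolding adjoint_op_def
proof (rule the_equality)
  note g = ess_bounded_cnj[OF f]
  have adj: "hinner H (mop f X) Y = hinner H X (mop (\<lambda>w. cnj (f w)) Y)" if X: "X \<in> hcarrier H" and Y: "Y \<in> hcarrier H" for X Y
    unfolding hinner_eq[OF mop(1)[OF f X] Y] hinner_eq[OF X mop(1)[OF g Y]]
  proof (rule integral_cong_AE)
    show "AE w in N. lift (mop f X) w * cnj (lift Y w) = lift X w * cnj (lift (mop (\<lambda>w. cnj (f w)) Y) w)"
      using mop(2)[OF f X] mop(2)[OF g Y] by eventually_elim simp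
  qed (use lift_meas[OF X] lift_meas[OF Y] lift_meas[OF mop(1)[OF f X]] lift_meas[OF mop(1)[OF g Y]] in measurable)
  then show "mop (\<lambda>w. cnj (f w)) \<in> bounded_ops H \<and> (\<forall>X\<in>hcarrier H. \<forall>Y\<in>hcarrier H. hinner H (mop f X) Y = hinner H X (mop (\<lambda>w. cnj (f w)) Y))"
    using mop_bounded[OF g] by blast
  fix S assume S: "S \<in> bounded_ops H \<and> (\<forall>X\<in>hcarrier H. \<forall>Y\<in>hcarrier H. hinner H (mop f X) Y = hinner H X (S Y))"
  show "S = mop (\<lambda>w. cnj (f w))"
  proof (rule extensionalityI[OF bounded_opD(4) bounded_opD(4)[OF mop_bounded[OF g]]])
    fix Y assume Y: "Y \<in> hcarrier H"
    show "S Y = mop (\<lambda>w. cnj (f w)) Y"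
    proof (rule hinner_ext)
      show "hinner H X (S Y) = hinner H X (mop (\<lambda>w. cnj (f w)) Y)" if "X \<in> hcarrier H" for X
        using adj[OF that Y] S that Y by simp
    qed (use S Y mop(1)[OF g Y] bounded_opD(1) in auto)
  qed (use S in blast)
qed

text \<open>Testing on indicators shows that the operator norm of a multiplication operator is the
  essential supremum of its symbol.\<close>

lemma mop_bound_iff:
  assumes f: "f \<in> ess_bounded N" and C: "0 \<le> C"
  shows "(\<forall>X\<in>hcarrier H. hnorm H (mop f X) \<le> C * hnorm H X) \<longleftrightarrow> (AE w in N. cmod (f w) \<le> C)"
proof
  assume *: "\<forall>X\<in>hcarrier H. hnorm H (mop f X) \<le> C * hnorm H X"
  show "AE w in N. cmod (f w) \<le> C"
  proof (rule ess_bounded_of_multiplier[OF ess_bounded_measurable[OF f] C])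
    fix A assume A: "A \<in> sets N"
    have iA: "sqint N (indicator A)" by (intro sqint_ess_bounded ess_bounded_indicator A)
    note v = vec[OF iA] note mv = mop[OF f v(1)]
    have ae: "AE w in N. lift (mop f (vec (indicator A))) w = f w * indicator A w"
      using mv(2) v(2) by eventually_elim simp
    have m: "(\<lambda>w. f w * indicator A w) \<in> borel_measurable N" using A ess_bounded_measurable[OF f] by measurable
    have "l2n N (\<lambda>w. f w * indicator A w) = hnorm H (mop f (vec (indicator A)))"
      unfolding hnorm_eq[OF mv(1)] by (rule l2n_cong_AE[OF ae lift_meas[OF mv(1)] m, symmetric])
    also have "\<dots> \<le> C * hnorm H (vec (indicator A))" using * v(1) by blast
    also have "hnorm H (vec (indicator A)) = l2n N (indicator A)"
      unfolding hnorm_eq[OF v(1)] by (rule l2n_cong_AE[OF v(2) lift_meas[OF v(1)] sqint_measurable[OF iA]])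
    finally show "sqint N (\<lambda>w. f w * indicator A w) \<and> l2n N (\<lambda>w. f w * indicator A w) \<le> C * l2n N (indicator A)"
      using sqint_mult_ess[OF f iA] by simp
  qed
qed (use hnorm_mop_le[OF f C] in blast)

lemma operator_algebra_mop:
  fixes S defines "A \<equiv> operator_algebra H S"
  assumes f: "f \<in> ess_bounded N" and g: "g \<in> ess_bounded N"
  shows "mop f \<otimes>\<^bsub>A\<^esub> mop g = mop (\<lambda>w. f w * g w)" "mop f \<oplus>\<^bsub>A\<^esub> mop g = mop (\<lambda>w. f w + g w)"
    "c \<odot>\<^bsub>A\<^esub> mop f = mop (\<lambda>w. c * f w)" "star A (mop f) = mop (\<lambda>w. cnj (f w))"
    "\<one>\<^bsub>A\<^esub> = mop (\<lambda>w. 1)" "\<zero>\<^bsub>A\<^esub> = mop (\<lambda>w. 0)"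
    "nrm A (mop f) = Inf {C. 0 \<le> C \<and> (AE w in N. cmod (f w) \<le> C)}"
proof -
  have "compose (hcarrier H) (mop f) (mop g) = mop (\<lambda>w. f w * g w)"
  proof (rule mop_eqI[OF ess_bounded_mult[OF f g] compose_extensional])
    fix X assume X: "X \<in> hcarrier H"
    show "compose (hcarrier H) (mop f) (mop g) X \<in> hcarrier H"
      using X by (simp add: compose_def mop f g)
    show "AE w in N. lift (compose (hcarrier H) (mop f) (mop g) X) w = f w * g w * lift X w"
      using mop(2)[OF f mop(1)[OF g X]] mop(2)[OF g X] by eventually_elim (simp add: compose_def X)
  qed
  then show "mop f \<otimes>\<^bsub>A\<^esub> mop g = mop (\<lambda>w. f w * g w)" by (simp add: A_def operator_algebra_def)
  have "(\<lambda>X\<in>hcarrier H. hadd H (mop f X) (mop g X)) = mop (\<lambda>w. f w + g w)"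
  proof (rule mop_eqI[OF ess_bounded_add[OF f g] restrict_extensional])
    fix X assume X: "X \<in> hcarrier H"
    show "(\<lambda>X\<in>hcarrier H. hadd H (mop f X) (mop g X)) X \<in> hcarrier H"
      using X by (simp add: hadd_closed mop f g)
    show "AE w in N. lift ((\<lambda>X\<in>hcarrier H. hadd H (mop f X) (mop g X)) X) w = (f w + g w) * lift X w"
      using lift_add[OF mop(1)[OF f X] mop(1)[OF g X]] mop(2)[OF f X] mop(2)[OF g X]
      by eventually_elim (simp add: X distrib_right)
  qed
  then show "mop f \<oplus>\<^bsub>A\<^esub> mop g = mop (\<lambda>w. f w + g w)" by (simp add: A_def operator_algebra_def)
  have "(\<lambda>X\<in>hcarrier H. hscale H c (mop f X)) = mop (\<lambda>w. c * f w)"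
  proof (rule mop_eqI[OF ess_bounded_smult[OF f] restrict_extensional])
    fix X assume X: "X \<in> hcarrier H"
    show "(\<lambda>X\<in>hcarrier H. hscale H c (mop f X)) X \<in> hcarrier H"
      using X by (simp add: hscale_closed mop f)
    show "AE w in N. lift ((\<lambda>X\<in>hcarrier H. hscale H c (mop f X)) X) w = (c * f w) * lift X w"
      using lift_scale[OF mop(1)[OF f X], of c] mop(2)[OF f X] by eventually_elim (simp add: X)
  qed
  then show "c \<odot>\<^bsub>A\<^esub> mop f = mop (\<lambda>w. c * f w)" by (simp add: A_def operator_algebra_def)
  show "star A (mop f) = mop (\<lambda>w. cnj (f w))" by (simp add: A_def operator_algebra_def adjoint_mop f)
  have "(\<lambda>X\<in>hcarrier H. X) = mop (\<lambda>w. 1)"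
    by (rule mop_eqI[OF ess_bounded_const restrict_extensional]) simp_all
  then show "\<one>\<^bsub>A\<^esub> = mop (\<lambda>w. 1)" by (simp add: A_def operator_algebra_def)
  have "(\<lambda>X\<in>hcarrier H. hzero H) = mop (\<lambda>w. 0)"
    by (rule mop_eqI[OF ess_bounded_const restrict_extensional]) (simp_all add: hzero_closed lift_zero)
  then show "\<zero>\<^bsub>A\<^esub> = mop (\<lambda>w. 0)" by (simp add: A_def operator_algebra_def)
  have "{C. 0 \<le> C \<and> (\<forall>X\<in>hcarrier H. hnorm H (mop f X) \<le> C * hnorm H X)} = {C. 0 \<le> C \<and> (AE w in N. cmod (f w) \<le> C)}"
    using mop_bound_iff[OF f] by blast
  then show "nrm A (mop f) = Inf {C. 0 \<le> C \<and> (AE w in N. cmod (f w) \<le> C)}"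
    by (simp add: A_def operator_algebra_def)
qed

text \<open>An operator is read off from its value at the constant function 1, which is its symbol
  up to a null set; in particular distinct operators have distinct values there.\<close>

lemma linf_model_operator_algebra:
  "linf_model N (operator_algebra H (mop ` ess_bounded N)) (\<lambda>T. lift (T cyc))"
proof -
  let ?A = "operator_algebra H (mop ` ess_bounded N)"
  note ops = operator_algebra_mop[of _ _ "mop ` ess_bounded N"]
  have car: "carrier ?A = mop ` ess_bounded N" by (simp add: operator_algebra_def)
  have mc: "mop f \<in> carrier ?A" if "f \<in> ess_bounded N" for f using that by (simp add: car)
  have eb: "lift (mop f cyc) \<in> ess_bounded N" if f: "f \<in> ess_bounded N" for f
  proof -
    obtain C where "AE w in N. cmod (f w) \<le> C" using f by (auto simp: ess_bounded_def)
    with lift_mop_cyc[OF f] have "AE w in N. cmod (lift (mop f cyc) w) \<le> C" by eventually_elim simp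
    then show ?thesis by (intro ess_boundedI lift_meas mop f cyc)
  qed
  note c = ess_bounded_const note l = lift_mop_cyc
  show ?thesis
  proof unfold_locales
    show "\<one>\<^bsub>?A\<^esub> \<in> carrier ?A" "AE w in N. lift (\<one>\<^bsub>?A\<^esub> cyc) w = 1"
      unfolding ops(5)[OF c[of 0] c[of 0]] by (intro mc l c)+
    show "\<zero>\<^bsub>?A\<^esub> \<in> carrier ?A" "AE w in N. lift (\<zero>\<^bsub>?A\<^esub> cyc) w = 0"
      unfolding ops(6)[OF c[of 0] c[of 0]] by (intro mc l c)+
    show "\<exists>T\<in>carrier ?A. AE w in N. lift (T cyc) w = f w" if "f \<in> ess_bounded N" for f
      using mc[OF that] l[OF that] by blast
    fix T assume "T \<in> carrier ?A"
    then obtain f where f: "f \<in> ess_bounded N" and T: "T = mop f" by (auto simp: car)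
    note lf = l[OF f]
    show "lift (T cyc) \<in> ess_bounded N" unfolding T by (rule eb[OF f])
    show "c \<odot>\<^bsub>?A\<^esub> T \<in> carrier ?A" for c
      unfolding T ops(3)[OF f f] by (intro mc ess_bounded_smult f)
    show "AE w in N. lift ((c \<odot>\<^bsub>?A\<^esub> T) cyc) w = c * lift (T cyc) w" for c
      unfolding T ops(3)[OF f f] using l[OF ess_bounded_smult[OF f, of c]] lf by eventually_elim simp
    show "star ?A T \<in> carrier ?A"
      unfolding T ops(4)[OF f f] by (intro mc ess_bounded_cnj f)
    show "AE w in N. lift (star ?A T cyc) w = cnj (lift (T cyc) w)"
      unfolding T ops(4)[OF f f] using l[OF ess_bounded_cnj[OF f]] lf by eventually_elim simp
    show "0 \<le> nrm ?A T" unfolding T ops(7)[OF f f] by (rule ess_norm_nonneg[OF f])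
    show "nrm ?A T \<le> C \<longleftrightarrow> (AE w in N. cmod (lift (T cyc) w) \<le> C)" if "0 \<le> C" for C
    proof -
      have "(AE w in N. cmod (f w) \<le> C) \<longleftrightarrow> (AE w in N. cmod (lift (T cyc) w) \<le> C)"
        by (rule eventually_subst) (use lf in eventually_elim, simp add: T)
      then show ?thesis unfolding T ops(7)[OF f f] ess_norm_le_iff[OF f that] .
    qed
    fix R assume "R \<in> carrier ?A"
    then obtain g where g: "g \<in> ess_bounded N" and R: "R = mop g" by (auto simp: car)
    note lg = l[OF g]
    show "T \<oplus>\<^bsub>?A\<^esub> R \<in> carrier ?A"
      unfolding T R ops(2)[OF f g] by (intro mc ess_bounded_add f g)
    show "AE w in N. lift ((T \<oplus>\<^bsub>?A\<^esub> R) cyc) w = lift (T cyc) w + lift (R cyc) w"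
      unfolding T R ops(2)[OF f g] using l[OF ess_bounded_add[OF f g]] lf lg by eventually_elim simp
    show "T \<otimes>\<^bsub>?A\<^esub> R \<in> carrier ?A"
      unfolding T R ops(1)[OF f g] by (intro mc ess_bounded_mult f g)
    show "AE w in N. lift ((T \<otimes>\<^bsub>?A\<^esub> R) cyc) w = lift (T cyc) w * lift (R cyc) w"
      unfolding T R ops(1)[OF f g] using l[OF ess_bounded_mult[OF f g]] lf lg by eventually_elim simp
    show "T = R" if "AE w in N. lift (T cyc) w = lift (R cyc) w"
      unfolding T R
    proof (rule mop_cong[OF f g])
      show "AE w in N. f w = g w" using that lf lg unfolding T R by eventually_elim simp
    qed
  qed
qed

end

section \<open>The Radon product measure\<close>

locale coin_space =
  fixes K :: "'k set"
begin

abbreviation "T \<equiv> cube_topology K"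
abbreviation "\<Omega> \<equiv> cube K"

lemma topspace_T: "topspace T = \<Omega>"
  by (simp add: cube_topology_def cube_def)

lemma compact_T: "compact_space T"
  by (simp add: cube_topology_def compact_space_product_topology compact_space_discrete_topology)

lemma restrict_cube: "\<omega> \<in> \<Omega> \<Longrightarrow> restrict \<omega> F \<in> cube F"
  by (simp add: cube_def)

section \<open>Cylinder sets\<close>

definition cylset :: "'k set \<Rightarrow> ('k \<Rightarrow> bool) set \<Rightarrow> ('k \<Rightarrow> bool) set" where
  "cylset F S = {\<omega>\<in>\<Omega>. restrict \<omega> F \<in> S}"

definition cylsets :: "('k \<Rightarrow> bool) set set" where
  "cylsets = {cylset F S | F S. F \<in> fin_subsets K}"

lemma cylset_lift: "F \<subseteq> G \<Longrightarrow> cylset F S = cylset G {s. restrict s F \<in> S}"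
  by (auto simp: cylset_def Int_absorb1)

lemma cylsetsE:
  assumes "A \<in> cylsets" obtains F S where "finite F" "F \<subseteq> K" "A = cylset F S"
  using assms by (auto simp: cylsets_def fin_subsets_def)

lemma cylsetsI: "finite F \<Longrightarrow> F \<subseteq> K \<Longrightarrow> cylset F S \<in> cylsets"
  by (auto simp: cylsets_def fin_subsets_def)

text \<open>Two cylinder sets can be written over the union of their index sets, which reduces set
  operations on them to set operations on their bases.\<close>

lemma cylsets_common:
  assumes "A \<in> cylsets" "B \<in> cylsets"
  obtains F S S' where "finite F" "F \<subseteq> K" "A = cylset F S" "B = cylset F S'"
proof -
  obtain F S G S' where "finite F" "F \<subseteq> K" "A = cylset F S" "finite G" "G \<subseteq> K" "B = cylset G S'"
    using assms by (elim cylsetsE)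
  then show ?thesis
    using that[of "F \<union> G"] cylset_lift[of F "F \<union> G" S] cylset_lift[of G "F \<union> G" S'] by auto
qed

lemma cylsets_ops:
  assumes "A \<in> cylsets" "B \<in> cylsets"
  shows "A \<union> B \<in> cylsets" "A \<inter> B \<in> cylsets" "A - B \<in> cylsets"
proof -
  obtain F S S' where F: "finite F" "F \<subseteq> K" and AB: "A = cylset F S" "B = cylset F S'"
    using cylsets_common[OF assms] .
  have "A \<union> B = cylset F (S \<union> S')" "A \<inter> B = cylset F (S \<inter> S')" "A - B = cylset F (S - S')"
    by (auto simp: AB cylset_def)
  then show "A \<union> B \<in> cylsets" "A \<inter> B \<in> cylsets" "A - B \<in> cylsets" using cylsetsI[OF F] by simp_all
qed

lemma empty_cylsets: "{} \<in> cylsets" and space_cylsets: "\<Omega> \<in> cylsets"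
  using cylsetsI[of "{}" "{}"] cylsetsI[of "{}" UNIV] by (simp_all add: cylset_def)

lemma Union_cylsets: "finite \<F> \<Longrightarrow> \<F> \<subseteq> cylsets \<Longrightarrow> \<Union>\<F> \<in> cylsets"
  by (induction \<F> rule: finite_induct) (auto simp: empty_cylsets intro: cylsets_ops)

lemma cylsets_subset: "A \<in> cylsets \<Longrightarrow> A \<subseteq> \<Omega>"
  by (auto simp: cylsets_def cylset_def)

lemma PiE_eq_cylset:
  assumes "F \<subseteq> K" "\<And>i. i \<in> K - F \<Longrightarrow> E i = UNIV"
  shows "Pi\<^sub>E K E = cylset F (Pi\<^sub>E F E)"
proof -
  have "(\<forall>i\<in>K. x i \<in> E i) \<longleftrightarrow> (\<forall>i\<in>F. x i \<in> E i)" for x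
  proof (intro iffI ballI)
    fix i assume "\<forall>i\<in>F. x i \<in> E i" "i \<in> K"
    then show "x i \<in> E i" using assms(2)[of i] by (cases "i \<in> F") auto
  qed (use assms(1) in blast)
  moreover have "Pi\<^sub>E K E = {x\<in>extensional K. \<forall>i\<in>K. x i \<in> E i}" by (auto simp: PiE_def Pi_iff)
  moreover have "cylset F (Pi\<^sub>E F E) = {x\<in>extensional K. \<forall>i\<in>F. x i \<in> E i}"
    unfolding cylset_def cube_def restrict_PiE_iff by (simp add: PiE_def)
  ultimately show ?thesis by simp
qed

lemma openin_cylset:
  assumes F: "finite F" "F \<subseteq> K" shows "openin T (cylset F S)"
  unfolding cube_topology_def openin_product_topology_alt
proof
  fix \<omega> assume \<omega>: "\<omega> \<in> cylset F S"
  \<comment> \<open>Fixing the coordinates in \<open>F\<close> gives a basic open neighbourhood of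
    \<open>\<omega>\<close> that stays in the cylinder set.\<close>
  let ?U = "\<lambda>i. if i \<in> F then {\<omega> i} else UNIV"
  have "x \<in> cylset F S" if x: "x \<in> Pi\<^sub>E K ?U" for x
  proof -
    have "restrict x F = restrict \<omega> F"
    proof (rule restrict_ext)
      fix i assume i: "i \<in> F"
      then have "x i \<in> ?U i" using F(2) by (intro PiE_mem[OF x]) auto
      then show "x i = \<omega> i" using i by simp
    qed
    moreover have "x \<in> \<Omega>" using x by (simp add: cube_def PiE_def)
    ultimately show ?thesis using \<omega> by (simp add: cylset_def)
  qed
  then have "Pi\<^sub>E K ?U \<subseteq> cylset F S" by blast
  moreover have "finite {i \<in> K. ?U i \<noteq> UNIV}"
    by (rule finite_subset[OF _ F(1)]) auto
  moreover have "\<omega> \<in> Pi\<^sub>E K ?U" using \<omega> by (auto simp: cylset_def cube_def PiE_iff)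
  ultimately show "\<exists>U. finite {i \<in> K. U i \<noteq> topspace (discrete_topology UNIV)} \<and>
      (\<forall>i\<in>K. openin (discrete_topology UNIV) (U i)) \<and> \<omega> \<in> Pi\<^sub>E K U \<and> Pi\<^sub>E K U \<subseteq> cylset F S"
    by (intro exI[of _ ?U]) simp
qed

lemma openin_cylsets: "A \<in> cylsets \<Longrightarrow> openin T A"
  by (auto elim!: cylsetsE intro: openin_cylset)

text \<open>The complement of a cylinder set is again a cylinder set, hence open, and the cube is
  compact.\<close>

lemma compactin_cylsets:
  assumes "A \<in> cylsets" shows "compactin T A"
proof (rule closedin_compact_space[OF compact_T])
  show "closedin T A"
    using openin_cylsets[OF cylsets_ops(3)[OF space_cylsets assms]] cylsets_subset[OF assms]
    by (simp add: closedin_def topspace_T)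
qed

text \<open>Cylinder sets form a base of the topology that is closed under finite unions, so
  compactness yields one in between. In later approximations cylinder sets can thus replace compact
  sets.\<close>

lemma cylset_between:
  assumes C: "compactin T C" and U: "openin T U" and CU: "C \<subseteq> U"
  shows "\<exists>D\<in>cylsets. C \<subseteq> D \<and> D \<subseteq> U"
proof -
  let ?\<U> = "{D\<in>cylsets. D \<subseteq> U}"
  have "\<exists>D\<in>?\<U>. x \<in> D" if x: "x \<in> C" for x
  proof -
    obtain V where V: "finite {i \<in> K. V i \<noteq> UNIV}" "x \<in> Pi\<^sub>E K V" "Pi\<^sub>E K V \<subseteq> U"
      using bspec[OF iffD1[OF openin_product_topology_alt U[unfolded cube_topology_def]], of x] CU x by auto
    have "Pi\<^sub>E K V = cylset {i \<in> K. V i \<noteq> UNIV} (Pi\<^sub>E {i \<in> K. V i \<noteq> UNIV} V)"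
      by (rule PiE_eq_cylset) auto
    then have "Pi\<^sub>E K V \<in> cylsets" using cylsetsI[OF V(1)] by simp
    then show ?thesis using V by blast
  qed
  then obtain \<F> where "finite \<F>" "\<F> \<subseteq> ?\<U>" "C \<subseteq> \<Union>\<F>"
    using compactinD[OF C, of ?\<U>] openin_cylsets by (auto simp: subset_iff)
  then show ?thesis using Union_cylsets[of \<F>] by (intro bexI[of _ "\<Union>\<F>"]) auto
qed

text \<open>If the index set is uncountable then open sets need not be measurable for the library product measure,
  which is therefore only evaluated on cylinder sets.\<close>

definition coin :: "('k \<Rightarrow> bool) measure" where
  "coin = PiM K (\<lambda>_. uniform_count_measure UNIV)"

lemma prob_space_coin1: "prob_space (uniform_count_measure (UNIV :: bool set))"
  by (rule prob_space_uniform_count_measure) auto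

lemma space_coin: "space coin = \<Omega>"
  by (simp add: coin_def space_PiM cube_def space_uniform_count_measure)

lemma prob_space_coin: "prob_space coin"
  unfolding coin_def by (rule prob_space_PiM[OF prob_space_coin1])

lemma PiE_coin:
  assumes F: "finite F" "F \<subseteq> K" and E: "\<And>i. i \<in> K - F \<Longrightarrow> E i = UNIV"
  shows "Pi\<^sub>E K E \<in> sets coin" "emeasure coin (Pi\<^sub>E K E) = (\<Prod>i\<in>F. ennreal (card (E i) / 2))"
proof -
  have e: "Pi\<^sub>E K E = prod_emb K (\<lambda>_. uniform_count_measure UNIV) F (Pi\<^sub>E F E)"
  proof -
    have "Pi\<^sub>E K E = cylset F (Pi\<^sub>E F E)" by (rule PiE_eq_cylset[OF F(2) E])
    also have "\<dots> = prod_emb K (\<lambda>_. uniform_count_measure UNIV) F (Pi\<^sub>E F E)"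
      unfolding cylset_def prod_emb_def cube_def space_uniform_count_measure by blast
    finally show ?thesis .
  qed
  show "Pi\<^sub>E K E \<in> sets coin"
    unfolding e coin_def by (rule sets_PiM_I[OF F(1,2)]) (simp add: sets_uniform_count_measure)
  have "emeasure coin (Pi\<^sub>E K E) = (\<Prod>i\<in>F. emeasure (uniform_count_measure UNIV) (E i))"
    unfolding e coin_def by (rule emeasure_PiM_emb[OF prob_space_coin1 F(2,1)]) (simp add: sets_uniform_count_measure)
  then show "emeasure coin (Pi\<^sub>E K E) = (\<Prod>i\<in>F. ennreal (card (E i) / 2))"
    by (simp add: emeasure_uniform_count_measure)
qed

text \<open>For \<open>F \<subseteq> K\<close> the product \<open>Pi\<^sub>E K (atom F s)\<close> is
  the set of points that agree with \<open>s\<close> on \<open>F\<close>; these sets are the minimal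
  nonempty cylinder sets over \<open>F\<close>.\<close>

definition atom :: "'k set \<Rightarrow> ('k \<Rightarrow> bool) \<Rightarrow> 'k \<Rightarrow> bool set" where
  "atom F s = (\<lambda>i. if i \<in> F then {s i} else UNIV)"

lemma cylset_UN:
  assumes "F \<subseteq> K" shows "cylset F S = (\<Union>s\<in>S \<inter> cube F. Pi\<^sub>E K (atom F s))"
proof -
  have "Pi\<^sub>E K (atom F s) = cylset F {s}" if "s \<in> cube F" for s
  proof -
    have "Pi\<^sub>E F (atom F s) = {s}"
    proof (rule equalityI; rule subsetI)
      fix x assume "x \<in> {s}"
      then show "x \<in> Pi\<^sub>E F (atom F s)" using that by (simp add: atom_def cube_def PiE_iff)
    next
      fix x assume x: "x \<in> Pi\<^sub>E F (atom F s)"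
      have "x = s"
      proof (rule extensionalityI[of x F s])
        show "x \<in> extensional F" using x by (simp add: PiE_def)
        show "s \<in> extensional F" using that by (simp add: cube_def PiE_def)
        fix i assume "i \<in> F"
        with PiE_mem[OF x this] show "x i = s i" by (simp add: atom_def)
      qed
      then show "x \<in> {s}" by simp
    qed
    then show ?thesis using PiE_eq_cylset[OF assms, of "atom F s"] by (simp add: atom_def)
  qed
  then show ?thesis by (auto simp: cylset_def restrict_cube)
qed

lemma disjoint_atoms:
  assumes "F \<subseteq> K" shows "disjoint_family_on (\<lambda>s. Pi\<^sub>E K (atom F s)) (S \<inter> cube F)"
proof (unfold disjoint_family_on_def, intro ballI impI)
  fix s t assume "s \<in> S \<inter> cube F" "t \<in> S \<inter> cube F" "s \<noteq> t"
  then obtain i where "i \<in> F" "s i \<noteq> t i"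
    using PiE_ext[of s F "\<lambda>_. UNIV" t] unfolding cube_def by blast
  then have "atom F s i \<inter> atom F t i = {}" "i \<in> K" using assms by (auto simp: atom_def)
  then show "Pi\<^sub>E K (atom F s) \<inter> Pi\<^sub>E K (atom F t) = {}"
    using PiE_mem by fastforce
qed

lemma finite_cube: "finite F \<Longrightarrow> finite (cube F)"
  unfolding cube_def by (intro finite_PiE) auto

lemma cylsets_coin: assumes "A \<in> cylsets" shows "A \<in> sets coin"
proof -
  obtain F S where F: "finite F" "F \<subseteq> K" and A: "A = cylset F S" using assms by (rule cylsetsE)
  show ?thesis unfolding A cylset_UN[OF F(2)]
    by (intro sets.finite_UN finite_Int disjI2 finite_cube F PiE_coin(1)[OF F]) (simp add: atom_def)
qed

section \<open>Inner volume of open sets and the outer measure\<close>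

definition inner_vol :: "('k \<Rightarrow> bool) set \<Rightarrow> ennreal" where
  "inner_vol U = (SUP D\<in>{D\<in>cylsets. D \<subseteq> U}. emeasure coin D)"

text \<open>The usual passage from a volume on open sets to an outer measure. As
  \<open>inner_vol\<close> measures only cylinder sets below an open set, it makes sense for open
  sets outside the product \<sigma>-algebra.\<close>

definition outer_vol :: "('k \<Rightarrow> bool) set \<Rightarrow> ennreal" where
  "outer_vol S = (INF U\<in>{U. openin T U \<and> S \<subseteq> U}. inner_vol U)"

lemma inner_vol_mono: "U \<subseteq> V \<Longrightarrow> inner_vol U \<le> inner_vol V"
  unfolding inner_vol_def by (rule SUP_subset_mono) auto

lemma inner_vol_upper: "D \<in> cylsets \<Longrightarrow> D \<subseteq> U \<Longrightarrow> emeasure coin D \<le> inner_vol U"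
  unfolding inner_vol_def by (rule SUP_upper) simp

lemma inner_vol_least: "(\<And>D. D \<in> cylsets \<Longrightarrow> D \<subseteq> U \<Longrightarrow> emeasure coin D \<le> c) \<Longrightarrow> inner_vol U \<le> c"
  unfolding inner_vol_def by (rule SUP_least) auto

lemma inner_vol_cylset: "D \<in> cylsets \<Longrightarrow> inner_vol D = emeasure coin D"
  by (intro antisym inner_vol_least inner_vol_upper emeasure_mono cylsets_coin) auto

lemma outer_vol_lower: "openin T U \<Longrightarrow> S \<subseteq> U \<Longrightarrow> outer_vol S \<le> inner_vol U"
  unfolding outer_vol_def by (rule INF_lower) simp

lemma outer_vol_greatest: "(\<And>U. openin T U \<Longrightarrow> S \<subseteq> U \<Longrightarrow> c \<le> inner_vol U) \<Longrightarrow> c \<le> outer_vol S"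
  unfolding outer_vol_def by (rule INF_greatest) auto

lemma outer_vol_open: "openin T U \<Longrightarrow> outer_vol U = inner_vol U"
  by (intro antisym outer_vol_lower outer_vol_greatest inner_vol_mono) auto

lemma inner_vol_space: "inner_vol \<Omega> = 1"
  using prob_space.emeasure_space_1[OF prob_space_coin] by (simp add: inner_vol_cylset space_cylsets space_coin)

lemma outer_vol_le_1: "S \<subseteq> \<Omega> \<Longrightarrow> outer_vol S \<le> 1"
  using outer_vol_lower[of \<Omega> S] by (simp add: inner_vol_space openin_cylsets space_cylsets)

lemma outer_vol_mono: "S \<subseteq> S' \<Longrightarrow> outer_vol S \<le> outer_vol S'"
  by (rule outer_vol_greatest) (auto intro: outer_vol_lower)

text \<open>A cylinder set \<open>D\<close> in the union is cut in two: \<open>D - V\<close> is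
  compact and contained in \<open>U\<close>, so some cylinder set \<open>D'\<close> lies between
  them, and then \<open>D \<inter> D'\<close> lies in \<open>U\<close> and \<open>D - D'\<close> in
  \<open>V\<close>.\<close>

lemma inner_vol_Un:
  assumes U: "openin T U" and V: "openin T V" shows "inner_vol (U \<union> V) \<le> inner_vol U + inner_vol V"
proof (rule inner_vol_least)
  fix D assume D: "D \<in> cylsets" "D \<subseteq> U \<union> V"
  have "D - V = (\<Omega> - V) \<inter> D" using cylsets_subset[OF D(1)] by blast
  moreover have "closedin T (\<Omega> - V)" using V closedin_def[of T] topspace_T openin_subset[OF V] by (simp add: double_diff)
  ultimately have "compactin T (D - V)"
    using closed_Int_compactin[OF _ compactin_cylsets[OF D(1)]] by simp
  then obtain D' where D': "D' \<in> cylsets" "D - V \<subseteq> D'" "D' \<subseteq> U"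
    using cylset_between[OF _ U] D(2) by blast
  have "emeasure coin D = emeasure coin ((D \<inter> D') \<union> (D - D'))" by (rule arg_cong[where f = "emeasure coin"]) auto
  also have "\<dots> \<le> emeasure coin (D \<inter> D') + emeasure coin (D - D')"
    by (rule emeasure_subadditive) (intro cylsets_coin cylsets_ops D D')+
  also have "\<dots> \<le> inner_vol U + inner_vol V"
    by (intro add_mono inner_vol_upper cylsets_ops D D') (use D' in auto)
  finally show "emeasure coin D \<le> inner_vol U + inner_vol V" .
qed

text \<open>A cylinder set is compact, so finitely many of the open sets already cover it.\<close>

lemma inner_vol_UN:
  assumes U: "\<And>n::nat. openin T (U n)" shows "inner_vol (\<Union>n. U n) \<le> (\<Sum>n. inner_vol (U n))"
proof (rule inner_vol_least)
  fix D assume D: "D \<in> cylsets" "D \<subseteq> (\<Union>n. U n)"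
  have fin: "inner_vol (\<Union>i<n. U i) \<le> (\<Sum>i<n. inner_vol (U i))" for n
  proof (induction n)
    case 0
    show ?case using inner_vol_cylset[OF empty_cylsets] by simp
  next
    case (Suc n)
    have "inner_vol (\<Union>i<Suc n. U i) = inner_vol ((\<Union>i<n. U i) \<union> U n)" by (rule arg_cong[where f = inner_vol]) (auto simp: lessThan_Suc)
    also have "\<dots> \<le> inner_vol (\<Union>i<n. U i) + inner_vol (U n)" by (rule inner_vol_Un[OF openin_Union U]) (auto simp: U)
    also have "\<dots> \<le> (\<Sum>i<Suc n. inner_vol (U i))" using Suc by (simp add: add_right_mono)
    finally show ?case .
  qed
  obtain \<F> where F: "finite \<F>" "\<F> \<subseteq> range U" "D \<subseteq> \<Union>\<F>"
    using compactinD[OF compactin_cylsets[OF D(1)], of "range U"] U D(2) by auto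
  obtain I where I: "finite I" "\<F> = U ` I" using finite_subset_image[OF F(1,2)] by blast
  obtain n where n: "I \<subseteq> {..<n}" using finite_nat_bounded[OF I(1)] by auto
  have "emeasure coin D \<le> inner_vol (\<Union>i<n. U i)"
    by (rule inner_vol_upper[OF D(1)]) (use F I n in blast)
  also have "\<dots> \<le> (\<Sum>i<n. inner_vol (U i))" by (rule fin)
  also have "\<dots> \<le> (\<Sum>n. inner_vol (U n))" by (rule sum_le_suminf) auto
  finally show "emeasure coin D \<le> (\<Sum>n. inner_vol (U n))" .
qed

lemma outer_measure_space_outer: "outer_measure_space (Pow \<Omega>) outer_vol"
  unfolding outer_measure_space_def
proof (intro conjI)
  show "positive (Pow \<Omega>) outer_vol"
    using outer_vol_open[OF openin_empty] inner_vol_cylset[OF empty_cylsets] by (simp add: positive_def)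
  show "increasing (Pow \<Omega>) outer_vol" by (auto simp: increasing_def intro: outer_vol_mono)
  show "countably_subadditive (Pow \<Omega>) outer_vol"
    unfolding countably_subadditive_def
  proof (intro allI impI)
    fix A :: "nat \<Rightarrow> ('k \<Rightarrow> bool) set" assume A: "range A \<subseteq> Pow \<Omega>"
    show "outer_vol (\<Union>i. A i) \<le> (\<Sum>i. outer_vol (A i))"
    proof (rule ennreal_le_epsilon)
      fix e :: real assume e: "0 < e"
      \<comment> \<open>The allowances \<open>e * (1/2)^Suc n\<close> sum to
        \<open>e\<close>.\<close>
      have "\<exists>U. openin T U \<and> A n \<subseteq> U \<and> inner_vol U \<le> outer_vol (A n) + ennreal (e * (1/2)^Suc n)" for n
      proof -
        have "outer_vol (A n) \<le> 1" using A by (intro outer_vol_le_1) auto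
        then have "outer_vol (A n) \<noteq> \<infinity>" by (auto simp: top_unique)
        moreover have "0 < e * (1/2)^Suc n" using e by simp
        ultimately have "\<exists>U\<in>{U. openin T U \<and> A n \<subseteq> U}. inner_vol U < outer_vol (A n) + ennreal (e * (1/2)^Suc n)"
          by (intro INF_approx_ennreal[OF _ outer_vol_def])
        then show ?thesis by (auto intro: less_imp_le)
      qed
      then have "\<forall>n. \<exists>U. openin T U \<and> A n \<subseteq> U \<and> inner_vol U \<le> outer_vol (A n) + ennreal (e * (1/2)^Suc n)" by (rule allI)
      from choice[OF this] obtain U where "\<forall>n. openin T (U n) \<and> A n \<subseteq> U n \<and> inner_vol (U n) \<le> outer_vol (A n) + ennreal (e * (1/2)^Suc n)" ..
      then have U: "openin T (U n)" "A n \<subseteq> U n" "inner_vol (U n) \<le> outer_vol (A n) + ennreal (e * (1/2)^Suc n)" for n by auto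
      have s: "(\<lambda>n. e * (1/2)^Suc n) sums (e * 1)" by (intro sums_mult power_half_series)
      have "outer_vol (\<Union>i. A i) \<le> inner_vol (\<Union>i. U i)"
        using U(1,2) by (intro outer_vol_lower openin_Union) blast+
      also have "\<dots> \<le> (\<Sum>n. inner_vol (U n))" by (rule inner_vol_UN[OF U(1)])
      also have "\<dots> \<le> (\<Sum>n. outer_vol (A n) + ennreal (e * (1/2)^Suc n))" by (intro suminf_le U(3)) auto
      also have "\<dots> = (\<Sum>n. outer_vol (A n)) + (\<Sum>n. ennreal (e * (1/2)^Suc n))" by (intro suminf_add[symmetric]) auto
      also have "(\<Sum>n. ennreal (e * (1/2)^Suc n)) = ennreal e"
      proof -
        have "0 \<le> e * (1/2)^Suc n" for n using e by simp
        from suminf_ennreal2[OF this sums_summable[OF s]] show ?thesis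
          by (simp only: sums_unique[OF s, symmetric] mult_1_right)
      qed
      finally show "outer_vol (\<Union>i. A i) \<le> (\<Sum>i. outer_vol (A i)) + ennreal e" .
    qed
  qed
qed

lemma outer_vol_Un_le:
  assumes "A \<subseteq> \<Omega>" "B \<subseteq> \<Omega>" shows "outer_vol (A \<union> B) \<le> outer_vol A + outer_vol B"
proof -
  have "Measure_Space.subadditive (Pow \<Omega>) outer_vol"
    using outer_measure_space_outer unfolding outer_measure_space_def
    by (auto intro: ring_of_sets.countably_subadditive_subadditive ring_of_sets_Pow)
  \<comment> \<open>Finite subadditivity is stated for disjoint sets, hence
    \<open>B - A\<close>.\<close>
  from subadditiveD[OF this, of A "B - A"] have "outer_vol (A \<union> B) \<le> outer_vol A + outer_vol (B - A)"
    using assms by (auto simp: Un_Diff_cancel)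
  also have "\<dots> \<le> outer_vol A + outer_vol B" by (intro add_left_mono outer_vol_mono) auto
  finally show ?thesis .
qed

text \<open>It is enough to test open sets \<open>V\<close>. A cylinder set \<open>D\<close> in
  \<open>U \<inter> V\<close> and a cylinder set \<open>D'\<close> in \<open>V - D\<close> are
  disjoint and lie in \<open>V\<close>; the suprema over \<open>D'\<close> and then over
  \<open>D\<close> give the nontrivial inequality.\<close>

lemma open_in_lambda_system:
  assumes U: "openin T U" shows "U \<in> lambda_system \<Omega> (Pow \<Omega>) outer_vol"
proof -
  have US: "U \<subseteq> \<Omega>" using openin_subset[OF U] by (simp add: topspace_T)
  have "outer_vol (U \<inter> X) + outer_vol ((\<Omega> - U) \<inter> X) = outer_vol X" if X: "X \<subseteq> \<Omega>" for X
  proof (rule antisym)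
    show "outer_vol X \<le> outer_vol (U \<inter> X) + outer_vol ((\<Omega> - U) \<inter> X)"
    proof -
      have "outer_vol X \<le> outer_vol ((U \<inter> X) \<union> ((\<Omega> - U) \<inter> X))" by (rule outer_vol_mono) (use X in auto)
      also have "\<dots> \<le> outer_vol (U \<inter> X) + outer_vol ((\<Omega> - U) \<inter> X)" by (rule outer_vol_Un_le) (use US in auto)
      finally show ?thesis .
    qed
    show "outer_vol (U \<inter> X) + outer_vol ((\<Omega> - U) \<inter> X) \<le> outer_vol X"
    proof (rule outer_vol_greatest)
      fix V assume V: "openin T V" "X \<subseteq> V"
      have "inner_vol (U \<inter> V) + outer_vol (V - U) = (SUP D\<in>{D\<in>cylsets. D \<subseteq> U \<inter> V}. emeasure coin D + outer_vol (V - U))"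
        unfolding inner_vol_def using empty_cylsets by (intro ennreal_SUP_add_left[symmetric]) auto
      also have "\<dots> \<le> inner_vol V"
      proof (rule SUP_least, elim CollectE conjE)
        fix D assume D: "D \<in> cylsets" "D \<subseteq> U \<inter> V"
        have VD: "openin T (V - D)"
          using V(1) closedin_def[of T D] openin_cylsets[OF cylsets_ops(3)[OF space_cylsets D(1)]] cylsets_subset[OF D(1)]
          by (intro openin_diff) (auto simp: topspace_T)
        have "emeasure coin D + outer_vol (V - U) \<le> emeasure coin D + inner_vol (V - D)"
          using D(2) by (intro add_left_mono outer_vol_lower VD) auto
        also have "\<dots> = (SUP D'\<in>{D'\<in>cylsets. D' \<subseteq> V - D}. emeasure coin D + emeasure coin D')"
          unfolding inner_vol_def using empty_cylsets by (intro ennreal_SUP_add_right) auto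
        also have "\<dots> \<le> inner_vol V"
        proof (rule SUP_least, elim CollectE conjE)
          fix D' assume D': "D' \<in> cylsets" "D' \<subseteq> V - D"
          have "emeasure coin D + emeasure coin D' = emeasure coin (D \<union> D')"
            using D' D by (intro plus_emeasure cylsets_coin) auto
          also have "\<dots> \<le> inner_vol V" using D' D by (intro inner_vol_upper cylsets_ops) auto
          finally show "emeasure coin D + emeasure coin D' \<le> inner_vol V" .
        qed
        finally show "emeasure coin D + outer_vol (V - U) \<le> inner_vol V" .
      qed
      finally have *: "inner_vol (U \<inter> V) + outer_vol (V - U) \<le> inner_vol V" .
      have "outer_vol (U \<inter> X) + outer_vol ((\<Omega> - U) \<inter> X) \<le> inner_vol (U \<inter> V) + outer_vol (V - U)"
        using V by (intro add_mono outer_vol_lower outer_vol_mono openin_Int U) auto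
      then show "outer_vol (U \<inter> X) + outer_vol ((\<Omega> - U) \<inter> X) \<le> inner_vol V" using * by (rule order_trans)
    qed
  qed
  then show ?thesis using US by (auto simp: lambda_system_def)
qed

section \<open>The Radon product measure: existence, regularity, uniqueness\<close>

definition radon :: "('k \<Rightarrow> bool) measure" where
  "radon = measure_of \<Omega> {U. openin T U} outer_vol"

lemma sets_radon: "sets radon = sigma_sets \<Omega> {U. openin T U}" and space_radon: "space radon = \<Omega>"
  using openin_subset[of T] by (auto simp: radon_def topspace_T intro!: sets_measure_of space_measure_of)

text \<open>By Caratheodory's theorem \<open>outer_vol\<close> is a measure on the sets that split
  every set additively; open sets are among these, hence all Borel sets.\<close>

lemma emeasure_radon:
  assumes "A \<in> sets radon" shows "emeasure radon A = outer_vol A"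
proof (rule emeasure_measure_of[OF radon_def _ _ _ assms])
  have ms: "measure_space \<Omega> (lambda_system \<Omega> (Pow \<Omega>) outer_vol) outer_vol"
    by (rule sigma_algebra.caratheodory_lemma[OF sigma_algebra_Pow outer_measure_space_outer])
  then have sa: "sigma_algebra \<Omega> (lambda_system \<Omega> (Pow \<Omega>) outer_vol)"
    and ca: "countably_additive (lambda_system \<Omega> (Pow \<Omega>) outer_vol) outer_vol"
    and po: "positive (lambda_system \<Omega> (Pow \<Omega>) outer_vol) outer_vol"
    by (auto simp: measure_space_def)
  have sub: "sets radon \<subseteq> lambda_system \<Omega> (Pow \<Omega>) outer_vol"
    unfolding sets_radon using open_in_lambda_system by (intro sigma_algebra.sigma_sets_subset[OF sa]) auto
  show "{U. openin T U} \<subseteq> Pow \<Omega>" using openin_subset[of T] by (auto simp: topspace_T)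
  show "positive (sets radon) outer_vol" using po by (simp add: positive_def)
  show "countably_additive (sets radon) outer_vol"
    using ca sub unfolding countably_additive_def by blast
qed

lemma open_sets_radon: "openin T U \<Longrightarrow> U \<in> sets radon"
  unfolding sets_radon by (rule sigma_sets.Basic) simp

lemma emeasure_radon_open: "openin T U \<Longrightarrow> emeasure radon U = inner_vol U"
  by (simp add: emeasure_radon open_sets_radon outer_vol_open)

lemma prob_space_radon: "prob_space radon"
  by (rule prob_spaceI) (simp add: space_radon emeasure_radon_open openin_cylsets[OF space_cylsets] inner_vol_space)

lemma radon_product: "is_radon_product K radon"
  unfolding is_radon_product_def
proof (intro conjI allI impI)
  interpret prob_space radon by (rule prob_space_radon)
  show "sets radon = sigma_sets (topspace T) {U. openin T U}" by (simp add: sets_radon topspace_T)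
  show "emeasure radon (space radon) = 1" by (rule emeasure_space_1)
  show "emeasure radon (Pi\<^sub>E K E) = ennreal ((1/2) ^ card {i \<in> K. E i \<noteq> UNIV})"
    if E: "(\<forall>i\<in>K. E i \<noteq> {}) \<and> finite {i\<in>K. E i \<noteq> UNIV}" for E
  proof -
    let ?F = "{i\<in>K. E i \<noteq> UNIV}"
    have F: "finite ?F" "?F \<subseteq> K" "\<And>i. i \<in> K - ?F \<Longrightarrow> E i = UNIV" using E by auto
    have "card (E i) = 1" if "i \<in> ?F" for i
    proof -
      have "E i \<noteq> {}" "E i \<noteq> UNIV" using E that by auto
      then have "card (E i) < card (UNIV :: bool set)" "0 < card (E i)"
        using psubset_card_mono[of UNIV "E i"] by (auto simp: card_gt_0_iff psubset_eq)
      then show ?thesis by simp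
    qed
    then have "(\<Prod>i\<in>?F. ennreal (card (E i) / 2)) = (\<Prod>i\<in>?F. ennreal (1/2))"
      by (intro prod.cong refl) simp
    moreover have "emeasure coin (Pi\<^sub>E K E) = (\<Prod>i\<in>?F. ennreal (card (E i) / 2))"
      by (rule PiE_coin(2)[OF F(1,2)]) blast
    ultimately have "emeasure coin (Pi\<^sub>E K E) = (\<Prod>i\<in>?F. ennreal (1/2))" by simp
    also have "\<dots> = ennreal ((1/2) ^ card ?F)" by (simp only: prod_constant ennreal_power)
    finally have 1: "emeasure coin (Pi\<^sub>E K E) = ennreal ((1/2) ^ card ?F)" .
    have "Pi\<^sub>E K E = cylset ?F (Pi\<^sub>E ?F E)" by (rule PiE_eq_cylset[OF F(2)]) blast
    then have "Pi\<^sub>E K E \<in> cylsets" using cylsetsI[OF F(1,2)] by simp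
    then show ?thesis using 1 by (simp add: emeasure_radon_open openin_cylsets inner_vol_cylset)
  qed
  show "regular_on T radon"
    unfolding regular_on_def
  proof (intro ballI conjI)
    fix B assume B: "B \<in> sets radon"
    have BS: "B \<subseteq> \<Omega>" using sets.sets_into_space[OF B] by (simp add: space_radon)
    have "(INF U\<in>{U. openin T U \<and> B \<subseteq> U}. emeasure radon U) = (INF U\<in>{U. openin T U \<and> B \<subseteq> U}. inner_vol U)"
      by (rule INF_cong) (auto simp: emeasure_radon_open)
    then show "emeasure radon B = (INF U\<in>{U. openin T U \<and> B \<subseteq> U}. emeasure radon U)"
      by (simp add: emeasure_radon[OF B] outer_vol_def)
    have compact_sets: "C \<in> sets radon" if "compactin T C" "closedin T C" for C
      using sets.Diff[OF sets.top open_sets_radon, of "\<Omega> - C"] that(2)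
      by (simp add: closedin_def topspace_T space_radon double_diff)
    \<comment> \<open>Inner regularity is outer regularity of the complement: if \<open>U\<close> is
      open, contains the complement of \<open>B\<close> and is close to it in measure, then the
      complement of \<open>U\<close> is a compact subset of \<open>B\<close>, by compactness of the
      cube.\<close>
    show "emeasure radon B = (SUP C\<in>{C. compactin T C \<and> C \<subseteq> B}. emeasure radon C)"
    proof (rule antisym)
      show "(SUP C\<in>{C. compactin T C \<and> C \<subseteq> B}. emeasure radon C) \<le> emeasure radon B"
        by (rule SUP_least) (auto intro: emeasure_mono B)
      show "emeasure radon B \<le> (SUP C\<in>{C. compactin T C \<and> C \<subseteq> B}. emeasure radon C)"
      proof (rule ennreal_le_epsilon)
        fix e :: real assume e: "0 < e"
        let ?B = "\<Omega> - B"
        have Bc: "?B \<in> sets radon" using sets.compl_sets[OF B] by (simp add: space_radon)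
        have "emeasure radon ?B \<noteq> \<infinity>" by simp
        then obtain U where U: "openin T U" "?B \<subseteq> U" "inner_vol U < emeasure radon ?B + ennreal e"
          using INF_approx_ennreal[OF e, of "outer_vol ?B" inner_vol "{U. openin T U \<and> ?B \<subseteq> U}"]
          by (auto simp: emeasure_radon[OF Bc] outer_vol_def)
        note Us = open_sets_radon[OF U(1)]
        have USp: "U \<subseteq> \<Omega>" using openin_subset[OF U(1)] by (simp add: topspace_T)
        let ?C = "\<Omega> - U"
        have cl: "closedin T ?C" using U(1) USp by (simp add: closedin_def topspace_T double_diff)
        then have co: "compactin T ?C" by (rule closedin_compact_space[OF compact_T])
        have CB: "?C \<subseteq> B" using U(2) BS by auto
        have "emeasure radon U = emeasure radon ?B + emeasure radon (U - ?B)"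
          using U(2) plus_emeasure[OF Bc sets.Diff[OF Us Bc]] by (simp add: Un_absorb1)
        then have "emeasure radon ?B + emeasure radon (U - ?B) \<le> emeasure radon ?B + ennreal e"
          using U(3) by (simp add: emeasure_radon_open[OF U(1)] less_imp_le)
        then have le: "emeasure radon (U - ?B) \<le> ennreal e"
          by (subst (asm) ennreal_add_left_cancel_le) simp
        have "emeasure radon B \<le> emeasure radon (?C \<union> (U - ?B))"
          using BS USp by (intro emeasure_mono sets.Un compact_sets co cl sets.Diff Us Bc) auto
        also have "\<dots> \<le> emeasure radon ?C + emeasure radon (U - ?B)"
          by (rule emeasure_subadditive) (intro compact_sets co cl sets.Diff Us Bc)+
        also have "\<dots> \<le> (SUP C\<in>{C. compactin T C \<and> C \<subseteq> B}. emeasure radon C) + ennreal e"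
          using co CB by (intro add_mono le SUP_upper) auto
        finally show "emeasure radon B \<le> (SUP C\<in>{C. compactin T C \<and> C \<subseteq> B}. emeasure radon C) + ennreal e" .
      qed
    qed
  qed
qed

lemma radonD:
  assumes "is_radon_product K \<nu>"
  shows "sets \<nu> = sets radon"
    and "A \<in> sets \<nu> \<Longrightarrow> emeasure \<nu> A = (INF U\<in>{U. openin T U \<and> A \<subseteq> U}. emeasure \<nu> U)"
    and "A \<in> sets \<nu> \<Longrightarrow> emeasure \<nu> A = (SUP C\<in>{C. compactin T C \<and> C \<subseteq> A}. emeasure \<nu> C)"
proof -
  show "sets \<nu> = sets radon" using assms by (simp add: is_radon_product_def sets_radon topspace_T)
  have "regular_on T \<nu>" using assms unfolding is_radon_product_def by blast
  then show "A \<in> sets \<nu> \<Longrightarrow> emeasure \<nu> A = (INF U\<in>{U. openin T U \<and> A \<subseteq> U}. emeasure \<nu> U)"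
    and "A \<in> sets \<nu> \<Longrightarrow> emeasure \<nu> A = (SUP C\<in>{C. compactin T C \<and> C \<subseteq> A}. emeasure \<nu> C)"
    unfolding regular_on_def by blast+
qed

text \<open>The definition fixes the mass of a single atom, and a cylinder set over \<open>F\<close>
  is a disjoint union of finitely many atoms.\<close>

lemma radon_cylset:
  assumes \<mu>: "is_radon_product K \<mu>" and F: "finite F" "F \<subseteq> K"
  shows "emeasure \<mu> (cylset F S) = (\<Sum>s\<in>S \<inter> cube F. ennreal ((1/2) ^ card F))"
proof -
  have sm: "sets \<mu> = sets radon" using \<mu> by (simp add: is_radon_product_def sets_radon topspace_T)
  have atom: "emeasure \<mu> (Pi\<^sub>E K (atom F s)) = ennreal ((1/2) ^ card F)" for s
  proof -
    have "{i\<in>K. atom F s i \<noteq> UNIV} = F" using F(2) by (auto simp: atom_def UNIV_bool)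
    moreover have "\<forall>i\<in>K. atom F s i \<noteq> {}" by (simp add: atom_def)
    ultimately show ?thesis using \<mu> F(1) by (simp add: is_radon_product_def)
  qed
  have ms: "Pi\<^sub>E K (atom F s) \<in> sets \<mu>" for s
  proof -
    have "Pi\<^sub>E K (atom F s) = cylset F (Pi\<^sub>E F (atom F s))" by (rule PiE_eq_cylset[OF F(2)]) (simp add: atom_def)
    then show ?thesis unfolding sm using open_sets_radon[OF openin_cylset[OF F]] by simp
  qed
  have "emeasure \<mu> (cylset F S) = (\<Sum>s\<in>S \<inter> cube F. emeasure \<mu> (Pi\<^sub>E K (atom F s)))"
    unfolding cylset_UN[OF F(2)]
    by (rule sum_emeasure[symmetric]) (use ms disjoint_atoms[OF F(2)] finite_cube[OF F(1)] in auto)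
  then show ?thesis by (simp add: atom)
qed

text \<open>Agreement spreads from cylinder sets to open sets, by inner regularity and a cylinder
  set between compact and open, and from open sets to Borel sets by outer regularity.\<close>

lemma radon_unique:
  assumes \<mu>: "is_radon_product K \<mu>" shows "\<mu> = radon"
proof (rule measure_eqI)
  show sm: "sets \<mu> = sets radon" using \<mu> by (simp add: is_radon_product_def sets_radon topspace_T)
  have cyl: "emeasure \<mu> D = emeasure radon D" if "D \<in> cylsets" for D
    using that by (elim cylsetsE) (simp add: radon_cylset[OF \<mu>] radon_cylset[OF radon_product])
  have reg: "emeasure \<nu> U = (SUP D\<in>{D\<in>cylsets. D \<subseteq> U}. emeasure \<nu> D)"
    if \<nu>: "is_radon_product K \<nu>" and U: "openin T U" for U \<nu>
  proof (rule antisym)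
    have sn: "sets \<nu> = sets radon" using \<nu> by (simp add: is_radon_product_def sets_radon topspace_T)
    have Us: "U \<in> sets \<nu>" using open_sets_radon[OF U] sn by simp
    show "(SUP D\<in>{D\<in>cylsets. D \<subseteq> U}. emeasure \<nu> D) \<le> emeasure \<nu> U"
      using Us by (intro SUP_least emeasure_mono) auto
    have "emeasure \<nu> U = (SUP C\<in>{C. compactin T C \<and> C \<subseteq> U}. emeasure \<nu> C)"
      by (rule radonD(3)[OF \<nu> Us])
    also have "\<dots> \<le> (SUP D\<in>{D\<in>cylsets. D \<subseteq> U}. emeasure \<nu> D)"
    proof (rule SUP_least, elim CollectE conjE)
      fix C assume C: "compactin T C" "C \<subseteq> U"
      obtain D where D: "D \<in> cylsets" "C \<subseteq> D" "D \<subseteq> U" using cylset_between[OF C(1) U C(2)] by blast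
      have "emeasure \<nu> C \<le> emeasure \<nu> D"
        by (rule emeasure_mono[OF D(2)]) (simp add: sn open_sets_radon openin_cylsets D(1))
      also have "\<dots> \<le> (SUP D\<in>{D\<in>cylsets. D \<subseteq> U}. emeasure \<nu> D)" using D by (intro SUP_upper) auto
      finally show "emeasure \<nu> C \<le> (SUP D\<in>{D\<in>cylsets. D \<subseteq> U}. emeasure \<nu> D)" .
    qed
    finally show "emeasure \<nu> U \<le> (SUP D\<in>{D\<in>cylsets. D \<subseteq> U}. emeasure \<nu> D)" .
  qed
  have op: "emeasure \<mu> U = emeasure radon U" if "openin T U" for U
    unfolding reg[OF \<mu> that] reg[OF radon_product that] by (rule SUP_cong) (auto simp: cyl)
  fix A assume A: "A \<in> sets \<mu>"
  then have "emeasure \<mu> A = (INF U\<in>{U. openin T U \<and> A \<subseteq> U}. emeasure \<mu> U)"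
    by (rule radonD(2)[OF \<mu>])
  also have "\<dots> = (INF U\<in>{U. openin T U \<and> A \<subseteq> U}. emeasure radon U)"
    by (rule INF_cong) (auto simp: op)
  also have "\<dots> = emeasure radon A"
    using A sm by (intro radonD(2)[OF radon_product, symmetric]) simp
  finally show "emeasure \<mu> A = emeasure radon A" .
qed

lemma product_measure_eq: "product_measure K = completion radon"
proof -
  have "(THE \<mu>. is_radon_product K \<mu>) = radon"
    by (rule the_equality) (rule radon_product, rule radon_unique)
  then show ?thesis by (simp add: product_measure_def)
qed

section \<open>Cylinder functions\<close>

abbreviation "N \<equiv> completion radon"

lemma prob_space_N: "prob_space N"
  using prob_space.emeasure_space_1[OF prob_space_radon] by (intro prob_spaceI) simp

sublocale nu: prob_space N by (rule prob_space_N)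

lemma cube_nonempty: "\<Omega> \<noteq> {}"
  using nu.not_empty by (simp add: space_radon)

definition cyl :: "'k set \<Rightarrow> (('k \<Rightarrow> bool) \<Rightarrow> complex) \<Rightarrow> ('k \<Rightarrow> bool) \<Rightarrow> complex" where
  "cyl F a = (\<lambda>\<omega>. a (restrict \<omega> F))"

text \<open>Agreement is asked for on the cube only. The values elsewhere stay arbitrary, so
  pointwise operations on total functions keep the set closed.\<close>

definition cylfuns :: "(('k \<Rightarrow> bool) \<Rightarrow> complex) set" where
  "cylfuns = {f. \<exists>F\<in>fin_subsets K. \<exists>a\<in>carrier (fin_tensor F). \<forall>\<omega>\<in>\<Omega>. f \<omega> = cyl F a \<omega>}"

lemma carrier_fin_tensor: "carrier (fin_tensor F) = cube F \<rightarrow>\<^sub>E UNIV"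
  by (simp add: fin_tensor_def)

lemma cylfunsI:
  assumes "F \<in> fin_subsets K" "\<And>\<omega>. \<omega> \<in> \<Omega> \<Longrightarrow> f \<omega> = a (restrict \<omega> F)" shows "f \<in> cylfuns"
  unfolding cylfuns_def mem_Collect_eq
  by (intro bexI[of _ "restrict a (cube F)"] bexI[OF _ assms(1)] ballI)
    (simp_all add: cyl_def assms(2) restrict_cube carrier_fin_tensor)

lemma cylfunsD:
  "f \<in> cylfuns \<Longrightarrow> \<exists>F\<in>fin_subsets K. \<exists>a\<in>carrier (fin_tensor F). \<forall>\<omega>\<in>\<Omega>. f \<omega> = cyl F a \<omega>"
  by (simp add: cylfuns_def)

lemma cyl_in_cylfuns: "F \<in> fin_subsets K \<Longrightarrow> cyl F a \<in> cylfuns"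
  by (rule cylfunsI) (auto simp: cyl_def)

lemma fin_subsets_Un: "F \<in> fin_subsets K \<Longrightarrow> G \<in> fin_subsets K \<Longrightarrow> F \<union> G \<in> fin_subsets K"
  by (auto simp: fin_subsets_def)

lemma empty_fin_subsets: "{} \<in> fin_subsets K"
  by (simp add: fin_subsets_def)

lemma restrict_restrict_subset: "F \<subseteq> G \<Longrightarrow> restrict (restrict \<omega> G) F = restrict \<omega> F"
  by (simp add: Int_absorb1)

lemma cylfuns_binop:
  assumes "f \<in> cylfuns" "g \<in> cylfuns" shows "(\<lambda>\<omega>. h (f \<omega>) (g \<omega>)) \<in> cylfuns"
proof -
  obtain F a where F: "F \<in> fin_subsets K" "\<forall>\<omega>\<in>\<Omega>. f \<omega> = cyl F a \<omega>" using cylfunsD[OF assms(1)] by blast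
  obtain G b where G: "G \<in> fin_subsets K" "\<forall>\<omega>\<in>\<Omega>. g \<omega> = cyl G b \<omega>" using cylfunsD[OF assms(2)] by blast
  show ?thesis
    by (rule cylfunsI[OF fin_subsets_Un[OF F(1) G(1)], where a = "\<lambda>s. h (a (restrict s F)) (b (restrict s G))"])
      (simp add: F(2) G(2) cyl_def restrict_restrict_subset del: restrict_restrict)
qed

lemma cylfuns_unop: "f \<in> cylfuns \<Longrightarrow> (\<lambda>\<omega>. h (f \<omega>)) \<in> cylfuns"
  using cylfuns_binop[of f f "\<lambda>x _. h x"] .

lemma cylfuns_const: "(\<lambda>\<omega>. c) \<in> cylfuns"
  by (rule cylfunsI[OF empty_fin_subsets]) simp

lemma indicator_cylfuns: "D \<in> cylsets \<Longrightarrow> indicator D \<in> cylfuns"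
  by (elim cylsetsE) (rule cylfunsI[where a = "indicator _"], auto simp: fin_subsets_def cylset_def indicator_def)

lemma cylfuns_measurable: "f \<in> cylfuns \<Longrightarrow> f \<in> borel_measurable N"
proof (rule measurable_completion, rule measurableI)
  fix B :: "complex set" assume f: "f \<in> cylfuns"
  obtain F a where F: "F \<in> fin_subsets K" "\<forall>\<omega>\<in>\<Omega>. f \<omega> = cyl F a \<omega>" using cylfunsD[OF f] by blast
  have "f -` B \<inter> space radon = cylset F (a -` B)"
    using F(2) by (auto simp: space_radon cylset_def cyl_def)
  then show "f -` B \<inter> space radon \<in> sets radon"
    using F(1) by (simp add: open_sets_radon openin_cylset fin_subsets_def)
qed simp

lemma cylfuns_bounded:
  assumes "f \<in> cylfuns" shows "bounded (f ` \<Omega>)"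
proof -
  obtain F a where F: "F \<in> fin_subsets K" "\<forall>\<omega>\<in>\<Omega>. f \<omega> = cyl F a \<omega>" using cylfunsD[OF assms] by blast
  have "f ` \<Omega> \<subseteq> a ` cube F" using F(2) by (auto simp: cyl_def restrict_cube)
  moreover have "finite (a ` cube F)" using F(1) by (intro finite_imageI finite_cube) (simp add: fin_subsets_def)
  ultimately show ?thesis by (rule finite_imp_bounded[OF finite_subset])
qed

lemma bounded_ess_bounded:
  assumes "f \<in> borel_measurable N" "bounded (f ` \<Omega>)" shows "f \<in> ess_bounded N"
proof -
  obtain C where C: "\<forall>x\<in>f ` \<Omega>. cmod x \<le> C" using assms(2) by (auto simp: bounded_iff)
  show ?thesis
    by (rule ess_boundedI[OF assms(1), of C], rule AE_I2) (use C in \<open>simp add: space_radon\<close>)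
qed

lemma cylfuns_ess_bounded: "f \<in> cylfuns \<Longrightarrow> f \<in> ess_bounded N"
  by (intro bounded_ess_bounded cylfuns_measurable cylfuns_bounded)

text \<open>An open set \<open>U\<close> around \<open>B\<close> comes from outer regularity, and a
  cylinder set \<open>D\<close> inside \<open>U\<close> from the definition of
  \<open>inner_vol\<close>; both miss little of \<open>U\<close>, which makes them close to each
  other.\<close>

lemma cylset_approx:
  assumes B: "B \<in> sets radon" and e: "0 < e"
  shows "\<exists>D\<in>cylsets. \<exists>U\<in>sets radon. B \<subseteq> U \<and> D \<subseteq> U \<and> measure radon (U - B) \<le> e \<and> measure radon (U - D) \<le> e"
proof -
  interpret R: prob_space radon by (rule prob_space_radon)
  have "outer_vol B \<noteq> \<infinity>" unfolding emeasure_radon[OF B, symmetric] by simp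
  then obtain U where U: "openin T U" "B \<subseteq> U" "inner_vol U < outer_vol B + ennreal e"
    using INF_approx_ennreal[OF e outer_vol_def] by blast
  note Us = open_sets_radon[OF U(1)]
  \<comment> \<open>If every cylinder set in \<open>U\<close> fell short by more than
    \<open>e\<close>, their supremum would fall short as well; but it is the measure of
    \<open>U\<close>, which is finite.\<close>
  have "\<exists>D\<in>cylsets. D \<subseteq> U \<and> emeasure radon U \<le> emeasure radon D + ennreal e"
  proof (rule ccontr)
    assume n: "\<not> (\<exists>D\<in>cylsets. D \<subseteq> U \<and> emeasure radon U \<le> emeasure radon D + ennreal e)"
    have "inner_vol U + ennreal e = (SUP D\<in>{D\<in>cylsets. D \<subseteq> U}. emeasure coin D + ennreal e)"
      unfolding inner_vol_def using empty_cylsets by (intro ennreal_SUP_add_left[symmetric]) auto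
    also have "\<dots> \<le> inner_vol U"
      using n by (intro SUP_least) (auto simp: emeasure_radon_open openin_cylsets inner_vol_cylset U(1) not_le intro: less_imp_le)
    finally have "emeasure radon U + ennreal e \<le> emeasure radon U + 0" by (simp add: emeasure_radon_open[OF U(1)])
    then have "ennreal e \<le> 0" by (subst (asm) ennreal_add_left_cancel_le) simp
    then show False using e by (simp add: ennreal_eq_0_iff)
  qed
  then obtain D where D: "D \<in> cylsets" "D \<subseteq> U" "emeasure radon U \<le> emeasure radon D + ennreal e" by blast
  have Ds: "D \<in> sets radon" by (rule open_sets_radon[OF openin_cylsets[OF D(1)]])
  have d: "measure radon (U - A) \<le> e" if "A \<in> sets radon" "A \<subseteq> U" "emeasure radon U \<le> emeasure radon A + ennreal e" for A
  proof -
    have "measure radon U \<le> measure radon A + e"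
      using that(3) e by (simp add: R.emeasure_eq_measure ennreal_plus[symmetric] del: ennreal_plus)
    then show ?thesis using R.finite_measure_Diff[OF Us that(1,2)] by simp
  qed
  have "measure radon (U - B) \<le> e"
    using U(3) by (intro d[OF B U(2)]) (simp add: emeasure_radon[OF B] emeasure_radon_open[OF U(1)] less_imp_le)
  then show ?thesis using d[OF Ds D(2,3)] D U Us by blast
qed

lemma indicator_approx:
  assumes A: "A \<in> sets N" and e: "0 < e"
  shows "\<exists>c\<in>cylfuns. l2n N (\<lambda>w. c w - indicator A w) < e"
proof -
  \<comment> \<open>A set of the completion is replaced by a Borel set that differs from it by a
    null set.\<close>
  define B where "B = main_part radon A"
  have B: "B \<in> sets radon" using A by (simp add: B_def)
  have AB: "AE w in N. (indicator A w :: complex) = indicator B w"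
  proof -
    have "AE w in radon. w \<in> B \<longleftrightarrow> w \<in> A" unfolding B_def by (rule AE_in_main_part[OF A])
    then have "AE w in N. w \<in> B \<longleftrightarrow> w \<in> A" by (rule AE_completion)
    then show ?thesis by eventually_elim (simp add: indicator_def)
  qed
  \<comment> \<open>The squared distance will be at most \<open>2 * d = e\<^sup>2 / 2\<close>, which
    is below \<open>e\<^sup>2\<close>.\<close>
  define d where "d = (e / 2)\<^sup>2"
  have d: "0 < d" using e by (simp add: d_def)
  obtain D U where D: "D \<in> cylsets" and U: "U \<in> sets radon" "B \<subseteq> U" "D \<subseteq> U"
    and m: "measure radon (U - B) \<le> d" "measure radon (U - D) \<le> d"
    using cylset_approx[OF B d] by blast
  have Ds: "D \<in> sets radon" by (rule open_sets_radon[OF openin_cylsets[OF D]])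
  note [measurable] = sets_completionI_sets[OF B] sets_completionI_sets[OF Ds] sets_completionI_sets[OF U(1)] A
  let ?c = "indicator D :: _ \<Rightarrow> complex"
  have "l2n N (\<lambda>w. ?c w - indicator A w) = l2n N (\<lambda>w. ?c w - indicator B w)"
    by (rule l2n_cong_AE) (use AB in eventually_elim, simp, measurable)
  moreover have "(l2n N (\<lambda>w. ?c w - indicator B w))\<^sup>2 \<le> (\<integral>w. indicator (U - B) w + indicator (U - D) w \<partial>N)"
    unfolding l2n_sq
  proof (rule integral_mono)
    have "sqint N (\<lambda>w. ?c w - indicator B w)"
      by (intro sqint_diff nu.sqint_ess_bounded ess_bounded_indicator sets_completionI_sets B Ds)
    then show "integrable N (\<lambda>w. (cmod (?c w - indicator B w))\<^sup>2)" by (rule sqint_integrable)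
    show "integrable N (\<lambda>w. indicator (U - B) w + indicator (U - D) w :: real)"
      by (intro Bochner_Integration.integrable_add integrable_real_indicator) (auto simp: nu.emeasure_eq_measure)
    show "(cmod (?c w - indicator B w))\<^sup>2 \<le> indicator (U - B) w + indicator (U - D) w" for w
      using U(2,3) by (auto simp: indicator_def)
  qed
  moreover have "(\<integral>w. indicator (U - B) w + indicator (U - D) w \<partial>N) = measure N (U - B) + measure N (U - D)"
  proof -
    have "(U - B) \<inter> space radon = U - B" "(U - D) \<inter> space radon = U - D"
      using sets.sets_into_space[OF U(1)] by auto
    then show ?thesis
      by (subst Bochner_Integration.integral_add) (auto simp: nu.emeasure_eq_measure intro!: integrable_real_indicator)
  qed
  moreover have "measure N (U - B) + measure N (U - D) \<le> 2 * d"
    using m U(1) B Ds by simp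
  moreover have "2 * d < e\<^sup>2" using e by (simp add: d_def power_divide)
  ultimately have "(l2n N (\<lambda>w. ?c w - indicator A w))\<^sup>2 < e\<^sup>2" by simp
  then have "l2n N (\<lambda>w. ?c w - indicator A w) < e" using e by (intro power2_less_imp_less[of _ e]) auto
  then show ?thesis using indicator_cylfuns[OF D] by blast
qed

lemma cylfuns_dense:
  assumes f: "sqint N f" and e: "0 < e"
  shows "\<exists>c\<in>cylfuns. l2n N (\<lambda>w. c w - f w) < e"
proof -
  let ?P = "\<lambda>f. sqint N f \<and> (\<forall>e>0. \<exists>c\<in>cylfuns. l2n N (\<lambda>w. c w - f w) < e)"
  have cs: "sqint N c" if "c \<in> cylfuns" for c by (rule nu.sqint_ess_bounded[OF cylfuns_ess_bounded[OF that]])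
  have "?P f"
  proof (rule complex_measurable_induct[OF sqint_measurable[OF f], where P = ?P])
    fix A assume "A \<in> sets N"
    then show "?P (indicator A)" using indicator_approx nu.sqint_ess_bounded[OF ess_bounded_indicator] by blast
  next
    fix c u assume u: "?P u"
    show "?P (\<lambda>w. c * u w)"
    proof (intro conjI allI impI)
      show "sqint N (\<lambda>w. c * u w)" using u by (intro sqint_smult) simp
      fix e :: real assume "0 < e"
      \<comment> \<open>The summand 1 keeps the denominator positive when
        \<open>c = 0\<close>.\<close>
      then have "0 < e / (cmod c + 1)" by (intro divide_pos_pos) (auto intro: add_nonneg_pos)
      then obtain v where v: "v \<in> cylfuns" "l2n N (\<lambda>w. v w - u w) < e / (cmod c + 1)" using u by blast
      have "l2n N (\<lambda>w. c * v w - c * u w) = cmod c * l2n N (\<lambda>w. v w - u w)"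
        unfolding right_diff_distrib[symmetric] by (rule l2n_smult)
      also have "\<dots> \<le> (cmod c + 1) * l2n N (\<lambda>w. v w - u w)" by (intro mult_right_mono) auto
      also have "\<dots> < e" using v(2) by (simp add: pos_less_divide_eq add_nonneg_pos mult.commute)
      finally show "\<exists>v\<in>cylfuns. l2n N (\<lambda>w. v w - c * u w) < e" by (rule bexI[OF _ cylfuns_unop[OF v(1), of "\<lambda>z. c * z"]])
    qed
  next
    fix u v assume u: "?P u" and v: "?P v"
    show "?P (\<lambda>w. u w + v w)"
    proof (intro conjI allI impI)
      show "sqint N (\<lambda>w. u w + v w)" using u v by (intro sqint_add) auto
      fix e :: real assume "0 < e"
      then have "0 < e / 2" by simp
      then obtain c d where c: "c \<in> cylfuns" "l2n N (\<lambda>w. c w - u w) < e / 2" and d: "d \<in> cylfuns" "l2n N (\<lambda>w. d w - v w) < e / 2"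
        using u v by blast
      have "l2n N (\<lambda>w. (c w + d w) - (u w + v w)) \<le> l2n N (\<lambda>w. c w - u w) + l2n N (\<lambda>w. d w - v w)"
        unfolding add_diff_add by (rule l2n_triangle[OF sqint_diff[OF cs[OF c(1)]] sqint_diff[OF cs[OF d(1)]]]) (use u v in auto)
      then show "\<exists>c\<in>cylfuns. l2n N (\<lambda>w. c w - (u w + v w)) < e"
        using c(2) d(2) cylfuns_binop[OF c(1) d(1), of "(+)"] by (intro bexI[of _ "\<lambda>w. c w + d w"]) auto
    qed
  next
    fix u v assume u: "?P u" and eq: "\<And>w. w \<in> space N \<Longrightarrow> u w = v w" and v: "v \<in> borel_measurable N"
    have ae: "AE w in N. u w = v w" using eq by (rule AE_I2)
    show "?P v"
    proof (intro conjI allI impI)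
      show "sqint N v" using u ae v by (blast intro: sqint_cong_AE)
      fix e :: real assume "0 < e"
      then obtain c where c: "c \<in> cylfuns" "l2n N (\<lambda>w. c w - u w) < e" using u by blast
      have "l2n N (\<lambda>w. c w - u w) = l2n N (\<lambda>w. c w - v w)"
        unfolding l2n_def by (intro arg_cong[where f = sqrt] Bochner_Integration.integral_cong) (auto simp: eq)
      then show "\<exists>c\<in>cylfuns. l2n N (\<lambda>w. c w - v w) < e" using c by auto
    qed
  next
    fix s assume s: "\<And>n::nat. s n \<in> borel_measurable N" "\<And>n. ?P (s n)"
      and lim: "\<And>w. w \<in> space N \<Longrightarrow> (\<lambda>n. s n w) \<longlonglongrightarrow> f w"
      and dom: "\<And>n w. w \<in> space N \<Longrightarrow> cmod (s n w) \<le> 2 * cmod (f w)"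
    note fm = sqint_measurable[OF f]
    have "(\<lambda>n. \<integral>w. (cmod (s n w - f w))\<^sup>2 \<partial>N) \<longlonglongrightarrow> (\<integral>w. 0 \<partial>N)"
    \<comment> \<open>From \<open>dom\<close> the difference \<open>s n - f\<close> is bounded by 3
      |f|, and 9 is the square of 3.\<close>
    proof (rule integral_dominated_convergence[where w = "\<lambda>w. 9 * (cmod (f w))\<^sup>2"])
      show "integrable N (\<lambda>w. 9 * (cmod (f w))\<^sup>2)" using sqint_integrable[OF f] by simp
      show "AE w in N. (\<lambda>n. (cmod (s n w - f w))\<^sup>2) \<longlonglongrightarrow> 0"
      proof (rule AE_I2)
        fix w assume "w \<in> space N"
        then have "(\<lambda>n. (cmod (s n w - f w))\<^sup>2) \<longlonglongrightarrow> (cmod (f w - f w))\<^sup>2" by (intro tendsto_intros lim)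
        then show "(\<lambda>n. (cmod (s n w - f w))\<^sup>2) \<longlonglongrightarrow> 0" by simp
      qed
      show "AE w in N. norm ((cmod (s n w - f w))\<^sup>2) \<le> 9 * (cmod (f w))\<^sup>2" for n
      proof (rule AE_I2)
        fix w assume w: "w \<in> space N"
        have "cmod (s n w - f w) \<le> 3 * cmod (f w)"
          using norm_triangle_ineq4[of "s n w" "f w"] dom[OF w, of n] by linarith
        then have "(cmod (s n w - f w))\<^sup>2 \<le> (3 * cmod (f w))\<^sup>2" by (intro power_mono) auto
        then show "norm ((cmod (s n w - f w))\<^sup>2) \<le> 9 * (cmod (f w))\<^sup>2" by (simp add: power_mult_distrib)
      qed
    qed (use s(1) fm in measurable)
    then have "(\<lambda>n. sqrt (\<integral>w. (cmod (s n w - f w))\<^sup>2 \<partial>N)) \<longlonglongrightarrow> sqrt 0" by (intro tendsto_real_sqrt) simp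
    then have l: "(\<lambda>n. l2n N (\<lambda>w. s n w - f w)) \<longlonglongrightarrow> 0" by (simp add: l2n_def)
    show "?P f"
    proof (intro conjI allI impI f)
      fix e :: real assume "0 < e"
      then have e2: "0 < e / 2" by simp
      obtain n where n: "l2n N (\<lambda>w. s n w - f w) < e / 2"
        using LIMSEQ_D[OF l e2] by fastforce
      obtain c where c: "c \<in> cylfuns" "l2n N (\<lambda>w. c w - s n w) < e / 2" using s(2)[of n] e2 by blast
      have "l2n N (\<lambda>w. c w - f w) \<le> l2n N (\<lambda>w. c w - s n w) + l2n N (\<lambda>w. s n w - f w)"
        using s(2)[of n] by (intro l2n_triangle_diff[OF cs[OF c(1)] _ f]) simp
      then show "\<exists>c\<in>cylfuns. l2n N (\<lambda>w. c w - f w) < e" using c n by (intro bexI[of _ c]) auto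
    qed
  qed
  then show ?thesis using e by blast
qed

text \<open>A cylinder function takes the value \<open>a s\<close> on the set of points that
  restrict to \<open>s\<close>, and each of these sets has mass
  \<open>(1/2) ^ card F\<close>.\<close>

lemma integral_cyl:
  assumes F: "F \<in> fin_subsets K"
  shows "(\<integral>w. cyl F a w \<partial>N) = (\<Sum>s\<in>cube F. a s) / 2 ^ card F"
proof -
  have Ff: "finite F" "F \<subseteq> K" using F by (auto simp: fin_subsets_def)
  note fc = finite_cube[OF Ff(1)]
  have ms: "cylset F {s} \<in> sets radon" for s by (rule open_sets_radon[OF openin_cylset[OF Ff]])
  have m: "measure N (cylset F {s}) = (1/2) ^ card F" if "s \<in> cube F" for s
  proof -
    have "emeasure radon (cylset F {s}) = ennreal ((1/2) ^ card F)"
      using radon_cylset[OF radon_product Ff, of "{s}"] that by simp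
    then show ?thesis using ms by (simp add: measure_def)
  qed
  have "cyl F a w = (\<Sum>s\<in>cube F. a s * indicator (cylset F {s}) w)" if "w \<in> space N" for w
  proof -
    have w: "w \<in> \<Omega>" using that by (simp add: space_radon)
    have "(\<Sum>s\<in>cube F. a s * indicator (cylset F {s}) w) = (\<Sum>s\<in>cube F. if restrict w F = s then a s else 0)"
      using w by (intro sum.cong refl) (auto simp: cylset_def indicator_def)
    then show ?thesis using fc restrict_cube[OF w, of F] by (simp add: cyl_def)
  qed
  then have "(\<integral>w. cyl F a w \<partial>N) = (\<integral>w. (\<Sum>s\<in>cube F. a s * indicator (cylset F {s}) w) \<partial>N)"
    by (intro Bochner_Integration.integral_cong) auto
  also have "\<dots> = (\<Sum>s\<in>cube F. \<integral>w. a s * indicator (cylset F {s}) w \<partial>N)"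
    by (intro Bochner_Integration.integral_sum nu.ess_bounded_integrable ess_bounded_smult ess_bounded_indicator sets_completionI_sets ms)
  also have "\<dots> = (\<Sum>s\<in>cube F. a s * (1/2) ^ card F)"
  proof (intro sum.cong refl)
    fix s assume s: "s \<in> cube F"
    have "(\<integral>w. indicator (cylset F {s}) w \<partial>N) = complex_of_real (measure N (cylset F {s}))"
    proof -
      have "(indicator (cylset F {s}) :: _ \<Rightarrow> complex) = (\<lambda>w. complex_of_real (indicator (cylset F {s}) w))"
        by (auto simp: indicator_def)
      then show ?thesis
        using sets_completionI_sets[OF ms[of s]] sets.sets_into_space[OF ms[of s]]
        by (simp only: integral_complex_of_real) (simp add: Int_absorb2)
    qed
    then show "(\<integral>w. a s * indicator (cylset F {s}) w \<partial>N) = a s * (1/2) ^ card F"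
      using m[OF s] by simp
  qed
  finally show ?thesis by (simp add: power_one_over sum_divide_distrib)
qed

section \<open>The C*-inductive limit\<close>

abbreviation "LC \<equiv> limit_class (fin_subsets K) fin_tensor tensor_one"
abbreviation "\<B> \<equiv> algebraic_limit (fin_subsets K) fin_tensor tensor_one"

text \<open>A class of the inductive limit consists of all presentations, at any finite level, of
  one function on the cube.\<close>

definition fcl :: "(('k \<Rightarrow> bool) \<Rightarrow> complex) \<Rightarrow> ('k set \<times> (('k \<Rightarrow> bool) \<Rightarrow> complex)) set" where
  "fcl f = {(G, b). G \<in> fin_subsets K \<and> b \<in> carrier (fin_tensor G) \<and> (\<forall>\<omega>\<in>\<Omega>. f \<omega> = cyl G b \<omega>)}"

text \<open>A point of \<open>cube H\<close> already has the value \<open>undefined\<close> at every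
  index outside \<open>H\<close>. On \<open>K - H\<close> this is some Boolean, so restriction to
  \<open>K\<close> yields a point of the whole cube that extends it.\<close>

lemma extend_cube:
  assumes "H \<subseteq> K" "s \<in> cube H" shows "restrict s K \<in> \<Omega>" "restrict (restrict s K) H = s"
proof -
  show "restrict s K \<in> \<Omega>" by (simp add: cube_def)
  have "restrict (restrict s K) H = restrict s H" by (rule restrict_restrict_subset[OF assms(1)])
  also have "\<dots> = s" using assms(2) by (intro extensional_restrict) (simp add: cube_def PiE_def)
  finally show "restrict (restrict s K) H = s" .
qed

lemma tensor_one_restrict:
  "F \<subseteq> H \<Longrightarrow> \<omega> \<in> \<Omega> \<Longrightarrow> tensor_one F H a (restrict \<omega> H) = cyl F a \<omega>"
  by (simp add: tensor_one_def restrict_cube restrict_restrict_subset cyl_def del: restrict_restrict)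

text \<open>Every point of \<open>cube H\<close> is the restriction of a point of the cube over
  \<open>K\<close>, so comparison at a finite level is the same as comparison of functions on the
  whole cube.\<close>

lemma tensor_one_eq_iff:
  assumes "F \<subseteq> H" "G \<subseteq> H" "H \<subseteq> K"
  shows "tensor_one F H a = tensor_one G H b \<longleftrightarrow> (\<forall>\<omega>\<in>\<Omega>. cyl F a \<omega> = cyl G b \<omega>)"
proof
  assume *: "tensor_one F H a = tensor_one G H b"
  show "\<forall>\<omega>\<in>\<Omega>. cyl F a \<omega> = cyl G b \<omega>"
  proof
    fix \<omega> assume \<omega>: "\<omega> \<in> \<Omega>"
    show "cyl F a \<omega> = cyl G b \<omega>"
      using fun_cong[OF *, of "restrict \<omega> H"] unfolding tensor_one_restrict[OF assms(1) \<omega>] tensor_one_restrict[OF assms(2) \<omega>] .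
  qed
next
  assume *: "\<forall>\<omega>\<in>\<Omega>. cyl F a \<omega> = cyl G b \<omega>"
  show "tensor_one F H a = tensor_one G H b"
  proof (rule extensionalityI)
    show "tensor_one F H a \<in> extensional (cube H)" "tensor_one G H b \<in> extensional (cube H)"
      by (simp_all add: tensor_one_def)
    fix s assume s: "s \<in> cube H"
    note e = extend_cube[OF assms(3) s]
    show "tensor_one F H a s = tensor_one G H b s"
      using tensor_one_restrict[OF assms(1) e(1), of a] tensor_one_restrict[OF assms(2) e(1), of b] bspec[OF * e(1)]
      unfolding e(2) by simp
  qed
qed

lemma limit_class_eq:
  assumes F: "F \<in> fin_subsets K" "a \<in> carrier (fin_tensor F)" and f: "\<forall>\<omega>\<in>\<Omega>. f \<omega> = cyl F a \<omega>"
  shows "LC (F, a) = fcl f"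
proof -
  have "(\<exists>H\<in>fin_subsets K. F \<le> H \<and> G \<le> H \<and> tensor_one F H a = tensor_one G H b) \<longleftrightarrow> (\<forall>\<omega>\<in>\<Omega>. f \<omega> = cyl G b \<omega>)"
    if G: "G \<in> fin_subsets K" for G b
  proof
    assume "\<exists>H\<in>fin_subsets K. F \<le> H \<and> G \<le> H \<and> tensor_one F H a = tensor_one G H b"
    then show "\<forall>\<omega>\<in>\<Omega>. f \<omega> = cyl G b \<omega>" using tensor_one_eq_iff[of F _ G a b] f by (auto simp: fin_subsets_def)
  next
    assume "\<forall>\<omega>\<in>\<Omega>. f \<omega> = cyl G b \<omega>"
    \<comment> \<open>Presentations over \<open>F\<close> and \<open>G\<close> become comparable at
      the level \<open>F \<union> G\<close>.\<close>
    then have "tensor_one F (F \<union> G) a = tensor_one G (F \<union> G) b"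
      using F(1) G f by (subst tensor_one_eq_iff) (auto simp: fin_subsets_def)
    then show "\<exists>H\<in>fin_subsets K. F \<le> H \<and> G \<le> H \<and> tensor_one F H a = tensor_one G H b"
      by (intro bexI[OF _ fin_subsets_Un[OF F(1) G]]) simp
  qed
  then show ?thesis unfolding limit_class_def fcl_def by (simp cong: conj_cong)
qed

lemma fcl_nonempty: "f \<in> cylfuns \<Longrightarrow> fcl f \<noteq> {}"
  using cylfunsD[of f] by (auto simp: fcl_def)

lemma fcl_eq_iff:
  assumes "f \<in> cylfuns" shows "fcl f = fcl g \<longleftrightarrow> (\<forall>\<omega>\<in>\<Omega>. f \<omega> = g \<omega>)"
proof
  assume *: "fcl f = fcl g"
  obtain F a where "(F, a) \<in> fcl f" using fcl_nonempty[OF assms] by (metis surj_pair ex_in_conv)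
  then have "(F, a) \<in> fcl f" "(F, a) \<in> fcl g" using * by simp_all
  then show "\<forall>\<omega>\<in>\<Omega>. f \<omega> = g \<omega>" by (simp add: fcl_def)
qed (simp add: fcl_def)

lemma carrier_B: "carrier \<B> = fcl ` cylfuns"
proof -
  have "carrier \<B> = LC ` (SIGMA F:fin_subsets K. carrier (fin_tensor F))"
    by (simp add: algebraic_limit_def Let_def)
  also have "\<dots> = fcl ` cylfuns"
  proof (rule equalityI; rule subsetI)
    fix X assume "X \<in> LC ` (SIGMA F:fin_subsets K. carrier (fin_tensor F))"
    then obtain F a where F: "F \<in> fin_subsets K" "a \<in> carrier (fin_tensor F)" "X = LC (F, a)" by auto
    then show "X \<in> fcl ` cylfuns"
      using limit_class_eq[OF F(1,2), of "cyl F a"] cyl_in_cylfuns[OF F(1)] by auto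
  next
    fix X assume "X \<in> fcl ` cylfuns"
    then obtain f where f: "f \<in> cylfuns" "X = fcl f" by auto
    then obtain F a where F: "F \<in> fin_subsets K" "a \<in> carrier (fin_tensor F)" "\<forall>\<omega>\<in>\<Omega>. f \<omega> = cyl F a \<omega>"
      using cylfunsD by blast
    then show "X \<in> LC ` (SIGMA F:fin_subsets K. carrier (fin_tensor F))"
      using limit_class_eq[OF F] f(2) by blast
  qed
  finally show ?thesis .
qed

lemma fcl_binop:
  assumes "f \<in> cylfuns" "g \<in> cylfuns"
  shows "(\<Union>(F, a)\<in>fcl f. \<Union>(G, b)\<in>fcl g. \<Union>H\<in>{H\<in>fin_subsets K. F \<le> H \<and> G \<le> H}.
      LC (H, \<lambda>s\<in>cube H. h (tensor_one F H a s) (tensor_one G H b s))) = fcl (\<lambda>\<omega>. h (f \<omega>) (g \<omega>))"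
proof (intro UN_prod_eq_const UN_eq_const fcl_nonempty assms)
  fix F a G b assume F: "(F, a) \<in> fcl f" and G: "(G, b) \<in> fcl g"
  then show "{H\<in>fin_subsets K. F \<le> H \<and> G \<le> H} \<noteq> {}"
    using fin_subsets_Un[of F G] by (auto simp: fcl_def)
  fix H assume H: "H \<in> {H\<in>fin_subsets K. F \<le> H \<and> G \<le> H}"
  then have FH: "H \<in> fin_subsets K" "F \<subseteq> H" "G \<subseteq> H" by auto
  show "LC (H, \<lambda>s\<in>cube H. h (tensor_one F H a s) (tensor_one G H b s)) = fcl (\<lambda>\<omega>. h (f \<omega>) (g \<omega>))"
  proof (rule limit_class_eq[OF FH(1)])
    show "\<forall>\<omega>\<in>\<Omega>. h (f \<omega>) (g \<omega>) = cyl H (\<lambda>s\<in>cube H. h (tensor_one F H a s) (tensor_one G H b s)) \<omega>"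
      using F G FH(2,3) tensor_one_restrict by (simp add: fcl_def cyl_def restrict_cube)
  qed (simp add: carrier_fin_tensor)
qed

lemma fcl_unop:
  assumes "f \<in> cylfuns"
  shows "(\<Union>(F, a)\<in>fcl f. LC (F, \<lambda>s\<in>cube F. h (a s))) = fcl (\<lambda>\<omega>. h (f \<omega>))"
proof (intro UN_prod_eq_const fcl_nonempty assms)
  fix F a assume F: "(F, a) \<in> fcl f"
  then have F': "F \<in> fin_subsets K" by (simp add: fcl_def)
  show "LC (F, \<lambda>s\<in>cube F. h (a s)) = fcl (\<lambda>\<omega>. h (f \<omega>))"
    by (rule limit_class_eq[OF F']) (use F in \<open>simp_all add: carrier_fin_tensor fcl_def cyl_def restrict_cube\<close>)
qed

lemma fcl_const: "(\<Union>F\<in>fin_subsets K. LC (F, \<lambda>s\<in>cube F. c)) = fcl (\<lambda>\<omega>. c)"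
  by (intro UN_eq_const limit_class_eq) (use empty_fin_subsets in \<open>auto simp: carrier_fin_tensor cyl_def restrict_cube\<close>)

lemma B_ops:
  assumes "f \<in> cylfuns" "g \<in> cylfuns"
  shows "fcl f \<otimes>\<^bsub>\<B>\<^esub> fcl g = fcl (\<lambda>\<omega>. f \<omega> * g \<omega>)" "fcl f \<oplus>\<^bsub>\<B>\<^esub> fcl g = fcl (\<lambda>\<omega>. f \<omega> + g \<omega>)"
    "c \<odot>\<^bsub>\<B>\<^esub> fcl f = fcl (\<lambda>\<omega>. c * f \<omega>)" "star \<B> (fcl f) = fcl (\<lambda>\<omega>. cnj (f \<omega>))"
    "\<one>\<^bsub>\<B>\<^esub> = fcl (\<lambda>\<omega>. 1)" "\<zero>\<^bsub>\<B>\<^esub> = fcl (\<lambda>\<omega>. 0)"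
  using fcl_binop[OF assms, of "(*)"] fcl_binop[OF assms, of "(+)"] fcl_unop[OF assms(1), of "\<lambda>z. c * z"]
    fcl_unop[OF assms(1), of cnj] fcl_const[of 1] fcl_const[of 0]
  by (simp_all add: algebraic_limit_def Let_def fin_tensor_def)

section \<open>The supremum norm on the cube\<close>

definition supn :: "(('k \<Rightarrow> bool) \<Rightarrow> complex) \<Rightarrow> real" where
  "supn f = (SUP \<omega>\<in>\<Omega>. cmod (f \<omega>))"

definition bfuns :: "(('k \<Rightarrow> bool) \<Rightarrow> complex) set" where
  "bfuns = {f. bounded (f ` \<Omega>)}"

lemma bfuns_bdd: "f \<in> bfuns \<Longrightarrow> bdd_above ((\<lambda>\<omega>. cmod (f \<omega>)) ` \<Omega>)"
  by (auto simp: bfuns_def bounded_iff intro: bdd_aboveI)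

lemma supn_le_iff: "f \<in> bfuns \<Longrightarrow> supn f \<le> C \<longleftrightarrow> (\<forall>\<omega>\<in>\<Omega>. cmod (f \<omega>) \<le> C)"
  unfolding supn_def by (rule cSUP_le_iff[OF cube_nonempty bfuns_bdd])

lemma le_supn: "f \<in> bfuns \<Longrightarrow> \<omega> \<in> \<Omega> \<Longrightarrow> cmod (f \<omega>) \<le> supn f"
  using supn_le_iff[of f "supn f"] by simp

lemma supn_nonneg: "f \<in> bfuns \<Longrightarrow> 0 \<le> supn f"
  using le_supn[of f] cube_nonempty norm_ge_zero order_trans by (metis ex_in_conv)

lemma supn_cong: "(\<And>\<omega>. \<omega> \<in> \<Omega> \<Longrightarrow> f \<omega> = g \<omega>) \<Longrightarrow> supn f = supn g"
  unfolding supn_def by (rule SUP_cong) auto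

lemma bfunsI: "(\<And>\<omega>. \<omega> \<in> \<Omega> \<Longrightarrow> cmod (f \<omega>) \<le> C) \<Longrightarrow> f \<in> bfuns"
  by (auto simp: bfuns_def bounded_iff)

lemma bfuns_add: assumes "f \<in> bfuns" "g \<in> bfuns" shows "(\<lambda>\<omega>. f \<omega> + g \<omega>) \<in> bfuns"
  by (rule bfunsI[of _ "supn f + supn g"]) (intro norm_triangle_le add_mono le_supn assms)

lemma bfuns_mult: assumes "f \<in> bfuns" "g \<in> bfuns" shows "(\<lambda>\<omega>. f \<omega> * g \<omega>) \<in> bfuns"
  by (rule bfunsI[of _ "supn f * supn g"]) (auto simp: norm_mult intro!: mult_mono le_supn supn_nonneg assms)

lemma bfuns_const: "(\<lambda>\<omega>. c) \<in> bfuns"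
  by (rule bfunsI[of _ "cmod c"]) simp

lemma bfuns_cnj: "f \<in> bfuns \<Longrightarrow> (\<lambda>\<omega>. cnj (f \<omega>)) \<in> bfuns"
  by (rule bfunsI[of _ "supn f"]) (simp add: le_supn)

lemma bfuns_diff: "f \<in> bfuns \<Longrightarrow> g \<in> bfuns \<Longrightarrow> (\<lambda>\<omega>. f \<omega> - g \<omega>) \<in> bfuns"
  using bfuns_add[OF _ bfuns_mult[OF bfuns_const], of f g "- 1"] by simp

lemma cylfuns_bfuns: "f \<in> cylfuns \<Longrightarrow> f \<in> bfuns"
  by (simp add: bfuns_def cylfuns_bounded)

text \<open>A coefficient array has the same set of absolute values as the function it presents, so
  all representatives have the same norm and the infimum is over one number.\<close>

lemma nrm_fcl:
  assumes f: "f \<in> cylfuns" shows "nrm \<B> (fcl f) = supn f"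
proof -
  have *: "nrm (fin_tensor F) a = supn f" if Fa: "(F, a) \<in> fcl f" for F a
  proof -
    have F: "finite F" "F \<subseteq> K" "\<forall>\<omega>\<in>\<Omega>. f \<omega> = cyl F a \<omega>" using Fa by (auto simp: fcl_def fin_subsets_def)
    have img: "(\<lambda>s. cmod (a s)) ` cube F = (\<lambda>\<omega>. cmod (f \<omega>)) ` \<Omega>"
    proof (rule equalityI; rule subsetI)
      fix x assume "x \<in> (\<lambda>s. cmod (a s)) ` cube F"
      then obtain s where s: "s \<in> cube F" "x = cmod (a s)" by blast
      note e = extend_cube[OF F(2) s(1)]
      have "f (restrict s K) = a s" using F(3) e(1) unfolding cyl_def by (simp only: e(2))
      then show "x \<in> (\<lambda>\<omega>. cmod (f \<omega>)) ` \<Omega>" using e(1) s(2) by (intro image_eqI[of _ _ "restrict s K"]) simp_all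
    next
      fix x assume "x \<in> (\<lambda>\<omega>. cmod (f \<omega>)) ` \<Omega>"
      then show "x \<in> (\<lambda>s. cmod (a s)) ` cube F" using F(3) by (auto simp: cyl_def restrict_cube)
    qed
    have "Max ((\<lambda>s. cmod (a s)) ` cube F) = Sup ((\<lambda>s. cmod (a s)) ` cube F)"
    proof (rule cSup_eq_Max[symmetric, OF finite_imageI[OF finite_cube[OF F(1)]]])
      show "(\<lambda>s. cmod (a s)) ` cube F \<noteq> {}" unfolding img using cube_nonempty by simp
    qed
    then show ?thesis by (simp add: fin_tensor_def supn_def img)
  qed
  have "nrm \<B> (fcl f) = (INF (F, a)\<in>fcl f. nrm (fin_tensor F) a)"
    by (simp add: algebraic_limit_def Let_def)
  also have "(\<lambda>(F, a). nrm (fin_tensor F) a) ` fcl f = {supn f}"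
    using * fcl_nonempty[OF f] by force
  finally show ?thesis by simp
qed

definition frep :: "('k set \<times> (('k \<Rightarrow> bool) \<Rightarrow> complex)) set \<Rightarrow> ('k \<Rightarrow> bool) \<Rightarrow> complex" where
  "frep X = (SOME f. f \<in> cylfuns \<and> X = fcl f)"

lemma frep:
  assumes "X \<in> carrier \<B>" shows "frep X \<in> cylfuns" "fcl (frep X) = X"
proof -
  have "\<exists>f. f \<in> cylfuns \<and> X = fcl f" using assms by (auto simp: carrier_B)
  from someI_ex[OF this] show "frep X \<in> cylfuns" "fcl (frep X) = X" unfolding frep_def by simp_all
qed

lemma fcl_carrier: "f \<in> cylfuns \<Longrightarrow> fcl f \<in> carrier \<B>"
  by (simp add: carrier_B)

lemma frep_fcl: "f \<in> cylfuns \<Longrightarrow> \<forall>\<omega>\<in>\<Omega>. frep (fcl f) \<omega> = f \<omega>"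
  using frep[OF fcl_carrier] fcl_eq_iff by blast

lemma B_ops_rep:
  assumes x: "x \<in> carrier \<B>" and y: "y \<in> carrier \<B>"
  shows "x \<otimes>\<^bsub>\<B>\<^esub> y = fcl (\<lambda>\<omega>. frep x \<omega> * frep y \<omega>)" "x \<oplus>\<^bsub>\<B>\<^esub> y = fcl (\<lambda>\<omega>. frep x \<omega> + frep y \<omega>)"
    "c \<odot>\<^bsub>\<B>\<^esub> x = fcl (\<lambda>\<omega>. c * frep x \<omega>)" "star \<B> x = fcl (\<lambda>\<omega>. cnj (frep x \<omega>))"
    "nrm \<B> x = supn (frep x)"
  using B_ops[OF frep(1)[OF x] frep(1)[OF y]] nrm_fcl[OF frep(1)[OF x]] unfolding frep(2)[OF x] frep(2)[OF y] by simp_all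

sublocale Bm: func_model \<B> "principal \<Omega>" frep
proof unfold_locales
  note one = B_ops(5)[OF cylfuns_const cylfuns_const] and zero = B_ops(6)[OF cylfuns_const cylfuns_const]
  show "\<one>\<^bsub>\<B>\<^esub> \<in> carrier \<B>" "\<zero>\<^bsub>\<B>\<^esub> \<in> carrier \<B>"
    unfolding one zero by (intro fcl_carrier cylfuns_const)+
  show "\<forall>\<^sub>F w in principal \<Omega>. frep \<one>\<^bsub>\<B>\<^esub> w = 1" "\<forall>\<^sub>F w in principal \<Omega>. frep \<zero>\<^bsub>\<B>\<^esub> w = 0"
    unfolding one zero eventually_principal by (rule frep_fcl[OF cylfuns_const])+
  fix x assume x: "x \<in> carrier \<B>"
  note fx = frep[OF x]
  show "c \<odot>\<^bsub>\<B>\<^esub> x \<in> carrier \<B>" for c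
    unfolding B_ops_rep(3)[OF x x] by (rule fcl_carrier[OF cylfuns_unop[OF fx(1)]])
  show "\<forall>\<^sub>F w in principal \<Omega>. frep (c \<odot>\<^bsub>\<B>\<^esub> x) w = c * frep x w" for c
    unfolding B_ops_rep(3)[OF x x] eventually_principal by (rule frep_fcl[OF cylfuns_unop[OF fx(1)]])
  show "star \<B> x \<in> carrier \<B>"
    unfolding B_ops_rep(4)[OF x x] by (rule fcl_carrier[OF cylfuns_unop[OF fx(1)]])
  show "\<forall>\<^sub>F w in principal \<Omega>. frep (star \<B> x) w = cnj (frep x w)"
    unfolding B_ops_rep(4)[OF x x] eventually_principal by (rule frep_fcl[OF cylfuns_unop[OF fx(1)]])
  show "0 \<le> nrm \<B> x" unfolding B_ops_rep(5)[OF x x] by (rule supn_nonneg[OF cylfuns_bfuns[OF fx(1)]])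
  show "nrm \<B> x \<le> C \<longleftrightarrow> (\<forall>\<^sub>F w in principal \<Omega>. cmod (frep x w) \<le> C)" if "0 \<le> C" for C
    unfolding B_ops_rep(5)[OF x x] eventually_principal by (rule supn_le_iff[OF cylfuns_bfuns[OF fx(1)]])
  fix y assume y: "y \<in> carrier \<B>"
  note fy = frep[OF y]
  show "x \<otimes>\<^bsub>\<B>\<^esub> y \<in> carrier \<B>"
    unfolding B_ops_rep(1)[OF x y] by (rule fcl_carrier[OF cylfuns_binop[OF fx(1) fy(1)]])
  show "\<forall>\<^sub>F w in principal \<Omega>. frep (x \<otimes>\<^bsub>\<B>\<^esub> y) w = frep x w * frep y w"
    unfolding B_ops_rep(1)[OF x y] eventually_principal by (rule frep_fcl[OF cylfuns_binop[OF fx(1) fy(1)]])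
  show "x \<oplus>\<^bsub>\<B>\<^esub> y \<in> carrier \<B>"
    unfolding B_ops_rep(2)[OF x y] by (rule fcl_carrier[OF cylfuns_binop[OF fx(1) fy(1)]])
  show "\<forall>\<^sub>F w in principal \<Omega>. frep (x \<oplus>\<^bsub>\<B>\<^esub> y) w = frep x w + frep y w"
    unfolding B_ops_rep(2)[OF x y] eventually_principal by (rule frep_fcl[OF cylfuns_binop[OF fx(1) fy(1)]])
  show "x = y" if "\<forall>\<^sub>F w in principal \<Omega>. frep x w = frep y w"
    using that fcl_eq_iff[OF fx(1), of "frep y"] fx(2) fy(2) by (simp add: eventually_principal)
qed

text \<open>Links the seminorm to uniform limits, whose standard rules then give compatibility with
  the operations of the algebra.\<close>

lemma supn_tendsto_iff:
  assumes s: "\<And>n. s n \<in> bfuns" and f: "f \<in> bfuns"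
  shows "(\<lambda>n. supn (\<lambda>w. s n w - f w)) \<longlonglongrightarrow> 0 \<longleftrightarrow> uniform_limit \<Omega> s f sequentially"
proof
  note d = bfuns_diff[OF s f]
  assume l: "(\<lambda>n. supn (\<lambda>w. s n w - f w)) \<longlonglongrightarrow> 0"
  show "uniform_limit \<Omega> s f sequentially"
  proof (rule uniform_limitI)
    fix e :: real assume "0 < e"
    with l have "\<forall>\<^sub>F n in sequentially. supn (\<lambda>w. s n w - f w) < e" by (rule order_tendstoD)
    then show "\<forall>\<^sub>F n in sequentially. \<forall>x\<in>\<Omega>. dist (s n x) (f x) < e"
      by eventually_elim (auto simp: dist_norm intro: le_less_trans[OF le_supn[OF d]])
  qed
next
  note d = bfuns_diff[OF s f]
  assume u: "uniform_limit \<Omega> s f sequentially"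
  show "(\<lambda>n. supn (\<lambda>w. s n w - f w)) \<longlonglongrightarrow> 0"
  proof (rule LIMSEQ_I)
    fix e :: real assume e: "0 < e"
    have "\<forall>\<^sub>F n in sequentially. \<forall>x\<in>\<Omega>. dist (s n x) (f x) < e / 2"
      by (rule uniform_limitD[OF u]) (use e in simp)
    then obtain n0 where n0: "\<And>n. n0 \<le> n \<Longrightarrow> \<forall>x\<in>\<Omega>. dist (s n x) (f x) < e / 2"
      by (auto simp: eventually_sequentially)
    have "norm (supn (\<lambda>w. s n w - f w) - 0) < e" if "n0 \<le> n" for n
    proof -
      have "supn (\<lambda>w. s n w - f w) \<le> e / 2"
        using n0[OF that] by (subst supn_le_iff[OF d]) (auto simp: dist_norm intro: less_imp_le)
      then show ?thesis using supn_nonneg[OF d, of n] e by simp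
    qed
    then show "\<exists>n0. \<forall>n\<ge>n0. norm (supn (\<lambda>w. s n w - f w) - 0) < e" by blast
  qed
qed

sublocale sup: seminorm_model \<B> "nrm \<B>" frep bfuns supn
proof unfold_locales
  show "frep x \<in> bfuns" if "x \<in> carrier \<B>" for x by (rule cylfuns_bfuns[OF frep(1)[OF that]])
  show "nrm \<B> (x \<ominus>\<^bsub>\<B>\<^esub> y) = supn (\<lambda>w. frep x w - frep y w)" if "x \<in> carrier \<B>" "y \<in> carrier \<B>" for x y
    unfolding B_ops_rep(5)[OF Bm.minus_closed'[OF that] that(2)]
    using Bm.theta_minus[OF that] by (intro supn_cong) (simp add: eventually_principal)
  show "0 \<le> supn (\<lambda>w. f w - g w)" if "f \<in> bfuns" "g \<in> bfuns" for f g
    by (rule supn_nonneg[OF bfuns_diff[OF that]])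
  show "supn (\<lambda>w. f w - g w) = supn (\<lambda>w. g w - f w)" for f g
    by (simp add: supn_def norm_minus_commute)
  show "supn (\<lambda>w. f w - h w) \<le> supn (\<lambda>w. f w - g w) + supn (\<lambda>w. g w - h w)"
    if f: "f \<in> bfuns" and g: "g \<in> bfuns" and h: "h \<in> bfuns" for f g h
  proof (subst supn_le_iff[OF bfuns_diff[OF f h]], rule ballI)
    fix w assume w: "w \<in> \<Omega>"
    have "cmod (f w - h w) \<le> cmod (f w - g w) + cmod (g w - h w)"
      using norm_triangle_ineq[of "f w - g w" "g w - h w"] by simp
    also have "\<dots> \<le> supn (\<lambda>w. f w - g w) + supn (\<lambda>w. g w - h w)"
      by (intro add_mono le_supn[OF bfuns_diff[OF f g] w] le_supn[OF bfuns_diff[OF g h] w])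
    finally show "cmod (f w - h w) \<le> supn (\<lambda>w. f w - g w) + supn (\<lambda>w. g w - h w)" .
  qed
  fix s :: "nat \<Rightarrow> ('k \<Rightarrow> bool) \<Rightarrow> complex"
  assume s: "\<And>n. s n \<in> bfuns" and c: "\<And>e. 0 < e \<Longrightarrow> \<exists>K. \<forall>m\<ge>K. \<forall>n\<ge>K. supn (\<lambda>w. s m w - s n w) < e"
  have "uniformly_Cauchy_on \<Omega> s"
    unfolding uniformly_Cauchy_on_def
  proof (intro allI impI)
    fix e :: real assume "0 < e"
    then obtain M where "\<forall>m\<ge>M. \<forall>n\<ge>M. supn (\<lambda>w. s m w - s n w) < e" using c by blast
    then show "\<exists>M. \<forall>x\<in>\<Omega>. \<forall>m\<ge>M. \<forall>n\<ge>M. dist (s m x) (s n x) < e"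
      by (intro exI[of _ M]) (auto simp: dist_norm intro: le_less_trans[OF le_supn[OF bfuns_diff[OF s s]]])
  qed
  then have "uniformly_convergent_on \<Omega> s" by (rule Cauchy_uniformly_convergent)
  then obtain f where f: "uniform_limit \<Omega> s f sequentially" by (auto simp: uniformly_convergent_on_def)
  obtain n where n: "\<forall>x\<in>\<Omega>. dist (s n x) (f x) < 1"
    using uniform_limitD[OF f, of 1] by (auto simp: eventually_sequentially)
  have fb: "f \<in> bfuns"
  proof (rule bfunsI)
    fix w assume w: "w \<in> \<Omega>"
    have "cmod (f w) \<le> cmod (s n w) + cmod (s n w - f w)" using norm_triangle_ineq4[of "s n w" "s n w - f w"] by simp
    then show "cmod (f w) \<le> supn (s n) + 1" using le_supn[OF s w, of n] bspec[OF n w] by (simp add: dist_norm)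
  qed
  then show "\<exists>f. f \<in> bfuns \<and> (\<lambda>n. supn (\<lambda>w. s n w - f w)) \<longlonglongrightarrow> 0"
    by (intro exI[of _ f] conjI fb iffD2[OF supn_tendsto_iff[OF s fb] f])
qed

section \<open>The completed C*-algebra as uniform limits of cylinder functions\<close>

abbreviation "\<A> \<equiv> inf_tensor K"

lemma A_eq: "\<A> = hausdorff_completion \<B>"
  by (simp add: inf_tensor_def cstar_limit_def)

lemma carrier_A: "carrier \<A> = sup.cls ` sup.lims"
  unfolding A_eq sup.cls_image[symmetric] by (simp add: hausdorff_completion_def Let_def)

lemma supconv_iff:
  "sup.conv s f \<longleftrightarrow> (\<forall>n. s n \<in> carrier \<B>) \<and> f \<in> bfuns \<and> uniform_limit \<Omega> (\<lambda>n. frep (s n)) f sequentially"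
  unfolding sup.conv_def using supn_tendsto_iff[OF cylfuns_bfuns[OF frep(1)]] by blast

lemma supconv_binop:
  assumes s: "sup.conv s f" and t: "sup.conv t g"
  shows "sup.conv (\<lambda>n. s n \<oplus>\<^bsub>\<B>\<^esub> t n) (\<lambda>w. f w + g w)" "sup.conv (\<lambda>n. s n \<otimes>\<^bsub>\<B>\<^esub> t n) (\<lambda>w. f w * g w)"
proof -
  have sc: "s n \<in> carrier \<B>" and tc: "t n \<in> carrier \<B>" for n using s t by (auto simp: supconv_iff)
  have fg: "f \<in> bfuns" "g \<in> bfuns" and u: "uniform_limit \<Omega> (\<lambda>n. frep (s n)) f sequentially"
    "uniform_limit \<Omega> (\<lambda>n. frep (t n)) g sequentially" using s t by (auto simp: supconv_iff)
  have "uniform_limit \<Omega> (\<lambda>n. frep (s n \<oplus>\<^bsub>\<B>\<^esub> t n)) (\<lambda>w. f w + g w) sequentially"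
    using uniform_limit_add[OF u] Bm.theta_add[OF sc tc]
    by (subst uniform_limit_cong'[of \<Omega> _ "\<lambda>n w. frep (s n) w + frep (t n) w"]) (auto simp: eventually_principal)
  then show "sup.conv (\<lambda>n. s n \<oplus>\<^bsub>\<B>\<^esub> t n) (\<lambda>w. f w + g w)"
    unfolding supconv_iff using sc tc fg by (simp add: Bm.closed bfuns_add)
  \<comment> \<open>A product of uniformly convergent sequences converges uniformly because the two
    limits are bounded.\<close>
  have "uniform_limit \<Omega> (\<lambda>n w. frep (s n) w * frep (t n) w) (\<lambda>w. f w * g w) sequentially"
    using fg by (intro uniform_lim_mult u) (auto simp: bfuns_def)
  then have "uniform_limit \<Omega> (\<lambda>n. frep (s n \<otimes>\<^bsub>\<B>\<^esub> t n)) (\<lambda>w. f w * g w) sequentially"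
    using Bm.theta_mult[OF sc tc]
    by (subst uniform_limit_cong'[of \<Omega> _ "\<lambda>n w. frep (s n) w * frep (t n) w"]) (auto simp: eventually_principal)
  then show "sup.conv (\<lambda>n. s n \<otimes>\<^bsub>\<B>\<^esub> t n) (\<lambda>w. f w * g w)"
    unfolding supconv_iff using sc tc fg by (simp add: Bm.closed bfuns_mult)
qed

lemma supconv_const: "f \<in> cylfuns \<Longrightarrow> sup.conv (\<lambda>n. fcl f) f"
  unfolding supconv_iff using fcl_carrier[of f] cylfuns_bfuns[of f] frep_fcl[of f]
  by (auto simp: uniform_limit_iff)

lemma supconv_unop:
  assumes s: "sup.conv s f"
  shows "sup.conv (\<lambda>n. c \<odot>\<^bsub>\<B>\<^esub> s n) (\<lambda>w. c * f w)" "sup.conv (\<lambda>n. star \<B> (s n)) (\<lambda>w. cnj (f w))"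
proof -
  have sc: "s n \<in> carrier \<B>" for n using s by (auto simp: supconv_iff)
  have f: "f \<in> bfuns" and u: "uniform_limit \<Omega> (\<lambda>n. frep (s n)) f sequentially" using s by (auto simp: supconv_iff)
  have "uniform_limit \<Omega> (\<lambda>n w. c * frep (s n) w) (\<lambda>w. c * f w) sequentially"
    by (rule bounded_linear.uniform_limit[OF bounded_linear_mult_right u])
  then have "uniform_limit \<Omega> (\<lambda>n. frep (c \<odot>\<^bsub>\<B>\<^esub> s n)) (\<lambda>w. c * f w) sequentially"
    using Bm.theta_smult[OF sc, of c]
    by (subst uniform_limit_cong'[of \<Omega> _ "\<lambda>n w. c * frep (s n) w"]) (auto simp: eventually_principal)
  then show "sup.conv (\<lambda>n. c \<odot>\<^bsub>\<B>\<^esub> s n) (\<lambda>w. c * f w)"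
    unfolding supconv_iff using sc f by (simp add: Bm.closed bfuns_mult bfuns_const)
  have "uniform_limit \<Omega> (\<lambda>n w. cnj (frep (s n) w)) (\<lambda>w. cnj (f w)) sequentially"
    by (rule bounded_linear.uniform_limit[OF bounded_linear_cnj u])
  then have "uniform_limit \<Omega> (\<lambda>n. frep (star \<B> (s n))) (\<lambda>w. cnj (f w)) sequentially"
    using Bm.theta_star[OF sc]
    by (subst uniform_limit_cong'[of \<Omega> _ "\<lambda>n w. cnj (frep (s n) w)"]) (auto simp: eventually_principal)
  then show "sup.conv (\<lambda>n. star \<B> (s n)) (\<lambda>w. cnj (f w))"
    unfolding supconv_iff using sc f by (simp add: Bm.closed bfuns_cnj)
qed

lemma lims_closed:
  assumes "f \<in> sup.lims" "g \<in> sup.lims"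
  shows "(\<lambda>w. f w + g w) \<in> sup.lims" "(\<lambda>w. f w * g w) \<in> sup.lims" "(\<lambda>w. c * f w) \<in> sup.lims" "(\<lambda>w. cnj (f w)) \<in> sup.lims"
proof -
  obtain s t where s: "sup.conv s f" and t: "sup.conv t g" using assms by (auto simp: sup.lims_def)
  show "(\<lambda>w. f w + g w) \<in> sup.lims" "(\<lambda>w. f w * g w) \<in> sup.lims" "(\<lambda>w. c * f w) \<in> sup.lims" "(\<lambda>w. cnj (f w)) \<in> sup.lims"
    by (rule sup.conv_in_lims[OF supconv_binop(1)[OF s t]] sup.conv_in_lims[OF supconv_binop(2)[OF s t]]
        sup.conv_in_lims[OF supconv_unop(1)[OF s]] sup.conv_in_lims[OF supconv_unop(2)[OF s]])+
qed

lemma cylfuns_lims: "f \<in> cylfuns \<Longrightarrow> f \<in> sup.lims"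
  by (rule sup.conv_in_lims[OF supconv_const])

lemma supn_eq_0: "f \<in> bfuns \<Longrightarrow> supn f = 0 \<longleftrightarrow> (\<forall>\<omega>\<in>\<Omega>. f \<omega> = 0)"
  using supn_le_iff[of f 0] supn_nonneg[of f] by auto

lemma cls_eq_iff_Omega:
  "f \<in> sup.lims \<Longrightarrow> g \<in> sup.lims \<Longrightarrow> sup.cls f = sup.cls g \<longleftrightarrow> (\<forall>\<omega>\<in>\<Omega>. f \<omega> = g \<omega>)"
  using sup.cls_eq_iff[of f g] supn_eq_0[OF bfuns_diff[OF sup.lims_V sup.lims_V], of f g] by simp

lemma A_ops:
  assumes f: "f \<in> sup.lims" and g: "g \<in> sup.lims"
  shows "sup.cls f \<otimes>\<^bsub>\<A>\<^esub> sup.cls g = sup.cls (\<lambda>\<omega>. f \<omega> * g \<omega>)" "sup.cls f \<oplus>\<^bsub>\<A>\<^esub> sup.cls g = sup.cls (\<lambda>\<omega>. f \<omega> + g \<omega>)"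
    "c \<odot>\<^bsub>\<A>\<^esub> sup.cls f = sup.cls (\<lambda>\<omega>. c * f \<omega>)" "star \<A> (sup.cls f) = sup.cls (\<lambda>\<omega>. cnj (f \<omega>))"
    "\<one>\<^bsub>\<A>\<^esub> = sup.cls (\<lambda>\<omega>. 1)" "\<zero>\<^bsub>\<A>\<^esub> = sup.cls (\<lambda>\<omega>. 0)" "nrm \<A> (sup.cls f) = supn f"
proof -
  show "sup.cls f \<otimes>\<^bsub>\<A>\<^esub> sup.cls g = sup.cls (\<lambda>\<omega>. f \<omega> * g \<omega>)" "sup.cls f \<oplus>\<^bsub>\<A>\<^esub> sup.cls g = sup.cls (\<lambda>\<omega>. f \<omega> + g \<omega>)"
    unfolding A_eq hausdorff_completion_def Let_def
    using sup.cls_binop[OF f g supconv_binop(2)] sup.cls_binop[OF f g supconv_binop(1)] by simp_all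
  show "c \<odot>\<^bsub>\<A>\<^esub> sup.cls f = sup.cls (\<lambda>\<omega>. c * f \<omega>)" "star \<A> (sup.cls f) = sup.cls (\<lambda>\<omega>. cnj (f \<omega>))"
    unfolding A_eq hausdorff_completion_def Let_def
    using sup.cls_unop[OF f supconv_unop(1)[of _ _ c]] sup.cls_unop[OF f supconv_unop(2)] by simp_all
  show "\<one>\<^bsub>\<A>\<^esub> = sup.cls (\<lambda>\<omega>. 1)" "\<zero>\<^bsub>\<A>\<^esub> = sup.cls (\<lambda>\<omega>. 0)"
    unfolding A_eq hausdorff_completion_def Let_def
    using sup.cauchy_class_conv[OF supconv_const[OF cylfuns_const]] B_ops(5,6)[OF cylfuns_const cylfuns_const] by simp_all
  have lim: "(\<lambda>n. nrm \<B> (s n)) \<longlonglongrightarrow> supn f" if "s \<in> sup.cls f" for s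
  proof -
    have s: "sup.conv s f" using that by (simp add: sup.cls_def)
    then have sc: "s n \<in> carrier \<B>" and fb: "f \<in> bfuns" and l: "(\<lambda>n. supn (\<lambda>w. frep (s n) w - f w)) \<longlonglongrightarrow> 0" for n
      by (auto simp: sup.conv_def)
    have sb: "frep (s n) \<in> bfuns" for n by (rule cylfuns_bfuns[OF frep(1)[OF sc]])
    \<comment> \<open>Against the zero function the triangle inequality for \<open>supn\<close>
      becomes the reverse triangle inequality, which makes the norms converge.\<close>
    have z: "(\<lambda>w. 0) \<in> bfuns" by (rule bfuns_const)
    have "norm (nrm \<B> (s n) - supn f) \<le> supn (\<lambda>w. frep (s n) w - f w)" for n
      using sup.q_triangle[OF sb fb z, of n] sup.q_triangle[OF fb sb z, of n] sup.q_commute[OF fb sb, of n]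
      by (simp add: B_ops_rep(5)[OF sc sc])
    then have "(\<lambda>n. nrm \<B> (s n) - supn f) \<longlonglongrightarrow> 0"
      by (intro Lim_null_comparison[OF always_eventually l] allI)
    then show ?thesis by (simp add: LIM_zero_iff)
  qed
  have "(THE r. \<forall>s\<in>sup.cls f. (\<lambda>n. nrm \<B> (s n)) \<longlonglongrightarrow> r) = supn f"
  proof (rule the_equality)
    fix r assume r: "\<forall>s\<in>sup.cls f. (\<lambda>n. nrm \<B> (s n)) \<longlonglongrightarrow> r"
    obtain s where "s \<in> sup.cls f" using sup.cls_nonempty[OF f] by blast
    then show "r = supn f" using lim r LIMSEQ_unique by blast
  qed (use lim in blast)
  then show "nrm \<A> (sup.cls f) = supn f" by (simp add: A_eq hausdorff_completion_def Let_def)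
qed

lemma rep_A:
  assumes "x \<in> carrier \<A>" shows "sup.rep x \<in> sup.lims" "sup.cls (sup.rep x) = x"
  using sup.rep[of x] assms by (simp_all add: carrier_A)

lemma cls_carrier: "f \<in> sup.lims \<Longrightarrow> sup.cls f \<in> carrier \<A>"
  by (simp add: carrier_A)

lemma rep_cls_A: "f \<in> sup.lims \<Longrightarrow> \<forall>\<omega>\<in>\<Omega>. sup.rep (sup.cls f) \<omega> = f \<omega>"
  using rep_A[OF cls_carrier[of f]] cls_eq_iff_Omega[of "sup.rep (sup.cls f)" f] by simp

lemma A_ops_rep:
  assumes x: "x \<in> carrier \<A>" and y: "y \<in> carrier \<A>"
  shows "x \<otimes>\<^bsub>\<A>\<^esub> y = sup.cls (\<lambda>\<omega>. sup.rep x \<omega> * sup.rep y \<omega>)" "x \<oplus>\<^bsub>\<A>\<^esub> y = sup.cls (\<lambda>\<omega>. sup.rep x \<omega> + sup.rep y \<omega>)"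
    "c \<odot>\<^bsub>\<A>\<^esub> x = sup.cls (\<lambda>\<omega>. c * sup.rep x \<omega>)" "star \<A> x = sup.cls (\<lambda>\<omega>. cnj (sup.rep x \<omega>))"
    "nrm \<A> x = supn (sup.rep x)"
  using A_ops(1-4)[OF rep_A(1)[OF x] rep_A(1)[OF y]] A_ops(7)[OF rep_A(1)[OF x] rep_A(1)[OF x]]
  unfolding rep_A(2)[OF x] rep_A(2)[OF y] by simp_all

sublocale Am: func_model \<A> "principal \<Omega>" sup.rep
proof unfold_locales
  note cl = cylfuns_lims[OF cylfuns_const]
  note one = A_ops(5)[OF cl cl] and zero = A_ops(6)[OF cl cl]
  show "\<one>\<^bsub>\<A>\<^esub> \<in> carrier \<A>" "\<zero>\<^bsub>\<A>\<^esub> \<in> carrier \<A>"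
    unfolding one zero by (intro cls_carrier cl)+
  show "\<forall>\<^sub>F w in principal \<Omega>. sup.rep \<one>\<^bsub>\<A>\<^esub> w = 1" "\<forall>\<^sub>F w in principal \<Omega>. sup.rep \<zero>\<^bsub>\<A>\<^esub> w = 0"
    unfolding one zero eventually_principal by (rule rep_cls_A[OF cl])+
  fix x assume x: "x \<in> carrier \<A>"
  note fx = rep_A[OF x]
  show "c \<odot>\<^bsub>\<A>\<^esub> x \<in> carrier \<A>" for c
    unfolding A_ops_rep(3)[OF x x] by (rule cls_carrier[OF lims_closed(3)[OF fx(1) fx(1)]])
  show "\<forall>\<^sub>F w in principal \<Omega>. sup.rep (c \<odot>\<^bsub>\<A>\<^esub> x) w = c * sup.rep x w" for c
    unfolding A_ops_rep(3)[OF x x] eventually_principal by (rule rep_cls_A[OF lims_closed(3)[OF fx(1) fx(1)]])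
  show "star \<A> x \<in> carrier \<A>"
    unfolding A_ops_rep(4)[OF x x] by (intro cls_carrier lims_closed(4)[OF fx(1) fx(1)])
  show "\<forall>\<^sub>F w in principal \<Omega>. sup.rep (star \<A> x) w = cnj (sup.rep x w)"
    unfolding A_ops_rep(4)[OF x x] eventually_principal by (rule rep_cls_A[OF lims_closed(4)[OF fx(1) fx(1)]])
  show "0 \<le> nrm \<A> x" unfolding A_ops_rep(5)[OF x x] by (rule supn_nonneg[OF sup.lims_V[OF fx(1)]])
  show "nrm \<A> x \<le> C \<longleftrightarrow> (\<forall>\<^sub>F w in principal \<Omega>. cmod (sup.rep x w) \<le> C)" if "0 \<le> C" for C
    unfolding A_ops_rep(5)[OF x x] eventually_principal by (rule supn_le_iff[OF sup.lims_V[OF fx(1)]])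
  fix y assume y: "y \<in> carrier \<A>"
  note fy = rep_A[OF y]
  show "x \<otimes>\<^bsub>\<A>\<^esub> y \<in> carrier \<A>"
    unfolding A_ops_rep(1)[OF x y] by (rule cls_carrier[OF lims_closed(2)[OF fx(1) fy(1)]])
  show "\<forall>\<^sub>F w in principal \<Omega>. sup.rep (x \<otimes>\<^bsub>\<A>\<^esub> y) w = sup.rep x w * sup.rep y w"
    unfolding A_ops_rep(1)[OF x y] eventually_principal by (rule rep_cls_A[OF lims_closed(2)[OF fx(1) fy(1)]])
  show "x \<oplus>\<^bsub>\<A>\<^esub> y \<in> carrier \<A>"
    unfolding A_ops_rep(2)[OF x y] by (rule cls_carrier[OF lims_closed(1)[OF fx(1) fy(1)]])
  show "\<forall>\<^sub>F w in principal \<Omega>. sup.rep (x \<oplus>\<^bsub>\<A>\<^esub> y) w = sup.rep x w + sup.rep y w"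
    unfolding A_ops_rep(2)[OF x y] eventually_principal by (rule rep_cls_A[OF lims_closed(1)[OF fx(1) fy(1)]])
  show "x = y" if "\<forall>\<^sub>F w in principal \<Omega>. sup.rep x w = sup.rep y w"
    using that cls_eq_iff_Omega[OF fx(1) fy(1)] fx(2) fy(2) by (simp add: eventually_principal)
qed

lemma lims_ess_bounded:
  assumes "f \<in> sup.lims" shows "f \<in> ess_bounded N"
proof -
  obtain s where s: "sup.conv s f" using assms by (auto simp: sup.lims_def)
  then have sc: "s n \<in> carrier \<B>" and f: "f \<in> bfuns" and u: "uniform_limit \<Omega> (\<lambda>n. frep (s n)) f sequentially" for n
    by (auto simp: supconv_iff)
  have "f \<in> borel_measurable N"
  proof (rule borel_measurable_LIMSEQ_metric)
    show "frep (s n) \<in> borel_measurable N" for n by (rule cylfuns_measurable[OF frep(1)[OF sc]])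
    show "(\<lambda>n. frep (s n) w) \<longlonglongrightarrow> f w" if "w \<in> space N" for w
      using tendsto_uniform_limitI[OF u] that by (simp add: space_radon)
  qed
  then show ?thesis using f by (intro bounded_ess_bounded) (simp_all add: bfuns_def)
qed

section \<open>The GNS representation of the product state\<close>

text \<open>Cut off to the carrier because bounded functionals are extensional; uniqueness of the
  product state is then an equality of functions.\<close>

definition mean :: "'k tensor \<Rightarrow> complex" where
  "mean = (\<lambda>x\<in>carrier \<A>. \<integral>w. sup.rep x w \<partial>N)"

lemma mean_eq: "x \<in> carrier \<A> \<Longrightarrow> mean x = (\<integral>w. sup.rep x w \<partial>N)"
  by (simp add: mean_def)

lemma rep_ess: "x \<in> carrier \<A> \<Longrightarrow> sup.rep x \<in> ess_bounded N"
  by (rule lims_ess_bounded[OF rep_A(1)])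

lemma rep_integrable: "x \<in> carrier \<A> \<Longrightarrow> integrable N (sup.rep x)"
  by (rule nu.ess_bounded_integrable[OF rep_ess])

lemma integral_Omega_cong: "(\<And>w. w \<in> \<Omega> \<Longrightarrow> f w = g w) \<Longrightarrow> (\<integral>w. f w \<partial>N) = (\<integral>w. g w \<partial>N)"
  for f g :: "_ \<Rightarrow> complex"
  by (rule Bochner_Integration.integral_cong) (auto simp: space_radon)

lemma l2n_Omega_cong: "(\<And>w. w \<in> \<Omega> \<Longrightarrow> f w = g w) \<Longrightarrow> l2n N f = l2n N g"
  unfolding l2n_def by (intro arg_cong[where f = sqrt] Bochner_Integration.integral_cong) (auto simp: space_radon)

lemma mean_cls:
  assumes f: "f \<in> sup.lims" shows "mean (sup.cls f) = (\<integral>w. f w \<partial>N)"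
  unfolding mean_eq[OF cls_carrier[OF f]] by (rule integral_Omega_cong) (use rep_cls_A[OF f] in simp)

lemma mean_bound:
  assumes x: "x \<in> carrier \<A>" shows "cmod (mean x) \<le> nrm \<A> x"
proof -
  have "cmod (mean x) \<le> (\<integral>w. cmod (sup.rep x w) \<partial>N)" unfolding mean_eq[OF x] by (rule integral_norm_bound)
  also have "\<dots> \<le> (\<integral>w. nrm \<A> x \<partial>N)"
  proof (rule integral_mono_AE)
    show "AE w in N. cmod (sup.rep x w) \<le> nrm \<A> x"
      using Am.ev_le_nrm[OF x] by (intro AE_I2) (simp add: eventually_principal space_radon)
  qed (use rep_integrable[OF x] in auto)
  finally show ?thesis using nu.prob_space by simp
qed

lemma mean_bounded_functional: "mean \<in> bounded_functionals \<A>"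
  unfolding bounded_functionals_def mem_Collect_eq
proof (intro conjI ballI allI)
  show "mean \<in> extensional (carrier \<A>)" by (simp add: mean_def)
  show "\<exists>C. \<forall>x\<in>carrier \<A>. cmod (mean x) \<le> C * nrm \<A> x" using mean_bound by (intro exI[of _ 1]) simp
  fix x assume x: "x \<in> carrier \<A>"
  note fx = rep_A(1)[OF x]
  show "mean (c \<odot>\<^bsub>\<A>\<^esub> x) = c * mean x" for c
    unfolding A_ops_rep(3)[OF x x] mean_cls[OF lims_closed(3)[OF fx fx]] mean_eq[OF x] by simp
  fix y assume y: "y \<in> carrier \<A>"
  note fy = rep_A(1)[OF y]
  show "mean (x \<oplus>\<^bsub>\<A>\<^esub> y) = mean x + mean y"
    unfolding A_ops_rep(2)[OF x y] mean_cls[OF lims_closed(1)[OF fx fy]] mean_eq[OF x] mean_eq[OF y]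
    by (rule Bochner_Integration.integral_add[OF rep_integrable[OF x] rep_integrable[OF y]])
qed

lemma mean_star_mult:
  assumes x: "x \<in> carrier \<A>" and y: "y \<in> carrier \<A>"
  shows "mean (star \<A> y \<otimes>\<^bsub>\<A>\<^esub> x) = (\<integral>w. sup.rep x w * cnj (sup.rep y w) \<partial>N)"
proof -
  have c: "star \<A> y \<otimes>\<^bsub>\<A>\<^esub> x \<in> carrier \<A>" by (intro Am.closed x y)
  show ?thesis unfolding mean_eq[OF c]
    by (rule integral_Omega_cong)
      (use Am.theta_mult[OF Am.star_closed[OF y] x] Am.theta_star[OF y] in \<open>simp add: eventually_principal mult.commute\<close>)
qed

lemma mean_star_self:
  assumes x: "x \<in> carrier \<A>"
  shows "mean (star \<A> x \<otimes>\<^bsub>\<A>\<^esub> x) = complex_of_real ((l2n N (sup.rep x))\<^sup>2)"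
  unfolding mean_star_mult[OF x x] complex_norm_square[symmetric] integral_complex_of_real l2n_sq ..

lemma mean_one: "mean \<one>\<^bsub>\<A>\<^esub> = 1"
proof -
  note cl = cylfuns_lims[OF cylfuns_const, of 1]
  show ?thesis unfolding A_ops(5)[OF cl cl] mean_cls[OF cl] using nu.prob_space by simp
qed

lemma mean_state: "is_state \<A> mean"
  unfolding is_state_def
proof (intro conjI mean_bounded_functional ballI)
  fix x assume "x \<in> pos \<A>"
  then obtain y where y: "y \<in> carrier \<A>" and x: "x = star \<A> y \<otimes>\<^bsub>\<A>\<^esub> y" by (auto simp: pos_def)
  show "mean x \<in> \<real>" "0 \<le> Re (mean x)" unfolding x mean_star_self[OF y] by simp_all
next
  show "dual_norm \<A> mean = 1"
    unfolding dual_norm_def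
  proof (rule cInf_eq_minimum)
    show "1 \<in> {C. 0 \<le> C \<and> (\<forall>x\<in>carrier \<A>. cmod (mean x) \<le> C * nrm \<A> x)}" using mean_bound by simp
    fix C assume C: "C \<in> {C. 0 \<le> C \<and> (\<forall>x\<in>carrier \<A>. cmod (mean x) \<le> C * nrm \<A> x)}"
    \<comment> \<open>The unit has mean 1 and norm at most 1, so no constant below 1 is
      admissible.\<close>
    have "nrm \<A> \<one>\<^bsub>\<A>\<^esub> \<le> 1"
      using Am.theta_one by (subst Am.nrm_le_iff[OF Am.one_closed]) (auto elim: eventually_mono)
    then have "C * nrm \<A> \<one>\<^bsub>\<A>\<^esub> \<le> C * 1" using C by (intro mult_left_mono) auto
    moreover have "cmod (mean \<one>\<^bsub>\<A>\<^esub>) \<le> C * nrm \<A> \<one>\<^bsub>\<A>\<^esub>" using C Am.one_closed by blast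
    ultimately show "1 \<le> C" by (simp add: mean_one)
  qed
qed

lemma cstar_limit_inj_eq:
  assumes "F \<in> fin_subsets K" "a \<in> carrier (fin_tensor F)"
  shows "cstar_limit_inj (fin_subsets K) fin_tensor tensor_one F a = sup.cls (cyl F a)"
  unfolding cstar_limit_inj_def limit_class_eq[OF assms, of "cyl F a", simplified]
  by (rule sup.cauchy_class_conv[OF supconv_const[OF cyl_in_cylfuns[OF assms(1)]]])

lemma elem_tensor_carrier: "elem_tensor F a \<in> carrier (fin_tensor F)"
  by (simp add: elem_tensor_def carrier_fin_tensor)

text \<open>Distributivity turns the sum over the cube into a product over \<open>F\<close> of sums
  of two terms, and \<open>2 ^ card F\<close> supplies one factor 1/2 for each of them.\<close>

lemma mean_elem_tensor:
  assumes F: "F \<in> fin_subsets K"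
  shows "mean (sup.cls (cyl F (elem_tensor F a))) = (\<Prod>i\<in>F. half_trace (a i))"
proof -
  have Ff: "finite F" using F by (simp add: fin_subsets_def)
  have "mean (sup.cls (cyl F (elem_tensor F a))) = (\<Sum>s\<in>cube F. \<Prod>i\<in>F. a i (s i)) / 2 ^ card F"
    unfolding mean_cls[OF cylfuns_lims[OF cyl_in_cylfuns[OF F]]] integral_cyl[OF F] by (simp add: elem_tensor_def)
  also have "(\<Sum>s\<in>cube F. \<Prod>i\<in>F. a i (s i)) = (\<Prod>i\<in>F. \<Sum>b\<in>UNIV. a i b)"
    unfolding cube_def by (rule prod_sum_PiE[symmetric, OF Ff]) simp
  also have "\<dots> / 2 ^ card F = (\<Prod>i\<in>F. half_trace (a i))"
    by (simp add: half_trace_def UNIV_bool prod_dividef add.commute)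
  finally show ?thesis .
qed

lemma functional_lin:
  assumes \<phi>: "\<phi> \<in> bounded_functionals \<A>" and f: "f \<in> sup.lims" and g: "g \<in> sup.lims"
  shows "\<phi> (sup.cls (\<lambda>w. f w + g w)) = \<phi> (sup.cls f) + \<phi> (sup.cls g)"
    "\<phi> (sup.cls (\<lambda>w. c * f w)) = c * \<phi> (sup.cls f)"
  unfolding A_ops(2,3)[OF f g, symmetric]
  using \<phi> cls_carrier[OF f] cls_carrier[OF g] by (simp_all add: bounded_functionals_def)

text \<open>Linearity is known on \<open>sup.lims\<close> only, so membership is carried along in
  the induction.\<close>

lemma functional_sum:
  assumes \<phi>: "\<phi> \<in> bounded_functionals \<A>" and U: "finite U" and F: "\<And>u. u \<in> U \<Longrightarrow> F u \<in> cylfuns"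
  shows "(\<lambda>w. \<Sum>u\<in>U. b u * F u w) \<in> sup.lims \<and>
    \<phi> (sup.cls (\<lambda>w. \<Sum>u\<in>U. b u * F u w)) = (\<Sum>u\<in>U. b u * \<phi> (sup.cls (F u)))"
  using U F
proof (induction U rule: finite_induct)
  case empty
  note z = cylfuns_lims[OF cylfuns_const, of 0]
  show ?case using functional_lin(2)[OF \<phi> z z, of 0] z by simp
next
  case (insert u U)
  note Fu = cylfuns_lims[OF insert.prems[of u]]
  have bl: "(\<lambda>w. b u * F u w) \<in> sup.lims" using Fu by (intro lims_closed(3)) auto
  have IH: "(\<lambda>w. \<Sum>u\<in>U. b u * F u w) \<in> sup.lims"
    "\<phi> (sup.cls (\<lambda>w. \<Sum>u\<in>U. b u * F u w)) = (\<Sum>u\<in>U. b u * \<phi> (sup.cls (F u)))" using insert by auto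
  show ?case
    using functional_lin(1)[OF \<phi> bl IH(1)] functional_lin(2)[OF \<phi> Fu Fu, of "b u"] IH lims_closed(1)[OF bl IH(1)]
    by (simp add: insert.hyps)
qed

text \<open>A bounded functional is determined on elementary tensors: these span the cylinder functions,
  which are dense in the supremum norm.\<close>

lemma functional_eqI:
  assumes \<phi>: "\<phi> \<in> bounded_functionals \<A>" and \<psi>: "\<psi> \<in> bounded_functionals \<A>"
    and eq: "\<And>F a. F \<in> fin_subsets K \<Longrightarrow> \<phi> (sup.cls (cyl F (elem_tensor F a))) = \<psi> (sup.cls (cyl F (elem_tensor F a)))"
  shows "\<phi> = \<psi>"
proof (rule extensionalityI)
  show "\<phi> \<in> extensional (carrier \<A>)" "\<psi> \<in> extensional (carrier \<A>)"
    using \<phi> \<psi> by (simp_all add: bounded_functionals_def)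
  have cyl_eq: "\<phi> (sup.cls f) = \<psi> (sup.cls f)" if f: "f \<in> cylfuns" for f
  proof -
    obtain F b where F: "F \<in> fin_subsets K" and b: "b \<in> carrier (fin_tensor F)" and fb: "\<forall>\<omega>\<in>\<Omega>. f \<omega> = cyl F b \<omega>"
      using cylfunsD[OF f] by blast
    have Ff: "finite F" using F by (simp add: fin_subsets_def)
    define e where "e u = cyl F (elem_tensor F (\<lambda>i t. of_bool (t = u i)))" for u
    have ec: "e u \<in> cylfuns" for u unfolding e_def by (rule cyl_in_cylfuns[OF F])
    have fs: "\<forall>\<omega>\<in>\<Omega>. f \<omega> = (\<Sum>u\<in>cube F. b u * e u \<omega>)"
      using fb fin_tensor_elem_basis[OF Ff b restrict_cube] by (simp add: cyl_def e_def)
    note s1 = functional_sum[OF \<phi> finite_cube[OF Ff], of e b, OF ec]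
    note s2 = functional_sum[OF \<psi> finite_cube[OF Ff], of e b, OF ec]
    have "sup.cls f = sup.cls (\<lambda>w. \<Sum>u\<in>cube F. b u * e u w)"
      using fs cls_eq_iff_Omega[OF cylfuns_lims[OF f] conjunct1[OF s1]] by blast
    then show ?thesis using s1 s2 eq[OF F] by (simp add: e_def)
  qed
  fix x assume x: "x \<in> carrier \<A>"
  define f where "f = sup.rep x"
  have f: "f \<in> sup.lims" "x = sup.cls f" using rep_A[OF x] by (simp_all add: f_def)
  obtain s where s: "sup.conv s f" using f(1) by (auto simp: sup.lims_def)
  have sc: "s n \<in> carrier \<B>" and l: "(\<lambda>n. supn (\<lambda>w. frep (s n) w - f w)) \<longlonglongrightarrow> 0" for n
    using s by (auto simp: sup.conv_def)
  note c = frep(1)[OF sc]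
  have lim: "(\<lambda>n. \<zeta> (sup.cls (frep (s n)))) \<longlonglongrightarrow> \<zeta> (sup.cls f)" if \<zeta>: "\<zeta> \<in> bounded_functionals \<A>" for \<zeta>
  proof -
    obtain C where C: "\<forall>x\<in>carrier \<A>. cmod (\<zeta> x) \<le> C * nrm \<A> x"
      using \<zeta> unfolding bounded_functionals_def by blast
    have "norm (\<zeta> (sup.cls (frep (s n))) - \<zeta> (sup.cls f)) \<le> C * supn (\<lambda>w. frep (s n) w - f w)" for n
    proof -
      note g = cylfuns_lims[OF c[of n]]
      note mf = lims_closed(3)[OF f(1) f(1), of "- 1"]
      note d = lims_closed(1)[OF g mf]
      have "\<zeta> (sup.cls (\<lambda>w. frep (s n) w + - 1 * f w)) = \<zeta> (sup.cls (frep (s n))) - \<zeta> (sup.cls f)"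
        using functional_lin(1)[OF \<zeta> g mf] functional_lin(2)[OF \<zeta> f(1) f(1), of "- 1"] by simp
      then show ?thesis
        using bspec[OF C cls_carrier[OF d]] A_ops(7)[OF d d] by simp
    qed
    then have "(\<lambda>n. \<zeta> (sup.cls (frep (s n))) - \<zeta> (sup.cls f)) \<longlonglongrightarrow> 0"
      by (intro Lim_null_comparison[OF always_eventually tendsto_mult_right_zero[OF l]] allI)
    then show ?thesis by (simp add: LIM_zero_iff)
  qed
  have "(\<lambda>n. \<phi> (sup.cls (frep (s n)))) \<longlonglongrightarrow> \<psi> (sup.cls f)"
    using lim[OF \<psi>] cyl_eq[OF c] by simp
  then show "\<phi> x = \<psi> x" using LIMSEQ_unique[OF lim[OF \<phi>]] by (simp add: f(2))
qed

lemma product_state_eq: "product_state K = mean"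
  unfolding product_state_def
proof (rule the_equality)
  show "is_state \<A> mean \<and> (\<forall>F\<in>fin_subsets K. \<forall>a. mean (cstar_limit_inj (fin_subsets K) fin_tensor tensor_one F (elem_tensor F a))
      = (\<Prod>i\<in>F. half_trace (a i)))"
    using mean_state mean_elem_tensor by (simp add: cstar_limit_inj_eq elem_tensor_carrier)
  fix \<omega> assume w: "is_state \<A> \<omega> \<and> (\<forall>F\<in>fin_subsets K. \<forall>a. \<omega> (cstar_limit_inj (fin_subsets K) fin_tensor tensor_one F (elem_tensor F a))
      = (\<Prod>i\<in>F. half_trace (a i)))"
  show "\<omega> = mean"
  proof (rule functional_eqI[OF _ mean_bounded_functional])
    show "\<omega> \<in> bounded_functionals \<A>" using w by (simp add: is_state_def)
    show "\<omega> (sup.cls (cyl F (elem_tensor F a))) = mean (sup.cls (cyl F (elem_tensor F a)))" if F: "F \<in> fin_subsets K" for F a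
      using bspec[OF conjunct2[OF w] F, THEN spec, of a]
      unfolding cstar_limit_inj_eq[OF F elem_tensor_carrier] mean_elem_tensor[OF F] .
  qed
qed

lemma gns_seminorm_eq: "x \<in> carrier \<A> \<Longrightarrow> gns_seminorm \<A> mean x = l2n N (sup.rep x)"
  by (simp add: gns_seminorm_def mean_star_self)

lemma rep_sqint: "x \<in> carrier \<A> \<Longrightarrow> sqint N (sup.rep x)"
  by (rule nu.sqint_ess_bounded[OF rep_ess])

sublocale l2: seminorm_model \<A> "gns_seminorm \<A> mean" sup.rep "{f. sqint N f}" "l2n N"
proof unfold_locales
  show "sup.rep x \<in> {f. sqint N f}" if "x \<in> carrier \<A>" for x using rep_sqint[OF that] by simp
  show "gns_seminorm \<A> mean (x \<ominus>\<^bsub>\<A>\<^esub> y) = l2n N (\<lambda>w. sup.rep x w - sup.rep y w)" if "x \<in> carrier \<A>" "y \<in> carrier \<A>" for x y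
    unfolding gns_seminorm_eq[OF Am.minus_closed'[OF that]]
    using Am.theta_minus[OF that] by (intro l2n_Omega_cong) (simp add: eventually_principal)
  show "l2n N (\<lambda>w. f w - g w) = l2n N (\<lambda>w. g w - f w)" for f g by (rule l2n_commute)
  show "l2n N (\<lambda>w. f w - h w) \<le> l2n N (\<lambda>w. f w - g w) + l2n N (\<lambda>w. g w - h w)"
    if "f \<in> {f. sqint N f}" "g \<in> {f. sqint N f}" "h \<in> {f. sqint N f}" for f g h
    using that by (intro l2n_triangle_diff) auto
  show "\<exists>f. f \<in> {f. sqint N f} \<and> (\<lambda>n. l2n N (\<lambda>w. s n w - f w)) \<longlonglongrightarrow> 0"
    if "\<And>n. s n \<in> {f. sqint N f}" "\<And>e. 0 < e \<Longrightarrow> \<exists>K. \<forall>m\<ge>K. \<forall>n\<ge>K. l2n N (\<lambda>w. s m w - s n w) < e" for s :: "nat \<Rightarrow> _"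
    using nu.l2_complete[of s] that by simp
qed simp

text \<open>Density of the cylinder functions makes every square-integrable function a limit, so no
  part of L2 is missing from the GNS space.\<close>

lemma l2_lims: "l2.lims = {f. sqint N f}"
proof (rule equalityI; rule subsetI)
  fix f assume "f \<in> {f. sqint N f}"
  then have f: "sqint N f" by simp
  have "\<forall>n. \<exists>c. c \<in> cylfuns \<and> l2n N (\<lambda>w. c w - f w) < 1 / real (Suc n)"
    using cylfuns_dense[OF f] by (simp add: Bex_def)
  from choice[OF this] obtain c where c: "\<forall>n. c n \<in> cylfuns \<and> l2n N (\<lambda>w. c n w - f w) < 1 / real (Suc n)" ..
  have cl: "c n \<in> sup.lims" for n using c cylfuns_lims by blast
  have "(\<lambda>n. l2n N (\<lambda>w. sup.rep (sup.cls (c n)) w - f w)) \<longlonglongrightarrow> 0"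
  proof (rule tendsto_sandwich[OF _ _ tendsto_const LIMSEQ_Suc[OF lim_1_over_n]])
    have "l2n N (\<lambda>w. sup.rep (sup.cls (c n)) w - f w) = l2n N (\<lambda>w. c n w - f w)" for n
      by (rule l2n_Omega_cong) (use rep_cls_A[OF cl] in simp)
    then show "\<forall>\<^sub>F n in sequentially. l2n N (\<lambda>w. sup.rep (sup.cls (c n)) w - f w) \<le> 1 / real (Suc n)"
      using c by (intro always_eventually allI) (simp add: less_imp_le)
  qed simp
  then have "l2.conv (\<lambda>n. sup.cls (c n)) f" using f cl by (simp add: l2.conv_def cls_carrier)
  then show "f \<in> l2.lims" by (rule l2.conv_in_lims)
qed (use l2.lims_V in blast)

section \<open>The GNS space as L2 of the product measure\<close>

abbreviation "\<H> \<equiv> gns_space \<A> mean"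

lemma hcarrier_H: "hcarrier \<H> = l2.cls ` l2.lims"
  unfolding l2.cls_image[symmetric] by (simp add: gns_space_def Let_def)

lemma l2convD:
  assumes "l2.conv s f"
  shows "s n \<in> carrier \<A>" "sqint N f" "sqint N (\<lambda>w. sup.rep (s n) w - f w)" "(\<lambda>n. l2n N (\<lambda>w. sup.rep (s n) w - f w)) \<longlonglongrightarrow> 0"
  using assms by (auto simp: l2.conv_def intro: sqint_diff rep_sqint)

lemma l2convI:
  assumes "\<And>n. s n \<in> carrier \<A>" "sqint N f" "\<And>n. l2n N (\<lambda>w. sup.rep (s n) w - f w) \<le> b n" "b \<longlonglongrightarrow> 0"
  shows "l2.conv s f"
  unfolding l2.conv_def using assms(1,2)
  by (auto intro!: tendsto_sandwich[OF _ _ tendsto_const assms(4)] always_eventually assms(3))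

lemma l2conv_add:
  assumes s: "l2.conv s f" and t: "l2.conv t g"
  shows "l2.conv (\<lambda>n. s n \<oplus>\<^bsub>\<A>\<^esub> t n) (\<lambda>w. f w + g w)"
proof (rule l2convI)
  note S = l2convD[OF s] and T = l2convD[OF t]
  show "s n \<oplus>\<^bsub>\<A>\<^esub> t n \<in> carrier \<A>" for n by (intro Am.closed S T)
  show "sqint N (\<lambda>w. f w + g w)" by (intro sqint_add S T)
  show "(\<lambda>n. l2n N (\<lambda>w. sup.rep (s n) w - f w) + l2n N (\<lambda>w. sup.rep (t n) w - g w)) \<longlonglongrightarrow> 0"
    using tendsto_add[OF S(4) T(4)] by simp
  fix n
  have "l2n N (\<lambda>w. sup.rep (s n \<oplus>\<^bsub>\<A>\<^esub> t n) w - (f w + g w)) = l2n N (\<lambda>w. (sup.rep (s n) w - f w) + (sup.rep (t n) w - g w))"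
    using Am.theta_add[OF S(1) T(1), of n n] by (intro l2n_Omega_cong) (simp add: eventually_principal)
  then show "l2n N (\<lambda>w. sup.rep (s n \<oplus>\<^bsub>\<A>\<^esub> t n) w - (f w + g w)) \<le> l2n N (\<lambda>w. sup.rep (s n) w - f w) + l2n N (\<lambda>w. sup.rep (t n) w - g w)"
    using l2n_triangle[OF S(3) T(3)] by simp
qed

text \<open>Multiplication by \<open>a\<close> is bounded for the L2 norm by the norm of
  \<open>a\<close>, so it passes to limits; this is what makes \<open>gns_rep\<close> act by
  multiplication.\<close>

lemma l2conv_mult:
  assumes a: "a \<in> carrier \<A>" and s: "l2.conv s f"
  shows "l2.conv (\<lambda>n. a \<otimes>\<^bsub>\<A>\<^esub> s n) (\<lambda>w. sup.rep a w * f w)"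
proof (rule l2convI)
  note S = l2convD[OF s]
  show "a \<otimes>\<^bsub>\<A>\<^esub> s n \<in> carrier \<A>" for n by (intro Am.closed S a)
  show "sqint N (\<lambda>w. sup.rep a w * f w)" by (intro sqint_mult_ess rep_ess S a)
  show "(\<lambda>n. nrm \<A> a * l2n N (\<lambda>w. sup.rep (s n) w - f w)) \<longlonglongrightarrow> 0" by (rule tendsto_mult_right_zero[OF S(4)])
  fix n
  have "l2n N (\<lambda>w. sup.rep (a \<otimes>\<^bsub>\<A>\<^esub> s n) w - sup.rep a w * f w) = l2n N (\<lambda>w. sup.rep a w * (sup.rep (s n) w - f w))"
    using Am.theta_mult[OF a S(1), of n] by (intro l2n_Omega_cong) (simp add: eventually_principal right_diff_distrib)
  also have "\<dots> \<le> nrm \<A> a * l2n N (\<lambda>w. sup.rep (s n) w - f w)"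
  proof (rule l2n_mult_le[OF ess_bounded_measurable[OF rep_ess[OF a]] _ Am.nrm_pos[OF a] S(3)])
    show "AE w in N. cmod (sup.rep a w) \<le> nrm \<A> a"
      using Am.ev_le_nrm[OF a] by (intro AE_I2) (simp add: eventually_principal space_radon)
  qed
  finally show "l2n N (\<lambda>w. sup.rep (a \<otimes>\<^bsub>\<A>\<^esub> s n) w - sup.rep a w * f w) \<le> nrm \<A> a * l2n N (\<lambda>w. sup.rep (s n) w - f w)" .
qed

lemma l2conv_smult:
  assumes s: "l2.conv s f" shows "l2.conv (\<lambda>n. c \<odot>\<^bsub>\<A>\<^esub> s n) (\<lambda>w. c * f w)"
proof (rule l2convI)
  note S = l2convD[OF s]
  show "c \<odot>\<^bsub>\<A>\<^esub> s n \<in> carrier \<A>" for n by (intro Am.closed S)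
  show "sqint N (\<lambda>w. c * f w)" by (intro sqint_smult S)
  show "(\<lambda>n. cmod c * l2n N (\<lambda>w. sup.rep (s n) w - f w)) \<longlonglongrightarrow> 0" by (rule tendsto_mult_right_zero[OF S(4)])
  fix n
  have "l2n N (\<lambda>w. sup.rep (c \<odot>\<^bsub>\<A>\<^esub> s n) w - c * f w) = l2n N (\<lambda>w. c * (sup.rep (s n) w - f w))"
    using Am.theta_smult[OF S(1), of c n] by (intro l2n_Omega_cong) (simp add: eventually_principal right_diff_distrib)
  then show "l2n N (\<lambda>w. sup.rep (c \<odot>\<^bsub>\<A>\<^esub> s n) w - c * f w) \<le> cmod c * l2n N (\<lambda>w. sup.rep (s n) w - f w)"
    by (simp add: l2n_smult)
qed

lemma l2conv_const: "a \<in> carrier \<A> \<Longrightarrow> l2.conv (\<lambda>n. a) (sup.rep a)"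
  by (rule l2convI[where b = "\<lambda>n. 0"]) (auto simp: rep_sqint l2n_def)

text \<open>Replacing \<open>s n\<close> by \<open>f\<close> and then \<open>t n\<close> by
  \<open>g\<close> splits the error into two inner products, each small by the Cauchy-Schwarz
  inequality. The limit is the same for all representatives, as the description in
  \<open>gns_space\<close> requires.\<close>

lemma l2conv_inner:
  assumes s: "l2.conv s f" and t: "l2.conv t g"
  shows "(\<lambda>n. mean (star \<A> (t n) \<otimes>\<^bsub>\<A>\<^esub> s n)) \<longlonglongrightarrow> (\<integral>w. f w * cnj (g w) \<partial>N)"
proof -
  note S = l2convD[OF s] and T = l2convD[OF t]
  let ?x = "\<lambda>n. l2n N (\<lambda>w. sup.rep (s n) w - f w)" and ?y = "\<lambda>n. l2n N (\<lambda>w. sup.rep (t n) w - g w)"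
  have b: "norm (mean (star \<A> (t n) \<otimes>\<^bsub>\<A>\<^esub> s n) - (\<integral>w. f w * cnj (g w) \<partial>N)) \<le> ?x n * (?y n + l2n N g) + l2n N f * ?y n" for n
  proof -
    let ?S = "sup.rep (s n)" and ?T = "sup.rep (t n)"
    have sq: "sqint N ?S" "sqint N ?T" by (intro rep_sqint S T)+
    have i: "integrable N (\<lambda>w. u w * cnj (v w))" if "sqint N u" "sqint N v" for u v
      by (intro sqint_prod_integrable sqint_cnj that)
    have "mean (star \<A> (t n) \<otimes>\<^bsub>\<A>\<^esub> s n) - (\<integral>w. f w * cnj (g w) \<partial>N) = (\<integral>w. ?S w * cnj (?T w) - f w * cnj (g w) \<partial>N)"
      unfolding mean_star_mult[OF S(1) T(1)] by (rule Bochner_Integration.integral_diff[symmetric, OF i[OF sq] i[OF S(2) T(2)]])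
    also have "\<dots> = (\<integral>w. (?S w - f w) * cnj (?T w) + f w * cnj (?T w - g w) \<partial>N)"
      by (simp add: algebra_simps)
    also have "\<dots> = (\<integral>w. (?S w - f w) * cnj (?T w) \<partial>N) + (\<integral>w. f w * cnj (?T w - g w) \<partial>N)"
      by (rule Bochner_Integration.integral_add[OF i[OF S(3) sq(2)] i[OF S(2) T(3)]])
    finally have "norm (mean (star \<A> (t n) \<otimes>\<^bsub>\<A>\<^esub> s n) - (\<integral>w. f w * cnj (g w) \<partial>N))
        \<le> cmod (\<integral>w. (?S w - f w) * cnj (?T w) \<partial>N) + cmod (\<integral>w. f w * cnj (?T w - g w) \<partial>N)"
      by (simp only: norm_triangle_ineq)
    also have "\<dots> \<le> ?x n * l2n N ?T + l2n N f * ?y n"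
      by (intro add_mono l2_inner_bound S T sq)
    \<comment> \<open>The norm of the approximating element varies with \<open>n\<close>; in this
      form the bound visibly tends to 0.\<close>
    also have "l2n N ?T \<le> ?y n + l2n N g" using l2n_triangle[OF T(3) T(2), of n] by simp
    finally show ?thesis by (simp add: mult_left_mono)
  qed
  have "(\<lambda>n. ?x n * (?y n + l2n N g) + l2n N f * ?y n) \<longlonglongrightarrow> 0 * (0 + l2n N g) + l2n N f * 0"
    by (intro tendsto_intros S(4) T(4))
  then have "(\<lambda>n. ?x n * (?y n + l2n N g) + l2n N f * ?y n) \<longlonglongrightarrow> 0" by simp
  then have "(\<lambda>n. mean (star \<A> (t n) \<otimes>\<^bsub>\<A>\<^esub> s n) - (\<integral>w. f w * cnj (g w) \<partial>N)) \<longlonglongrightarrow> 0"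
    by (rule Lim_null_comparison[OF always_eventually, rotated]) (intro allI b)
  then show ?thesis by (simp add: LIM_zero_iff)
qed

lemma l2_rep:
  assumes "X \<in> hcarrier \<H>" shows "l2.rep X \<in> l2.lims" "l2.cls (l2.rep X) = X" "sqint N (l2.rep X)"
  using l2.rep[of X] assms l2_lims unfolding hcarrier_H by auto

lemma l2_cls_carrier: "sqint N f \<Longrightarrow> l2.cls f \<in> hcarrier \<H>"
  by (simp add: hcarrier_H l2_lims)

lemma l2_rep_cls:
  assumes f: "sqint N f" shows "AE w in N. l2.rep (l2.cls f) w = f w"
proof -
  have "l2n N (\<lambda>w. l2.rep (l2.cls f) w - f w) = 0" using f by (intro l2.rep_cls) (simp add: l2_lims)
  then have "AE w in N. l2.rep (l2.cls f) w - f w = 0"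
    using l2n_eq_0_iff[OF sqint_diff[OF l2_rep(3)[OF l2_cls_carrier[OF f]] f]] by simp
  then show ?thesis by eventually_elim simp
qed

lemma H_ops:
  assumes f: "f \<in> l2.lims" and g: "g \<in> l2.lims"
  shows "hadd \<H> (l2.cls f) (l2.cls g) = l2.cls (\<lambda>w. f w + g w)" "hscale \<H> c (l2.cls f) = l2.cls (\<lambda>w. c * f w)"
    "hzero \<H> = l2.cls (sup.rep \<zero>\<^bsub>\<A>\<^esub>)" "hinner \<H> (l2.cls f) (l2.cls g) = (\<integral>w. f w * cnj (g w) \<partial>N)"
proof -
  show "hadd \<H> (l2.cls f) (l2.cls g) = l2.cls (\<lambda>w. f w + g w)"
    using l2.cls_binop[OF f g l2conv_add] by (simp add: gns_space_def Let_def)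
  show "hscale \<H> c (l2.cls f) = l2.cls (\<lambda>w. c * f w)"
    using l2.cls_unop[OF f l2conv_smult] by (simp add: gns_space_def Let_def)
  show "hzero \<H> = l2.cls (sup.rep \<zero>\<^bsub>\<A>\<^esub>)"
    using l2.cauchy_class_conv[OF l2conv_const[OF Am.zero_closed]] by (simp add: gns_space_def Let_def)
  have lim: "(\<lambda>n. mean (star \<A> (t n) \<otimes>\<^bsub>\<A>\<^esub> s n)) \<longlonglongrightarrow> (\<integral>w. f w * cnj (g w) \<partial>N)" if "s \<in> l2.cls f" "t \<in> l2.cls g" for s t
    using that by (intro l2conv_inner) (simp_all add: l2.cls_def)
  have "(THE z. \<forall>s\<in>l2.cls f. \<forall>t\<in>l2.cls g. (\<lambda>n. mean (star \<A> (t n) \<otimes>\<^bsub>\<A>\<^esub> s n)) \<longlonglongrightarrow> z) = (\<integral>w. f w * cnj (g w) \<partial>N)"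
  proof (rule the_equality)
    fix z assume z: "\<forall>s\<in>l2.cls f. \<forall>t\<in>l2.cls g. (\<lambda>n. mean (star \<A> (t n) \<otimes>\<^bsub>\<A>\<^esub> s n)) \<longlonglongrightarrow> z"
    obtain s t where st: "s \<in> l2.cls f" "t \<in> l2.cls g" using l2.cls_nonempty[OF f] l2.cls_nonempty[OF g] by blast
    show "z = (\<integral>w. f w * cnj (g w) \<partial>N)" by (rule LIMSEQ_unique[OF _ lim[OF st]]) (use z st in blast)
  qed (use lim in blast)
  then show "hinner \<H> (l2.cls f) (l2.cls g) = (\<integral>w. f w * cnj (g w) \<partial>N)" by (simp add: gns_space_def Let_def)
qed

sublocale L: l2_model N \<H> l2.rep
proof unfold_locales
  note z = rep_sqint[OF Am.zero_closed]
  note zero = H_ops(3)[of "sup.rep \<zero>\<^bsub>\<A>\<^esub>" "sup.rep \<zero>\<^bsub>\<A>\<^esub>", unfolded l2_lims mem_Collect_eq, OF z z]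
  show "hzero \<H> \<in> hcarrier \<H>" unfolding zero by (rule l2_cls_carrier[OF z])
  show "AE w in N. l2.rep (hzero \<H>) w = 0"
  proof -
    have "AE w in N. sup.rep \<zero>\<^bsub>\<A>\<^esub> w = 0"
      using Am.theta_zero by (intro AE_I2) (simp add: eventually_principal space_radon)
    with l2_rep_cls[OF z] show ?thesis unfolding zero by eventually_elim simp
  qed
  show "\<exists>X\<in>hcarrier \<H>. AE w in N. l2.rep X w = f w" if "sqint N f" for f
    using l2_rep_cls[OF that] l2_cls_carrier[OF that] by blast
  fix X assume X: "X \<in> hcarrier \<H>"
  note x = l2_rep[OF X]
  show "sqint N (l2.rep X)" by (rule x)
  have sc: "hscale \<H> c X = l2.cls (\<lambda>w. c * l2.rep X w)" for c using H_ops(2)[OF x(1) x(1), of c] unfolding x(2) .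
  show "hscale \<H> c X \<in> hcarrier \<H>" for c unfolding sc by (intro l2_cls_carrier sqint_smult x)
  show "AE w in N. l2.rep (hscale \<H> c X) w = c * l2.rep X w" for c unfolding sc by (intro l2_rep_cls sqint_smult x)
  fix Y assume Y: "Y \<in> hcarrier \<H>"
  note y = l2_rep[OF Y]
  have ad: "hadd \<H> X Y = l2.cls (\<lambda>w. l2.rep X w + l2.rep Y w)" using H_ops(1)[OF x(1) y(1)] unfolding x(2) y(2) .
  show "hadd \<H> X Y \<in> hcarrier \<H>" unfolding ad by (intro l2_cls_carrier sqint_add x y)
  show "AE w in N. l2.rep (hadd \<H> X Y) w = l2.rep X w + l2.rep Y w" unfolding ad by (intro l2_rep_cls sqint_add x y)
  show "hinner \<H> X Y = (\<integral>w. l2.rep X w * cnj (l2.rep Y w) \<partial>N)" using H_ops(4)[OF x(1) y(1)] unfolding x(2) y(2) .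
  show "X = Y" if "AE w in N. l2.rep X w = l2.rep Y w"
  proof -
    have "AE w in N. l2.rep X w - l2.rep Y w = 0" using that by eventually_elim simp
    then have "l2n N (\<lambda>w. l2.rep X w - l2.rep Y w) = 0" by (subst l2n_eq_0_iff[OF sqint_diff[OF x(3) y(3)]])
    then show ?thesis using l2.cls_eq_iff[OF x(1) y(1)] unfolding x(2) y(2) by simp
  qed
qed

lemma gns_rep_eq:
  assumes a: "a \<in> carrier \<A>" shows "gns_rep \<A> mean a = L.mop (sup.rep a)"
proof (rule L.mop_eqI[OF rep_ess[OF a]])
  show "gns_rep \<A> mean a \<in> extensional (hcarrier \<H>)" by (simp add: gns_rep_def)
  fix X assume X: "X \<in> hcarrier \<H>"
  note x = l2_rep[OF X]
  have eq: "gns_rep \<A> mean a X = l2.cls (\<lambda>w. sup.rep a w * l2.rep X w)"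
    using l2.cls_unop[OF x(1) l2conv_mult[OF a]] X unfolding x(2) by (simp add: gns_rep_def)
  note sq = sqint_mult_ess[OF rep_ess[OF a] x(3)]
  show "gns_rep \<A> mean a X \<in> hcarrier \<H>" unfolding eq by (rule l2_cls_carrier[OF sq])
  show "AE w in N. l2.rep (gns_rep \<A> mean a X) w = sup.rep a w * l2.rep X w" unfolding eq by (rule l2_rep_cls[OF sq])
qed

text \<open>Every vector is a limit of elements of the C*-algebra by construction, so their
  representatives are dense in L2 and the computation of the bicommutant applies.\<close>

lemma tensor_vn_algebra_eq: "tensor_vn_algebra K = operator_algebra \<H> (L.mop ` ess_bounded N)"
proof -
  have "gns_rep \<A> mean ` carrier \<A> = L.mop ` (sup.rep ` carrier \<A>)" by (auto simp: gns_rep_eq)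
  moreover have "L.dense (sup.rep ` carrier \<A>)"
    unfolding L.dense_def
  proof (intro allI impI)
    fix f assume "sqint N f"
    then obtain s where s: "l2.conv s f" using l2_lims by (auto simp: l2.lims_def)
    show "\<exists>c. (\<forall>n::nat. c n \<in> sup.rep ` carrier \<A>) \<and> (\<lambda>n. l2n N (\<lambda>w. c n w - f w)) \<longlonglongrightarrow> 0"
      using l2convD(1,4)[OF s] by (intro exI[of _ "\<lambda>n. sup.rep (s n)"]) auto
  qed
  ultimately show ?thesis
    using L.bicommutant_mop[of "sup.rep ` carrier \<A>"] rep_ess
    by (simp add: tensor_vn_algebra_def product_state_eq gns_algebra_def Let_def image_subset_iff)
qed

lemma gns_vector_eq: "gns_vector \<A> mean = L.cyc"
proof (rule L.lift_eqI)
  note o = rep_sqint[OF Am.one_closed]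
  have eq: "gns_vector \<A> mean = l2.cls (sup.rep \<one>\<^bsub>\<A>\<^esub>)"
    unfolding gns_vector_def by (rule l2.cauchy_class_conv[OF l2conv_const[OF Am.one_closed]])
  show "gns_vector \<A> mean \<in> hcarrier \<H>" unfolding eq by (rule l2_cls_carrier[OF o])
  have "AE w in N. sup.rep \<one>\<^bsub>\<A>\<^esub> w = 1"
    using Am.theta_one by (intro AE_I2) (simp add: eventually_principal space_radon)
  with l2_rep_cls[OF o] show "AE w in N. l2.rep (gns_vector \<A> mean) w = 1" unfolding eq by eventually_elim simp
qed (rule L.cyc)+

text \<open>The vector state at the constant function 1 integrates the value of the operator there,
  which is its symbol.\<close>

lemma tensor_vn_trace_eq:
  assumes R: "R \<in> carrier (tensor_vn_algebra K)"
  shows "tensor_vn_trace K R = (\<integral>w. l2.rep (R L.cyc) w \<partial>N)"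
proof -
  obtain f where f: "f \<in> ess_bounded N" "R = L.mop f"
    using R unfolding tensor_vn_algebra_eq by (auto simp: operator_algebra_def)
  have c: "R L.cyc \<in> hcarrier \<H>" unfolding f(2) by (rule L.mop(1)[OF f(1) L.cyc(1)])
  have "tensor_vn_trace K R = (\<integral>w. l2.rep (R L.cyc) w * cnj (l2.rep L.cyc w) \<partial>N)"
    unfolding tensor_vn_trace_def product_state_eq gns_functional_def gns_vector_eq
    by (rule L.hinner_eq[OF c L.cyc(1)])
  also have "\<dots> = (\<integral>w. l2.rep (R L.cyc) w \<partial>N)"
  proof (rule integral_cong_AE)
    show "AE w in N. l2.rep (R L.cyc) w * cnj (l2.rep L.cyc w) = l2.rep (R L.cyc) w"
      using L.cyc(2) by eventually_elim simp
  qed (use L.lift_meas[OF c] L.lift_meas[OF L.cyc(1)] in measurable)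
  finally show ?thesis .
qed

text \<open>Both sides are copies of L-infinity of the same measure, one evaluated through the
  symbol of an operator, the other through a representative of a class.\<close>

theorem tensor_isomorphic_Linf:
  "vn_measure_isomorphic (tensor_vn_algebra K, functional_weight (tensor_vn_trace K))
     (Linf (product_measure K), functional_weight (Linf_integral (product_measure K)))"
  unfolding product_measure_eq
proof (rule linf_models_isomorphic)
  show "linf_model N (tensor_vn_algebra K) (\<lambda>R. l2.rep (R L.cyc))"
    unfolding tensor_vn_algebra_eq by (rule L.linf_model_operator_algebra)
  show "linf_model N (Linf N) (ae_rep N)" by (rule linf_model_Linf[OF prob_space_N])
qed (simp_all add: tensor_vn_trace_eq Linf_integral_eq)

end

theorem corollary9p24:
  fixes \<kappa> :: "'k rel"
  assumes "Cinfinite \<kappa>"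
  shows "vn_measure_isomorphic
           (tensor_vn_algebra (Field \<kappa>), functional_weight (tensor_vn_trace (Field \<kappa>)))
           (Linf (product_measure (Field \<kappa>)), functional_weight (Linf_integral (product_measure (Field \<kappa>))))"
  by (rule coin_space.tensor_isomorphic_Linf)

end
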